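(* Given a facet $F$ of the Voronoi polyhedron $\Pi$, all its neighbors (facets of $\Pi$ meeting $F$ along a codimension-two face of $\Pi$) may be determined in a finite number of steps.
   Context: $V$ is a real vector space with a ${\mathbb Q}$-structure, $C\subset V$ an open self-adjoint homogeneous cone with respect to a scalar product $\langle\,,\,\rangle$ defined over ${\mathbb Q}$, such that the connected linear automorphism group of $C$ is defined by rational equations. $\Xi(C)$ is the set of cusps (one-dimensional rational boundary components of $C$), $L\subset V({\mathbb Q})$ a lattice, $L'=L-\{0\}$, and the Voronoi polyhedron $\Pi$ is the closed convex hull of $L'\cap\Xi(C)$. Each facet $F$ has a perfect form $y_F\in C\cap V({\mathbb Q})$ with $F=\{x\in\Pi:\langle x,y_F\rangle=1\}$ and $\langle x,y_F\rangle>1$ on $\Pi-F$, and a finite set of minimal vectors $Z_F=\{z\in L'\cap\Xi(C):\langle z,y_F\rangle=1\}$ whose convex hull is $F$. The facet $F$ is assumed given via $y_F$ and $Z_F$. *)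

theory Defs
  imports "HOL-Analysis.Analysis" "HOL-Library.Nat_Bijection"
begin

section \<open>Rational structures and lattices\<close>

text \<open>The real vector space with its scalar product is an arbitrary Euclidean space; the
  rational structure is independent of the standard basis of that space and is given by a
  real basis \<open>bs\<close> whose rational span is \<open>V(\<rat>)\<close>.\<close>

definition is_basis_list :: "'a::euclidean_space list \<Rightarrow> bool" where
  "is_basis_list bs \<longleftrightarrow> distinct bs \<and> independent (set bs) \<and> span (set bs) = UNIV"

definition rat_vec :: "'a::euclidean_space list \<Rightarrow> rat list \<Rightarrow> 'a" where
  "rat_vec bs qs = (\<Sum>i<length bs. of_rat (qs ! i) *\<^sub>R bs ! i)"

definition rational_points :: "'a::euclidean_space list \<Rightarrow> 'a set" where
  "rational_points bs = {rat_vec bs qs | qs. length qs = length bs}"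

definition inner_rational :: "'a::euclidean_space list \<Rightarrow> bool" where
  "inner_rational bs \<longleftrightarrow> (\<forall>b\<in>set bs. \<forall>c\<in>set bs. b \<bullet> c \<in> \<rat>)"

definition rational_lattice :: "'a::euclidean_space list \<Rightarrow> 'a set \<Rightarrow> bool" where
  "rational_lattice bs L \<longleftrightarrow> L \<subseteq> rational_points bs \<and>
     (\<exists>B. independent B \<and> span B = UNIV \<and>
          L = {\<Sum>b\<in>B. of_int (k b) *\<^sub>R b | k :: 'a \<Rightarrow> int. True})"

definition rational_subspace :: "'a::euclidean_space list \<Rightarrow> 'a set \<Rightarrow> bool" where
  "rational_subspace bs W \<longleftrightarrow> subspace W \<and> span (W \<inter> rational_points bs) = W"


section \<open>Self-adjoint homogeneous cones\<close>

definition open_cone :: "'a::euclidean_space set \<Rightarrow> bool" where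
  "open_cone C \<longleftrightarrow> open C \<and> C \<noteq> {} \<and> convex C \<and> (\<forall>x\<in>C. \<forall>t>0. t *\<^sub>R x \<in> C)"

definition self_adjoint :: "'a::euclidean_space set \<Rightarrow> bool" where
  "self_adjoint C \<longleftrightarrow> C = {y. \<forall>x\<in>closure C - {0}. x \<bullet> y > 0}"

definition aut_group :: "'a::euclidean_space set \<Rightarrow> ('a \<Rightarrow>\<^sub>L 'a) set" where
  "aut_group C = {g. bij (blinfun_apply g) \<and> blinfun_apply g ` C = C}"

definition homogeneous :: "'a::euclidean_space set \<Rightarrow> bool" where
  "homogeneous C \<longleftrightarrow> (\<forall>x\<in>C. \<forall>y\<in>C. \<exists>g\<in>aut_group C. blinfun_apply g x = y)"

text \<open>Polynomials with rational coefficients in the matrix entries of an endomorphism, the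
  matrix being taken with respect to \<open>bs\<close>.\<close>

inductive rational_poly :: "'a::euclidean_space list \<Rightarrow> (('a \<Rightarrow>\<^sub>L 'a) \<Rightarrow> real) \<Rightarrow> bool"
  for bs where
  const: "c \<in> \<rat> \<Longrightarrow> rational_poly bs (\<lambda>g. c)"
| entry: "b \<in> set bs \<Longrightarrow> c \<in> set bs \<Longrightarrow>
    rational_poly bs (\<lambda>g. representation (set bs) (blinfun_apply g b) c)"
| add: "rational_poly bs p \<Longrightarrow> rational_poly bs q \<Longrightarrow> rational_poly bs (\<lambda>g. p g + q g)"
| mult: "rational_poly bs p \<Longrightarrow> rational_poly bs q \<Longrightarrow> rational_poly bs (\<lambda>g. p g * q g)"

definition linear_group :: "('a::euclidean_space \<Rightarrow>\<^sub>L 'a) set \<Rightarrow> bool" where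
  "linear_group H \<longleftrightarrow> id_blinfun \<in> H \<and> (\<forall>g\<in>H. \<forall>h\<in>H. g o\<^sub>L h \<in> H) \<and>
     (\<forall>g\<in>H. \<exists>h\<in>H. g o\<^sub>L h = id_blinfun \<and> h o\<^sub>L g = id_blinfun)"

text \<open>The identity component of the automorphism group need not itself be the zero set of
  polynomials (already multiplication by \<open>t > 0\<close> on a line is not); as usual for real groups,
  being defined over \<open>\<rat>\<close> means being the identity component of the real points of a linear
  algebraic group given by rational equations.\<close>

definition aut_defined_over_rat :: "'a::euclidean_space list \<Rightarrow> 'a set \<Rightarrow> bool" where
  "aut_defined_over_rat bs C \<longleftrightarrow>
     (\<exists>P H. (\<forall>p\<in>P. rational_poly bs p) \<and>
        H = {g. bij (blinfun_apply g) \<and> (\<forall>p\<in>P. p g = 0)} \<and> linear_group H \<and>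
        connected_component_set (aut_group C) id_blinfun = connected_component_set H id_blinfun)"


section \<open>Cusps and the Voronoi polyhedron\<close>

text \<open>A boundary component is the interior, relative to its linear span, of the intersection of
  the closed cone with a supporting hyperplane; it is rational if that span is.  (The
  intersection contains 0, so its linear span and its affine hull agree.)\<close>

definition boundary_component :: "'a::euclidean_space set \<Rightarrow> 'a set \<Rightarrow> bool" where
  "boundary_component C K \<longleftrightarrow>
     (\<exists>a. a \<noteq> 0 \<and> {x. a \<bullet> x = 0} \<inter> C = {} \<and> K = rel_interior ({x. a \<bullet> x = 0} \<inter> closure C))"

definition cusps :: "'a::euclidean_space list \<Rightarrow> 'a set \<Rightarrow> 'a set set" where
  "cusps bs C = {K. boundary_component C K \<and> rational_subspace bs (span K) \<and> dim K = 1}"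

definition cusp_vectors :: "'a::euclidean_space list \<Rightarrow> 'a set \<Rightarrow> 'a set \<Rightarrow> 'a set" where
  "cusp_vectors bs C L = (L - {0}) \<inter> \<Union> (cusps bs C)"

definition voronoi_polyhedron :: "'a::euclidean_space list \<Rightarrow> 'a set \<Rightarrow> 'a set \<Rightarrow> 'a set" where
  "voronoi_polyhedron bs C L = closure (convex hull (cusp_vectors bs C L))"

definition perfect_form ::
    "'a::euclidean_space list \<Rightarrow> 'a set \<Rightarrow> 'a set \<Rightarrow> 'a set \<Rightarrow> 'a \<Rightarrow> bool" where
  "perfect_form bs C L F y \<longleftrightarrow> y \<in> C \<inter> rational_points bs \<and>
     F = {x \<in> voronoi_polyhedron bs C L. x \<bullet> y = 1} \<and>
     (\<forall>x \<in> voronoi_polyhedron bs C L - F. x \<bullet> y > 1)"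

definition minimal_vectors :: "'a::euclidean_space list \<Rightarrow> 'a set \<Rightarrow> 'a set \<Rightarrow> 'a \<Rightarrow> 'a set" where
  "minimal_vectors bs C L y = {z \<in> cusp_vectors bs C L. z \<bullet> y = 1}"

definition neighbor :: "'a::euclidean_space set \<Rightarrow> 'a set \<Rightarrow> 'a set \<Rightarrow> bool" where
  "neighbor P F F' \<longleftrightarrow> F' facet_of P \<and> F' \<noteq> F \<and>
     (F \<inter> F') face_of P \<and> aff_dim (F \<inter> F') = aff_dim P - 2"


section \<open>Facets as finite data\<close>

text \<open>A facet is given by the coordinates of its perfect form and of its minimal vectors, the
  latter listed in any order.\<close>

type_synonym facet_data = "rat list \<times> rat list list"

definition represents_facet ::
    "'a::euclidean_space list \<Rightarrow> 'a set \<Rightarrow> 'a set \<Rightarrow> facet_data \<Rightarrow> 'a set \<Rightarrow> bool" where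
  "represents_facet bs C L d F \<longleftrightarrow>
     F facet_of voronoi_polyhedron bs C L \<and>
     length (fst d) = length bs \<and> (\<forall>q\<in>set (snd d). length q = length bs) \<and>
     perfect_form bs C L F (rat_vec bs (fst d)) \<and>
     rat_vec bs ` set (snd d) = minimal_vectors bs C L (rat_vec bs (fst d)) \<and>
     convex hull (minimal_vectors bs C L (rat_vec bs (fst d))) = F"

definition code_rat :: "rat \<Rightarrow> nat" where
  "code_rat q = prod_encode (int_encode (fst (quotient_of q)), int_encode (snd (quotient_of q)))"

definition code_vec :: "rat list \<Rightarrow> nat" where
  "code_vec q = list_encode (map code_rat q)"

definition code_facet :: "facet_data \<Rightarrow> nat" where
  "code_facet d = prod_encode (code_vec (fst d), list_encode (map code_vec (snd d)))"

definition code_facets :: "facet_data list \<Rightarrow> nat" where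
  "code_facets ds = list_encode (map code_facet ds)"


section \<open>Algorithms\<close>

text \<open>Programs for partial recursive functions relative to oracles: \<open>Query i\<close> asks the
  \<open>i\<close>-th oracle.  \<open>evaluates orc p xs v\<close> says that the program halts on the arguments \<open>xs\<close>
  after finitely many steps with result \<open>v\<close>.  In \<open>PrimRec\<close> the recursion argument comes first
  and the step function receives the counter, the previous value and the parameters;
  \<open>Minimize\<close> searches for the least zero in the first argument.\<close>

datatype program =
    Zero | Succ | Proj nat | Query nat
  | Comp program "program list" | PrimRec program program | Minimize program

inductive evaluates :: "(nat \<Rightarrow> nat \<Rightarrow> nat) \<Rightarrow> program \<Rightarrow> nat list \<Rightarrow> nat \<Rightarrow> bool"
  for orc where
  zero: "evaluates orc Zero xs 0"
| succ: "evaluates orc Succ [x] (Suc x)"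
| proj: "i < length xs \<Longrightarrow> evaluates orc (Proj i) xs (xs ! i)"
| query: "evaluates orc (Query i) [x] (orc i x)"
| comp: "list_all2 (\<lambda>q y. evaluates orc q xs y) qs ys \<Longrightarrow> evaluates orc p ys v \<Longrightarrow>
    evaluates orc (Comp p qs) xs v"
| rec_0: "evaluates orc p xs v \<Longrightarrow> evaluates orc (PrimRec p q) (0 # xs) v"
| rec_Suc: "evaluates orc (PrimRec p q) (n # xs) u \<Longrightarrow> evaluates orc q (n # u # xs) v \<Longrightarrow>
    evaluates orc (PrimRec p q) (Suc n # xs) v"
| minimize: "evaluates orc p (n # xs) 0 \<Longrightarrow> (\<And>m. m < n \<Longrightarrow> \<exists>k. evaluates orc p (m # xs) (Suc k)) \<Longrightarrow>
    evaluates orc (Minimize p) xs n"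

text \<open>Programs have a unique result.\<close>

lemma evaluates_unique:
  "evaluates orc p xs v \<Longrightarrow> evaluates orc p xs w \<Longrightarrow> v = w"
proof (induction arbitrary: w rule: evaluates.induct)
  case (comp xs qs ys p v)
  from comp.prems obtain zs where zs: "list_all2 (\<lambda>q y. evaluates orc q xs y) qs zs"
    and w: "evaluates orc p zs w"
    by cases auto
  have "ys = zs"
    using comp.IH(1) zs by (intro nth_equalityI) (auto simp: list_all2_conv_all_nth)
  then show ?case using comp.IH(2) w by blast
next
  case (rec_0 p xs v q)
  from rec_0.prems rec_0.IH show ?case by cases auto
next
  case (rec_Suc p q n xs u v)
  from rec_Suc.prems show ?case
    by cases (use rec_Suc.IH in blast)
next
  case (minimize p n xs)
  from minimize.prems have w: "evaluates orc p (w # xs) 0"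
    "\<And>m. m < w \<Longrightarrow> \<exists>k. evaluates orc p (m # xs) (Suc k)"
    by (cases, auto)+
  have "\<not> w < n" using minimize.IH(2) w(1) by fastforce
  moreover have "\<not> n < w" using minimize.IH(1) w(2) by fastforce
  ultimately show ?case by simp
qed (auto elim: evaluates.cases)

text \<open>The only access an algorithm has to the cone beyond finitely many constants: deciding for
  a rational vector whether it lies in \<open>C\<close> (oracle 0) or on a cusp (oracle 1).\<close>

definition cone_oracle :: "'a::euclidean_space list \<Rightarrow> 'a set \<Rightarrow> nat \<Rightarrow> nat \<Rightarrow> nat" where
  "cone_oracle bs C i k =
     (if \<exists>q. length q = length bs \<and> k = code_vec q \<and>
           rat_vec bs q \<in> (if i = 0 then C else \<Union> (cusps bs C)) then 1 else 0)"

end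

theory Submission
  imports Defs
begin

text \<open>Let \<open>m\<close> be the dimension of the span of the cusp vectors, and let \<open>F\<close> have perfect form
  \<open>y\<close> and minimal vectors \<open>Z\<close>.  For \<open>m - 1\<close> vectors \<open>S\<close> of \<open>Z\<close>, either some functional vanishing
  on \<open>S\<close> takes both signs on \<open>Z\<close>, and then \<open>S\<close> does not span a codimension-two face, or there is
  a neighbor of \<open>F\<close> across \<open>S\<close>.  The latter is found as in Voronoi's algorithm: if \<open>r\<close> vanishes on
  \<open>S\<close> and is nonnegative on \<open>Z\<close>, increase \<open>t\<close> as long as \<open>y + t r\<close> is at least 1 on all cusp
  vectors.  If the process did not stop at a new cusp vector, the limiting hyperplane would cut
  out an unbounded facet, but every facet has a perfect form in \<open>C\<close> and is therefore bounded.
  So reduction theory is not needed.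

  Both alternatives have finite rational certificates that can be verified with the two oracles:
  a sign-changing functional can be approximated by a rational one, and the minimal vectors of a
  rational \<open>y' \<in> C\<close> lie in an explicit box of lattice points.  The algorithm searches for a list of
  facets together with certificates covering all tuples \<open>S\<close>.\<close>

section \<open>Computability\<close>

text \<open>The constants \<open>m\<close>, \<open>G\<close>, \<open>M\<close>, \<open>l\<close>,
  \<open>K\<close>, \<open>e\<close> belong to the cone and the lattice and are built into the
  program; only the facet is input. The search has no a priori bound, so two facts are needed: an
  accepted certificate is right, and every facet has one. An accepted list is complete for the
  following reason. A neighbor meets F in a face spanned by m - 1 independent minimal vectors of F.
  Such a tuple S admits no sign-changing functional, so some listed facet contains S; and at most
  one neighbor does. The box of lattice points comes from the openness of C: for large N the point N
  y - e lies in C, so a cusp vector z with z \<bullet> y \<le> 1 satisfies z \<bullet> e \<le> N,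
  and z \<bullet> e dominates the norm of z on the closed cone. In making certificates rational the
  obstacle is exactness: a rational functional must vanish wherever the real one does, so mere
  density is too weak. The limiting form y + t r never enters a certificate; it only exhibits a
  facet, whose rational form comes from the hypothesis on facets.\<close>

definition nary :: "(nat \<Rightarrow> nat \<Rightarrow> nat) \<Rightarrow> nat \<Rightarrow> (nat list \<Rightarrow> nat) \<Rightarrow> bool" where
  "nary orc n f \<longleftrightarrow> (\<exists>p. \<forall>xs. length xs = n \<longrightarrow> evaluates orc p xs (f xs))"

lemma nary_proj: "i < n \<Longrightarrow> nary orc n (\<lambda>xs. xs ! i)"
  unfolding nary_def by (metis evaluates.proj)

lemma nary_comp:
  assumes g: "nary orc (length fs) g" and fs: "\<And>f. f \<in> set fs \<Longrightarrow> nary orc n f"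
  shows "nary orc n (\<lambda>xs. g (map (\<lambda>f. f xs) fs))"
proof -
  obtain p where p: "length xs = length fs \<Longrightarrow> evaluates orc p xs (g xs)" for xs
    using g unfolding nary_def by blast
  have "\<forall>f\<in>set fs. \<exists>q. \<forall>xs. length xs = n \<longrightarrow> evaluates orc q xs (f xs)"
    using fs unfolding nary_def by blast
  then obtain q where q: "\<And>f xs. f \<in> set fs \<Longrightarrow> length xs = n \<Longrightarrow> evaluates orc (q f) xs (f xs)"
    by metis
  have "evaluates orc (Comp p (map q fs)) xs (g (map (\<lambda>f. f xs) fs))" if "length xs = n" for xs
    by (rule evaluates.comp[OF _ p]) (auto simp: list_all2_conv_all_nth intro!: q that)
  then show ?thesis unfolding nary_def by blast
qed

lemma nary_comp1: "nary orc 1 g \<Longrightarrow> nary orc n f \<Longrightarrow> nary orc n (\<lambda>xs. g [f xs])"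
  using nary_comp[of orc "[f]" g n] by simp

lemma nary_comp2:
  "nary orc 2 g \<Longrightarrow> nary orc n f1 \<Longrightarrow> nary orc n f2 \<Longrightarrow> nary orc n (\<lambda>xs. g [f1 xs, f2 xs])"
  using nary_comp[of orc "[f1, f2]" g n] by (auto simp: numeral_2_eq_2)

lemma nary_Suc: "nary orc n f \<Longrightarrow> nary orc n (\<lambda>xs. Suc (f xs))"
proof -
  have "nary orc 1 (\<lambda>xs. Suc (xs ! 0))"
    unfolding nary_def using evaluates.succ by (metis One_nat_def length_0_conv length_Suc_conv nth_Cons_0)
  then show "nary orc n f \<Longrightarrow> ?thesis" using nary_comp1 by fastforce
qed

lemma nary_const: "nary orc n (\<lambda>_. k)"
proof (induction k)
  case 0
  show ?case unfolding nary_def using evaluates.zero by blast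
qed (rule nary_Suc)

lemma nary_primrec:
  assumes f: "nary orc n f" and g: "nary orc (Suc (Suc n)) g"
  shows "nary orc (Suc n) (\<lambda>xs. rec_nat (f (tl xs)) (\<lambda>k r. g (k # r # tl xs)) (xs ! 0))"
proof -
  obtain p where p: "length xs = n \<Longrightarrow> evaluates orc p xs (f xs)" for xs
    using f unfolding nary_def by blast
  obtain q where q: "length xs = Suc (Suc n) \<Longrightarrow> evaluates orc q xs (g xs)" for xs
    using g unfolding nary_def by blast
  have "evaluates orc (PrimRec p q) (k # xs) (rec_nat (f xs) (\<lambda>k r. g (k # r # xs)) k)"
    if "length xs = n" for k xs
    by (induction k) (use that p q in \<open>auto intro: evaluates.rec_0 evaluates.rec_Suc\<close>)
  then have "evaluates orc (PrimRec p q) xs (rec_nat (f (tl xs)) (\<lambda>k r. g (k # r # tl xs)) (xs ! 0))"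
    if "length xs = Suc n" for xs
    using that by (cases xs) auto
  then show ?thesis unfolding nary_def by blast
qed

lemma nary_add:
  assumes "nary orc n f" "nary orc n g"
  shows "nary orc n (\<lambda>xs. f xs + g xs)"
proof -
  have eq: "rec_nat b (\<lambda>_. Suc) a = a + b" for a b :: nat by (induction a) auto
  have "nary orc 2 (\<lambda>xs. rec_nat (tl xs ! 0) (\<lambda>k r. Suc ((k # r # tl xs) ! 1)) (xs ! 0))"
    unfolding numeral_2_eq_2 by (intro nary_primrec nary_Suc nary_proj) auto
  from nary_comp2[OF this assms] show ?thesis by (simp add: eq)
qed

lemma nary_pred:
  assumes "nary orc n f"
  shows "nary orc n (\<lambda>xs. f xs - 1)"
proof -
  have eq: "rec_nat 0 (\<lambda>k r. k) a = a - 1" for a :: nat by (cases a) auto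
  have "nary orc 1 (\<lambda>xs. rec_nat ((\<lambda>_. 0) (tl xs)) (\<lambda>k r. (k # r # tl xs) ! 0) (xs ! 0))"
    unfolding One_nat_def by (intro nary_primrec nary_const nary_proj) auto
  from nary_comp1[OF this assms] show ?thesis by (simp add: eq)
qed

lemma nary_diff:
  assumes "nary orc n f" "nary orc n g"
  shows "nary orc n (\<lambda>xs. f xs - g xs)"
proof -
  have eq: "rec_nat a (\<lambda>_ r. r - Suc 0) b = a - b" for a b :: nat by (induction b) auto
  have "nary orc 2 (\<lambda>xs. rec_nat (tl xs ! 0) (\<lambda>k r. (k # r # tl xs) ! 1 - 1) (xs ! 0))"
    unfolding numeral_2_eq_2 by (intro nary_primrec nary_pred nary_proj) auto
  \<comment> \<open>The recursion runs over the first argument, here the subtrahend, hence the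
    swapped arguments.\<close>
  from nary_comp2[OF this assms(2,1)] show ?thesis by (simp add: eq)
qed

lemma nary_triangle:
  assumes "nary orc n f"
  shows "nary orc n (\<lambda>xs. triangle (f xs))"
proof -
  have eq: "rec_nat 0 (\<lambda>k r. r + Suc k) a = triangle a" for a :: nat by (induction a) auto
  have "nary orc 1 (\<lambda>xs. rec_nat ((\<lambda>_. 0) (tl xs))
          (\<lambda>k r. (k # r # tl xs) ! 1 + Suc ((k # r # tl xs) ! 0)) (xs ! 0))"
    unfolding One_nat_def by (intro nary_primrec nary_add nary_Suc nary_const nary_proj) auto
  from nary_comp1[OF this assms] eq show ?thesis by simp
qed

lemma nary_prod_encode:
  assumes "nary orc n f" "nary orc n g"
  shows "nary orc n (\<lambda>xs. prod_encode (f xs, g xs))"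
  unfolding prod_encode_def case_prod_conv by (intro nary_add nary_triangle assms)

lemma program_prod_encode:
  "\<exists>p. \<forall>a b. evaluates orc p [a, b] (prod_encode (a, b))"
proof -
  have "nary orc 2 (\<lambda>xs. prod_encode (xs ! 0, xs ! 1))"
    by (intro nary_prod_encode nary_proj) auto
  then obtain p where p: "length xs = 2 \<Longrightarrow> evaluates orc p xs (prod_encode (xs ! 0, xs ! 1))" for xs
    unfolding nary_def by blast
  have "evaluates orc p [a, b] (prod_encode (a, b))" for a b
    using p[of "[a, b]"] by simp
  then show ?thesis by blast
qed

lemma program_proj: "evaluates orc (Proj 0) (x # xs) x"
  using evaluates.proj[of 0 "x # xs"] by simp

lemma evaluates_Least:
  assumes p: "\<And>n. evaluates orc p (n # xs) (h n)" and ex: "\<exists>n. h n = 0"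
  shows "evaluates orc (Minimize p) xs (LEAST n. h n = 0)"
proof (rule evaluates.minimize)
  show "evaluates orc p ((LEAST n. h n = 0) # xs) 0"
    using p LeastI_ex[OF ex] by metis
  show "\<exists>k. evaluates orc p (m # xs) (Suc k)" if "m < (LEAST n. h n = 0)" for m
    using p[of m] not_less_Least[OF that] by (metis old.nat.exhaust)
qed

text \<open>\<open>prod_encode (a, b)\<close> is \<open>triangle (a + b) + a\<close> and lies below
  the next triangular number. So the diagonal \<open>a + b\<close> of a pair can be recovered by
  \<open>Minimize\<close>.\<close>

lemma Least_triangle: "(LEAST s. triangle (a + b) + a < triangle (Suc s)) = a + b"
proof (rule Least_equality)
  fix s assume *: "triangle (a + b) + a < triangle (Suc s)"
  have "mono triangle" by (rule incseq_SucI) simp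
  then have "triangle (Suc s) \<le> triangle (a + b)" if "Suc s \<le> a + b"
    using that by (rule monoD)
  then show "a + b \<le> s" using * by (meson le_add1 not_less_eq_eq not_le order_trans)
qed simp

lemma nary_prod_decode:
  assumes "nary orc n f"
  shows "nary orc n (\<lambda>xs. fst (prod_decode (f xs)))" "nary orc n (\<lambda>xs. snd (prod_decode (f xs)))"
proof -
  \<comment> \<open>\<open>h [s, k]\<close> vanishes exactly when
    \<open>k < triangle (Suc s)\<close>; the search argument comes first, as in
    \<open>Minimize\<close>.\<close>
  define h where "h = (\<lambda>xs. Suc (xs ! 1) - triangle (Suc (xs ! 0)))"
  have "nary orc 2 h"
    unfolding h_def by (intro nary_diff nary_Suc nary_triangle nary_proj) auto
  then obtain p where p: "length xs = 2 \<Longrightarrow> evaluates orc p xs (h xs)" for xs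
    unfolding nary_def by blast
  have "evaluates orc (Minimize p) [k] (fst (prod_decode k) + snd (prod_decode k))" for k
  proof -
    obtain a b where ab: "prod_decode k = (a, b)" by force
    then have k: "k = triangle (a + b) + a"
      using prod_decode_inverse[of k] by (simp add: prod_encode_def)
    have *: "h [s, k] = 0 \<longleftrightarrow> triangle (a + b) + a < triangle (Suc s)" for s
      unfolding h_def k by auto
    have "h [a + b, k] = 0" by (simp add: h_def k)
    then have "evaluates orc (Minimize p) [k] (LEAST s. h [s, k] = 0)"
      by (intro evaluates_Least p) auto
    then show ?thesis unfolding * Least_triangle ab by simp
  qed
  then have "nary orc 1 (\<lambda>xs. fst (prod_decode (xs ! 0)) + snd (prod_decode (xs ! 0)))"
    unfolding nary_def by (metis One_nat_def length_0_conv length_Suc_conv nth_Cons_0)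
  from nary_comp1[OF this assms]
  have s: "nary orc n (\<lambda>xs. fst (prod_decode (f xs)) + snd (prod_decode (f xs)))" by simp
  have eq: "fst (prod_decode k) = k - triangle (fst (prod_decode k) + snd (prod_decode k))" for k
  proof -
    obtain a b where ab: "prod_decode k = (a, b)" by force
    then have "k = triangle (a + b) + a"
      using prod_decode_inverse[of k] by (simp add: prod_encode_def)
    then show ?thesis unfolding ab fst_conv snd_conv by simp
  qed
  have "nary orc n (\<lambda>xs. f xs - triangle (fst (prod_decode (f xs)) + snd (prod_decode (f xs))))"
    by (intro nary_diff nary_triangle s assms)
  then show fst: "nary orc n (\<lambda>xs. fst (prod_decode (f xs)))" using eq by simp
  have "nary orc n (\<lambda>xs. (fst (prod_decode (f xs)) + snd (prod_decode (f xs))) - fst (prod_decode (f xs)))"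
    by (intro nary_diff s fst)
  then show "nary orc n (\<lambda>xs. snd (prod_decode (f xs)))" by simp
qed

section \<open>Coded types and computable functions between them\<close>

text \<open>Codes need only be injective, since computability concerns arguments that are codes. The
  instances reproduce \<open>code_rat\<close>, \<open>code_vec\<close> and
  \<open>code_facet\<close>, so that the final translation is an equality.\<close>

class coded =
  fixes code :: "'a \<Rightarrow> nat"
  assumes inj_code: "inj code"

lemma code_eq_iff [simp]: "code x = code y \<longleftrightarrow> x = y"
  using inj_code by (auto dest: injD)

instantiation nat :: coded
begin
definition code_nat :: "nat \<Rightarrow> nat" where [simp]: "code_nat n = n"
instance by standard (simp add: inj_on_def)
end

instantiation bool :: coded
begin
definition code_bool :: "bool \<Rightarrow> nat" where "code_bool b = of_bool b"
instance by standard (auto simp: inj_on_def code_bool_def)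
end

instantiation int :: coded
begin
definition code_int :: "int \<Rightarrow> nat" where "code_int = int_encode"
instance by standard (simp add: code_int_def inj_int_encode)
end

instantiation prod :: (coded, coded) coded
begin
definition code_prod :: "'a \<times> 'b \<Rightarrow> nat" where "code_prod x = prod_encode (code (fst x), code (snd x))"
instance by standard (auto simp: inj_on_def code_prod_def)
end

instantiation list :: (coded) coded
begin
definition code_list :: "'a list \<Rightarrow> nat" where "code_list xs = list_encode (map code xs)"
instance by standard (simp add: code_list_def inj_on_def list_encode_eq inj_map_eq_map inj_code)
end

instantiation rat :: coded
begin
definition code_rat_eq: "code q = code (quotient_of q)" for q :: rat
instance by standard (simp add: code_rat_eq inj_on_def quotient_of_inject_eq)
end

definition computable :: "(nat \<Rightarrow> nat \<Rightarrow> nat) \<Rightarrow> ('a::coded \<Rightarrow> 'b::coded) \<Rightarrow> bool" where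
  "computable orc f \<longleftrightarrow> (\<exists>p. \<forall>x. evaluates orc p [code x] (code (f x)))"

named_theorems computable

lemma computable_nary:
  assumes "nary orc 1 F" "\<And>x. code (f x) = F [code x]"
  shows "computable orc f"
  using assms unfolding nary_def computable_def by (metis length_Cons list.size(3) One_nat_def)

lemma computable_comp:
  assumes "computable orc g" "computable orc f"
  shows "computable orc (\<lambda>x. g (f x))"
proof -
  obtain p q where "\<And>x. evaluates orc p [code x] (code (g x))" "\<And>x. evaluates orc q [code x] (code (f x))"
    using assms unfolding computable_def by blast
  then have "evaluates orc (Comp p [q]) [code x] (code (g (f x)))" for x
    by (intro evaluates.comp[where ys = "[code (f x)]"]) auto
  then show ?thesis unfolding computable_def by blast
qed

lemma computable_id [computable]: "computable orc (\<lambda>x. x)"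
  by (rule computable_nary[OF nary_proj[of 0]]) auto

lemma computable_const [computable]: "computable orc (\<lambda>_. c)"
  by (rule computable_nary[OF nary_const]) auto

lemma computable_query:
  assumes "\<And>x. code (f x) = orc i (code x)"
  shows "computable orc f"
  unfolding computable_def using evaluates.query assms by metis

lemma computable_Pair [computable]:
  assumes "computable orc f" "computable orc g"
  shows "computable orc (\<lambda>x. (f x, g x))"
proof -
  obtain p q where p: "\<And>x. evaluates orc p [code x] (code (f x))" "\<And>x. evaluates orc q [code x] (code (g x))"
    using assms unfolding computable_def by blast
  obtain r where r: "\<And>a b. evaluates orc r [a, b] (prod_encode (a, b))"
    using program_prod_encode[of orc] by blast
  have "evaluates orc (Comp r [p, q]) [code x] (code (f x, g x))" for x
    unfolding code_prod_def by (rule evaluates.comp[where ys = "[code (f x), code (g x)]"]) (use p r in auto)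
  then show ?thesis unfolding computable_def by blast
qed

lemma computable_fst [computable]: "computable orc f \<Longrightarrow> computable orc (\<lambda>x. fst (f x))"
  by (rule computable_comp[of _ fst], rule computable_nary[OF nary_prod_decode(1)[OF nary_proj[of 0]]])
    (auto simp: code_prod_def)

lemma computable_snd [computable]: "computable orc f \<Longrightarrow> computable orc (\<lambda>x. snd (f x))"
  by (rule computable_comp[of _ snd], rule computable_nary[OF nary_prod_decode(2)[OF nary_proj[of 0]]])
    (auto simp: code_prod_def)

lemma computable_code: "computable orc f \<Longrightarrow> computable orc (\<lambda>x. code (f x))"
  unfolding computable_def by simp

lemma computable_code_iff: "computable orc (\<lambda>x. code (f x)) \<longleftrightarrow> computable orc f"
  unfolding computable_def by simp

lemma computable_nary1:
  assumes "nary orc 1 F" "computable orc f" "\<And>x. code (g x) = F [code (f x)]"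
  shows "computable orc g"
proof -
  have "computable orc (\<lambda>n::nat. F [n])"
    by (rule computable_nary[OF assms(1)]) simp
  from computable_comp[OF this computable_code[OF assms(2)]]
  have "computable orc (\<lambda>x. code (g x))" using assms(3) by simp
  then show ?thesis by (simp add: computable_code_iff)
qed

lemma computable_nary2:
  assumes F: "nary orc 2 F" and "computable orc f" "computable orc g" "\<And>x. code (h x) = F [code (f x), code (g x)]"
  shows "computable orc h"
proof (rule computable_nary1)
  show "nary orc 1 (\<lambda>xs. F [fst (prod_decode (xs ! 0)), snd (prod_decode (xs ! 0))])"
    by (intro nary_comp2[OF F] nary_prod_decode nary_proj) auto
  show "computable orc (\<lambda>x. (f x, g x))" using assms by (intro computable)
qed (simp add: assms code_prod_def)

lemma computable_Suc [computable]: "computable orc f \<Longrightarrow> computable orc (\<lambda>x. Suc (f x))"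
  by (rule computable_nary1[OF nary_Suc[OF nary_proj[of 0]], of _ f]) auto

lemma computable_add_nat [computable]:
  fixes f g :: "_ \<Rightarrow> nat"
  shows "computable orc f \<Longrightarrow> computable orc g \<Longrightarrow> computable orc (\<lambda>x. f x + g x)"
  by (rule computable_nary2[OF nary_add[OF nary_proj[of 0] nary_proj[of 1]], of _ f g]) auto

lemma computable_diff_nat [computable]:
  fixes f g :: "_ \<Rightarrow> nat"
  shows "computable orc f \<Longrightarrow> computable orc g \<Longrightarrow> computable orc (\<lambda>x. f x - g x)"
  by (rule computable_nary2[OF nary_diff[OF nary_proj[of 0] nary_proj[of 1]], of _ f g]) auto

lemma computable_rec_nat:
  assumes n: "computable orc n" and f: "computable orc f"
    and g: "computable orc (\<lambda>p. g (fst p) (fst (snd p)) (snd (snd p)))"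
  shows "computable orc (\<lambda>x. rec_nat (f x) (\<lambda>k r. g k r x) (n x))"
proof -
  obtain pn pf pg where p: "\<And>x. evaluates orc pn [code x] (code (n x))"
    "\<And>x. evaluates orc pf [code x] (code (f x))"
    "\<And>k r x. evaluates orc pg [code (k, r, x)] (code (g k r x))"
    using assms unfolding computable_def by fastforce
  obtain t where t: "\<And>a b. evaluates orc t [a, b] (prod_encode (a, b))"
    using program_prod_encode[of orc] by blast
  \<comment> \<open>Packs counter, previous value and parameter into the code of a triple, the
    single argument that \<open>pg\<close> expects.\<close>
  define q where "q = Comp pg [Comp t [Proj 0, Comp t [Proj (Suc 0), Proj 2]]]"
  have proj: "evaluates orc (Proj (Suc 0)) [a, b, c] b" "evaluates orc (Proj 2) [a, b, c] c" for a b c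
    using evaluates.proj[of 1 "[a, b, c]"] evaluates.proj[of 2 "[a, b, c]"] by simp_all
  have q: "evaluates orc q [k, code r, code x] (code (g k r x))" for k r x
  proof -
    have "evaluates orc (Comp t [Proj (Suc 0), Proj 2]) [k, code r, code x] (prod_encode (code r, code x))"
      by (rule evaluates.comp[where ys = "[code r, code x]"]) (simp_all add: proj t)
    then have "evaluates orc (Comp t [Proj 0, Comp t [Proj (Suc 0), Proj 2]]) [k, code r, code x] (code (k, r, x))"
      unfolding code_prod_def by (intro evaluates.comp[where ys = "[k, prod_encode (code r, code x)]"])
        (simp_all add: program_proj t)
    then show ?thesis
      unfolding q_def by (intro evaluates.comp[where ys = "[code (k, r, x)]"]) (simp_all add: p)
  qed
  have rec: "evaluates orc (PrimRec pf q) [k, code x] (code (rec_nat (f x) (\<lambda>k r. g k r x) k))" for k x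
    by (induction k) (use p q in \<open>auto intro: evaluates.rec_0 evaluates.rec_Suc\<close>)
  have "evaluates orc (Comp (PrimRec pf q) [pn, Proj 0]) [code x] (code (rec_nat (f x) (\<lambda>k r. g k r x) (n x)))" for x
    by (intro evaluates.comp[where ys = "[n x, code x]"]) (use p rec program_proj in auto)
  then show ?thesis unfolding computable_def by blast
qed

lemma computable_ignore_middle:
  assumes "computable orc (\<lambda>p. P (fst p) (snd p))"
  shows "computable orc (\<lambda>p. P (fst p) (snd (snd p)))"
  using computable_comp[OF assms computable_Pair[OF computable_fst[OF computable_id]
        computable_snd[OF computable_snd[OF computable_id]]]] by simp

lemma computable_funpow:
  fixes f :: "'a::coded \<Rightarrow> 'b::coded" and g :: "'b \<Rightarrow> 'a \<Rightarrow> 'b"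
  assumes "computable orc n" "computable orc f" "computable orc (\<lambda>p. g (fst p) (snd p))"
  shows "computable orc (\<lambda>x. ((\<lambda>r. g r x) ^^ n x) (f x))"
proof -
  have eq: "rec_nat a (\<lambda>_. h) k = (h ^^ k) a" for a :: 'b and k h by (induction k) auto
  have "computable orc (\<lambda>p :: nat \<times> 'b \<times> 'a. g (fst (snd p)) (snd (snd p)))"
    using computable_comp[OF assms(3) computable_snd[OF computable_id]] by simp
  then show ?thesis using computable_rec_nat[of orc n f "\<lambda>_. g"] assms(1,2) by (simp add: eq)
qed

text \<open>A recursion of length 0 or 1: no step leaves \<open>g x\<close>, one step overwrites it
  by \<open>f x\<close>.\<close>

lemma computable_if [computable]:
  assumes "computable orc b" "computable orc f" "computable orc g"
  shows "computable orc (\<lambda>x. if b x then f x else g x)"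
proof -
  have "computable orc (\<lambda>x. (of_bool (b x) :: nat))"
    using computable_code[OF assms(1)] by (simp add: code_bool_def)
  then have "computable orc (\<lambda>x. rec_nat (g x) (\<lambda>k r. f x) (of_bool (b x)))"
    by (rule computable_rec_nat[where g = "\<lambda>_ _. f"])
      (use assms in \<open>auto intro!: computable_comp[OF assms(2)] computable\<close>)
  moreover have "rec_nat u (\<lambda>k r. v) (of_bool c) = (if c then v else u)" for u v :: 'b and c
    by simp
  ultimately show ?thesis by simp
qed

lemma computable_less_nat [computable]:
  fixes f g :: "_ \<Rightarrow> nat"
  assumes "computable orc f" "computable orc g"
  shows "computable orc (\<lambda>x. f x < g x)"
proof -
  have "computable orc (\<lambda>x. 1 - (1 - (g x - f x)))" by (intro computable assms)
  moreover have "1 - (1 - (b - a)) = of_bool (a < b)" for a b :: nat by auto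
  ultimately have "computable orc (\<lambda>x. code (f x < g x))" by (simp add: code_bool_def)
  then show ?thesis by (simp add: computable_code_iff)
qed

lemma computable_not [computable]:
  assumes "computable orc f"
  shows "computable orc (\<lambda>x. \<not> f x)"
proof -
  have "computable orc (\<lambda>x. if f x then False else True)" by (intro computable assms)
  moreover have "(if b then False else True) = (\<not> b)" for b by simp
  ultimately show ?thesis by simp
qed

lemma computable_conj [computable]:
  assumes "computable orc f" "computable orc g"
  shows "computable orc (\<lambda>x. f x \<and> g x)"
proof -
  have "computable orc (\<lambda>x. if f x then g x else False)" by (intro computable assms)
  moreover have "(if b then c else False) = (b \<and> c)" for b c by simp
  ultimately show ?thesis by simp
qed

lemma computable_disj [computable]:
  assumes "computable orc f" "computable orc g"
  shows "computable orc (\<lambda>x. f x \<or> g x)"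
proof -
  have "computable orc (\<lambda>x. \<not> (\<not> f x \<and> \<not> g x))" by (intro computable assms)
  then show ?thesis by simp
qed

lemma computable_imp [computable]:
  assumes "computable orc f" "computable orc g"
  shows "computable orc (\<lambda>x. f x \<longrightarrow> g x)"
  unfolding imp_conv_disj by (intro computable assms)

lemma computable_le_nat [computable]:
  fixes f g :: "_ \<Rightarrow> nat"
  assumes "computable orc f" "computable orc g"
  shows "computable orc (\<lambda>x. f x \<le> g x)"
  using computable_not[OF computable_less_nat[OF assms(2,1)]] by (simp add: not_less)

lemma computable_eq [computable]:
  assumes "computable orc f" "computable orc g"
  shows "computable orc (\<lambda>x. f x = g x)"
proof -
  have "computable orc (\<lambda>x. code (f x) \<le> code (g x) \<and> code (g x) \<le> code (f x))"
    by (intro computable computable_code assms)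
  then show ?thesis by (simp add: eq_iff[symmetric])
qed

text \<open>The partial version of search, claiming a result only where a solution exists. The final
  algorithm has this form, as only codes of facets are known to have certificates.\<close>

lemma computable_Least:
  fixes P :: "'a::coded \<Rightarrow> nat \<Rightarrow> bool"
  assumes P: "computable orc (\<lambda>p. P (fst p) (snd p))" and f: "computable orc f"
  shows "\<exists>p. \<forall>x. (\<exists>n. P x n) \<longrightarrow> evaluates orc p [code x] (code (f (x, LEAST n. P x n)))"
proof -
  have "computable orc (\<lambda>p. of_bool (\<not> P (snd p) (fst p)) :: nat)"
    using computable_code[OF computable_not[OF computable_comp[OF P, of "\<lambda>p. (snd p, fst p)"]]]
    by (simp add: code_bool_def computable)
  then obtain q where q: "\<And>n x. evaluates orc q [code (n, x)] (of_bool (\<not> P x n))"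
    unfolding computable_def by fastforce
  obtain qf where qf: "\<And>n x. evaluates orc qf [code (x, n)] (code (f (x, n)))"
    using f unfolding computable_def by fastforce
  obtain r where r: "\<And>a b. evaluates orc r [a, b] (prod_encode (a, b))"
    using program_prod_encode[of orc] by blast
  have test: "evaluates orc (Comp q [r]) [n, code x] (of_bool (\<not> P x n))" for n x
    by (rule evaluates.comp[where ys = "[code (n, x)]"]) (use q r in \<open>auto simp: code_prod_def\<close>)
  let ?m = "Minimize (Comp q [r])"
  have m: "evaluates orc ?m [code x] (LEAST n. P x n)" if "\<exists>n. P x n" for x
    using evaluates_Least[of orc "Comp q [r]" "[code x]" "\<lambda>n. of_bool (\<not> P x n)"] test that by simp
  have "evaluates orc (Comp qf [Comp r [Proj 0, ?m]]) [code x] (code (f (x, LEAST n. P x n)))"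
    if "\<exists>n. P x n" for x
  proof -
    have "evaluates orc (Comp r [Proj 0, ?m]) [code x] (code (x, LEAST n. P x n))"
      unfolding code_prod_def by (intro evaluates.comp[where ys = "[code x, LEAST n. P x n]"])
        (simp_all add: program_proj m[OF that] r)
    then show ?thesis
      by (intro evaluates.comp[where ys = "[code (x, LEAST n. P x n)]"]) (simp_all add: qf)
  qed
  then show ?thesis by blast
qed

lemma computable_search:
  fixes P :: "'a::coded \<Rightarrow> nat \<Rightarrow> bool"
  assumes "computable orc (\<lambda>p. P (fst p) (snd p))" "computable orc f" "\<And>x. \<exists>n. P x n"
  shows "computable orc (\<lambda>x. f (x, LEAST n. P x n))"
  using computable_Least[OF assms(1,2)] assms(3) unfolding computable_def by auto

section \<open>Integer arithmetic\<close>

lemma computable_mult_nat [computable]: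
  fixes f g :: "_ \<Rightarrow> nat"
  assumes "computable orc f" "computable orc g"
  shows "computable orc (\<lambda>x. f x * g x)"
proof -
  have "computable orc (\<lambda>x. ((\<lambda>r. r + g x) ^^ f x) 0)"
    by (rule computable_funpow[where g = "\<lambda>r x. r + g x"])
      (intro computable assms computable_comp[OF assms(2)])+
  moreover have "((\<lambda>r. r + b) ^^ a) 0 = a * b" for a b :: nat by (induction a) auto
  ultimately show ?thesis by simp
qed

lemma computable_half: "computable orc (\<lambda>n::nat. n div 2)"
proof -
  have "computable orc (\<lambda>n::nat. snd (n, LEAST h. n < 2 * h + 2))"
    by (rule computable_search[of _ "\<lambda>n h. n < 2 * h + 2"]; (intro computable)?) presburger
  moreover have "(LEAST h. n < 2 * h + 2) = n div 2" for n :: nat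
    by (rule Least_equality) auto
  ultimately show ?thesis by simp
qed

lemma computable_nat [computable]:
  assumes "computable orc f"
  shows "computable orc (\<lambda>x. nat (f x))"
proof -
  \<comment> \<open>\<open>int_encode\<close> sends nonnegative \<open>i\<close> to
    \<open>2 * i\<close> and negative \<open>i\<close> to the odd number
    \<open>- 2 * i - 1\<close>.\<close>
  have "computable orc (\<lambda>i::int. if code i = 2 * (code i div 2) then code i div 2 else 0)"
    by (intro computable computable_comp[OF computable_half] computable_code)
  moreover have "(if code i = 2 * (code i div 2) then code i div 2 else 0) = nat i" for i :: int
    unfolding code_int_def int_encode_def sum_encode_def by auto
  ultimately have "computable orc nat" by simp
  from computable_comp[OF this assms] show ?thesis .
qed

lemma computable_int [computable]:
  assumes "computable orc f"
  shows "computable orc (\<lambda>x. int (f x))"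
proof -
  have "computable orc (\<lambda>n::nat. 2 * n)" by (intro computable)
  moreover have "code (int n) = 2 * n" for n
    unfolding code_int_def int_encode_def sum_encode_def by auto
  ultimately have "computable orc (\<lambda>n. code (int n))" by simp
  then have "computable orc int" by (simp add: computable_code_iff)
  from computable_comp[OF this assms] show ?thesis .
qed

lemma computable_uminus_int [computable]:
  fixes f :: "_ \<Rightarrow> int"
  assumes "computable orc f"
  shows "computable orc (\<lambda>x. - f x)"
proof -
  \<comment> \<open>For positive \<open>i\<close> the codes of \<open>i\<close> and
    \<open>- i\<close> are \<open>2 * i\<close> and \<open>2 * i - 1\<close>: negation swaps these
    neighbours and fixes 0.\<close>
  have "computable orc (\<lambda>i::int. if code i = 0 then 0 else
      if code i = 2 * (code i div 2) then code i - 1 else Suc (code i))"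
    by (intro computable computable_comp[OF computable_half] computable_code)
  moreover have "(if code i = 0 then 0 else
      if code i = 2 * (code i div 2) then code i - 1 else Suc (code i)) = code (- i)" for i :: int
    unfolding code_int_def int_encode_def sum_encode_def by (auto simp: nat_diff_distrib') 
  ultimately have "computable orc (\<lambda>i::int. code (- i))" by simp
  then have "computable orc (uminus :: int \<Rightarrow> int)" by (simp add: computable_code_iff)
  from computable_comp[OF this assms] show ?thesis .
qed

lemma computable_int_diff:
  assumes "computable orc f" "computable orc g"
  shows "computable orc (\<lambda>x. int (f x) - int (g x))"
proof -
  have "computable orc (\<lambda>x. if g x \<le> f x then int (f x - g x) else - int (g x - f x))"
    by (intro computable assms)
  moreover have "(if b \<le> a then int (a - b) else - int (b - a)) = int a - int b" for a b by auto
  ultimately show ?thesis by simp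
qed

lemma computable_add_int [computable]:
  fixes f g :: "_ \<Rightarrow> int"
  assumes "computable orc f" "computable orc g"
  shows "computable orc (\<lambda>x. f x + g x)"
proof -
  \<comment> \<open>An integer \<open>a\<close> is the difference of the naturals
    \<open>nat a\<close> and \<open>nat (- a)\<close>; the same decomposition serves
    multiplication.\<close>
  have "computable orc (\<lambda>x. int (nat (f x) + nat (g x)) - int (nat (- f x) + nat (- g x)))"
    by (intro computable computable_int_diff assms)
  moreover have "int (nat a + nat b) - int (nat (- a) + nat (- b)) = a + b" for a b by auto
  ultimately show ?thesis by simp
qed

lemma computable_mult_int [computable]:
  fixes f g :: "_ \<Rightarrow> int"
  assumes "computable orc f" "computable orc g"
  shows "computable orc (\<lambda>x. f x * g x)"
proof -
  have "computable orc (\<lambda>x. int (nat (f x) * nat (g x) + nat (- f x) * nat (- g x))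
     - int (nat (f x) * nat (- g x) + nat (- f x) * nat (g x)))"
    by (intro computable computable_int_diff assms)
  moreover have "int (nat a * nat b + nat (- a) * nat (- b)) - int (nat a * nat (- b) + nat (- a) * nat b) = a * b" for a b
    by (auto simp: nat_mult_distrib[symmetric] le_less mult_nonneg_nonneg split: if_splits)
  ultimately show ?thesis by simp
qed

lemma computable_less_int [computable]:
  fixes f g :: "_ \<Rightarrow> int"
  assumes "computable orc f" "computable orc g"
  shows "computable orc (\<lambda>x. f x < g x)"
proof -
  have "computable orc (\<lambda>x. 0 < nat (g x + - f x))"
    by (intro computable assms)
  then show ?thesis by simp
qed

lemma computable_quotient_of: "computable orc quotient_of"
  by (rule computable_nary[OF nary_proj[of 0]]) (simp_all add: code_rat_eq)

section \<open>Enumerations and rational arithmetic\<close>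

text \<open>A computable surjection turns a search over structured data into one over numbers;
  repetitions are harmless.\<close>

definition enumerates :: "(nat \<Rightarrow> nat \<Rightarrow> nat) \<Rightarrow> (nat \<Rightarrow> 'a::coded) \<Rightarrow> bool" where
  "enumerates orc e \<longleftrightarrow> computable orc e \<and> surj e"

lemma enumerates_nat: "enumerates orc (\<lambda>n::nat. n)"
  by (simp add: enumerates_def computable)

text \<open>The code of \<open>int_decode n\<close> is \<open>n\<close> itself, so a projection
  computes it.\<close>

lemma enumerates_int: "enumerates orc int_decode"
  unfolding enumerates_def
  by (intro conjI surj_int_decode computable_nary[OF nary_proj[of 0]]) (simp_all add: code_int_def)

lemma enumerates_prod:
  assumes "enumerates orc e" "enumerates orc f"
  shows "enumerates orc (\<lambda>n. (e (fst (prod_decode n)), f (snd (prod_decode n))))"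
proof -
  have "computable orc prod_decode"
    by (rule computable_nary[OF nary_proj[of 0]]) (simp_all add: code_prod_def)
  moreover have "\<exists>n. (a, b) = (e (fst (prod_decode n)), f (snd (prod_decode n)))" for a b
  proof -
    obtain k l where "a = e k" "b = f l" using assms unfolding enumerates_def surj_def by metis
    then show ?thesis by (intro exI[of _ "prod_encode (k, l)"]) simp
  qed
  ultimately show ?thesis using assms unfolding enumerates_def surj_def
    by (auto intro!: computable intro: computable_comp[of _ e] computable_comp[of _ f])
qed

text \<open>Reduced fractions are found by searching for a Bezout identity.\<close>

lemma computable_Fract [computable]:
  assumes "computable orc f" "computable orc g"
  shows "computable orc (\<lambda>x. Fract (f x) (g x))"
proof -
  obtain e :: "nat \<Rightarrow> (int \<times> int) \<times> int \<times> int" where e: "computable orc e" "surj e"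
    using enumerates_prod[OF enumerates_prod[OF enumerates_int enumerates_int]
        enumerates_prod[OF enumerates_int enumerates_int]] unfolding enumerates_def by blast
  \<comment> \<open>For \<open>w = ((p, q), u, v)\<close>: positive denominator, coprimality by the
    Bezout coefficients, and equality of fractions by cross multiplication.\<close>
  define good where "good = (\<lambda>x::int \<times> int. \<lambda>w. 0 < snd (fst w)
     \<and> fst (snd w) * fst (fst w) + snd (snd w) * snd (fst w) = 1
     \<and> fst (fst w) * snd x = fst x * snd (fst w))"
  have sound: "fst w = quotient_of (Fract (fst x) (snd x))" if "good x w" "snd x \<noteq> 0" for x w
  proof -
    obtain p q u v where w: "w = ((p, q), u, v)" by (metis prod.exhaust)
    have "u * p + v * q = 1" using that(1) by (simp add: good_def w)
    then have "coprime p q" by (intro coprimeI) (metis dvd_add dvd_mult)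
    moreover have "Fract (fst x) (snd x) = Fract p q"
      using that by (auto simp: good_def w eq_rat)
    ultimately show ?thesis using that(1) by (simp add: good_def w quotient_of_Fract Rat.normalize_def coprime_iff_gcd_eq_1)
  qed
  have complete: "\<exists>w. good x w" if "snd x \<noteq> 0" for x
  proof -
    obtain p q where pq: "quotient_of (Fract (fst x) (snd x)) = (p, q)" by force
    then have "q > 0" "coprime p q" by (auto intro: quotient_of_denom_pos quotient_of_coprime)
    moreover obtain u v where "u * p + v * q = gcd p q" using bezout_int by blast
    moreover have "Fract (fst x) (snd x) = Fract p q"
      using quotient_of_inject[of "Fract (fst x) (snd x)" "Fract p q"] pq \<open>q > 0\<close> \<open>coprime p q\<close>
      by (simp add: quotient_of_Fract Rat.normalize_def)
    ultimately show ?thesis using that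
      by (intro exI[of _ "((p, q), u, v)"]) (auto simp: good_def eq_rat)
  qed
  \<comment> \<open>The first disjunct makes the search total; at denominator 0 \<open>Fract\<close>
    is 0 by convention and its code is supplied separately.\<close>
  have ex: "\<exists>n. snd x = 0 \<or> good x (e n)" for x
    using complete[of x] e(2) by (metis surjD)
  have "computable orc (\<lambda>p. snd (fst p) = 0 \<or> good (fst p) (e (snd p)))"
    unfolding good_def by (intro computable computable_comp[OF e(1)])
  moreover have "computable orc (\<lambda>p :: (int \<times> int) \<times> nat. fst (e (snd p)))"
    by (intro computable computable_comp[OF e(1)])
  ultimately have "computable orc (\<lambda>x. fst (e (snd (x, LEAST n. snd x = 0 \<or> good x (e n)))))"
    by (rule computable_search) (rule ex)
  then have "computable orc (\<lambda>x. code (fst (e (LEAST n. snd x = 0 \<or> good x (e n)))))"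
    unfolding snd_conv by (rule computable_code)
  then have "computable orc (\<lambda>x. if snd x = 0 then code (0::rat)
      else code (fst (e (LEAST n. snd x = 0 \<or> good x (e n)))))"
    by (intro computable)
  moreover have "(if snd x = 0 then code (0::rat)
      else code (fst (e (LEAST n. snd x = 0 \<or> good x (e n))))) = code (Fract (fst x) (snd x))" for x
    using LeastI_ex[OF ex[of x]] sound[of x "e (LEAST n. snd x = 0 \<or> good x (e n))"] by (auto simp: code_rat_eq rat_number_collapse)
  ultimately have "computable orc (\<lambda>x. Fract (fst x) (snd x))"
    by (simp add: computable_code_iff)
  from computable_comp[OF this computable_Pair[OF assms]] show ?thesis by simp
qed

lemma enumerates_rat: "\<exists>e::nat \<Rightarrow> rat. enumerates orc e"
proof -
  obtain e :: "nat \<Rightarrow> int \<times> int" where e: "computable orc e" "surj e"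
    using enumerates_prod[OF enumerates_int enumerates_int] unfolding enumerates_def by blast
  have "\<exists>n. q = Fract (fst (e n)) (snd (e n))" for q
    using Rat_cases[of q] e(2) by (metis fst_conv snd_conv surjD)
  then have "enumerates orc (\<lambda>n. Fract (fst (e n)) (snd (e n)))"
    unfolding enumerates_def surj_def by (auto intro!: computable e)
  then show ?thesis by blast
qed

lemma computable_numerator [computable]: "computable orc f \<Longrightarrow> computable orc (\<lambda>x. fst (quotient_of (f x)))"
  and computable_denominator [computable]: "computable orc f \<Longrightarrow> computable orc (\<lambda>x. snd (quotient_of (f x)))"
  by (intro computable computable_comp[OF computable_quotient_of]; assumption)+

lemma Fract_quotient_of: "q = Fract (fst (quotient_of q)) (snd (quotient_of q))"
  by (cases "quotient_of q") (simp add: quotient_of_div Fract_of_int_quotient)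

lemma quotient_of_denom_nonzero: "snd (quotient_of q) \<noteq> 0"
  using quotient_of_denom_pos' by (metis less_irrefl)

lemma computable_add_rat [computable]:
  fixes f g :: "_ \<Rightarrow> rat"
  assumes "computable orc f" "computable orc g"
  shows "computable orc (\<lambda>x. f x + g x)"
proof -
  let ?n = "\<lambda>q. fst (quotient_of q)" and ?d = "\<lambda>q. snd (quotient_of q)"
  have "computable orc (\<lambda>x. Fract (?n (f x) * ?d (g x) + ?n (g x) * ?d (f x)) (?d (f x) * ?d (g x)))"
    by (intro computable assms)
  moreover have "Fract (?n a * ?d b + ?n b * ?d a) (?d a * ?d b) = a + b" for a b
    using Fract_quotient_of[of a] Fract_quotient_of[of b] add_rat quotient_of_denom_nonzero by metis
  ultimately show ?thesis by simp
qed

lemma computable_mult_rat [computable]: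
  fixes f g :: "_ \<Rightarrow> rat"
  assumes "computable orc f" "computable orc g"
  shows "computable orc (\<lambda>x. f x * g x)"
proof -
  let ?n = "\<lambda>q. fst (quotient_of q)" and ?d = "\<lambda>q. snd (quotient_of q)"
  have "computable orc (\<lambda>x. Fract (?n (f x) * ?n (g x)) (?d (f x) * ?d (g x)))"
    by (intro computable assms)
  moreover have "Fract (?n a * ?n b) (?d a * ?d b) = a * b" for a b
    using Fract_quotient_of[of a] Fract_quotient_of[of b] mult_rat by metis
  ultimately show ?thesis by simp
qed

lemma computable_uminus_rat [computable]:
  fixes f :: "_ \<Rightarrow> rat"
  assumes "computable orc f"
  shows "computable orc (\<lambda>x. - f x)"
  using computable_mult_rat[OF computable_const[of _ "-1"] assms] by simp

lemma computable_diff_rat [computable]: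
  fixes f g :: "_ \<Rightarrow> rat"
  assumes "computable orc f" "computable orc g"
  shows "computable orc (\<lambda>x. f x - g x)"
  using computable_add_rat[OF assms(1) computable_uminus_rat[OF assms(2)]] by simp

lemma computable_less_rat [computable]:
  fixes f g :: "_ \<Rightarrow> rat"
  assumes "computable orc f" "computable orc g"
  shows "computable orc (\<lambda>x. f x < g x)"
proof -
  \<comment> \<open>\<open>quotient_of\<close> has positive denominator, so the numerator carries
    the sign.\<close>
  have "computable orc (\<lambda>x. 0 < fst (quotient_of (g x - f x)))" by (intro computable assms)
  moreover have "0 < fst (quotient_of q) \<longleftrightarrow> 0 < q" for q
    using zero_less_Fract_iff[of "snd (quotient_of q)" "fst (quotient_of q)"]
      Fract_quotient_of[of q] quotient_of_denom_pos' by simp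
  ultimately show ?thesis by simp
qed

lemma computable_le_rat [computable]:
  fixes f g :: "_ \<Rightarrow> rat"
  assumes "computable orc f" "computable orc g"
  shows "computable orc (\<lambda>x. f x \<le> g x)"
  using computable_not[OF computable_less_rat[OF assms(2,1)]] by (simp add: not_less)

lemma computable_rat_of_nat [computable]:
  assumes "computable orc f"
  shows "computable orc (\<lambda>x. rat_of_nat (f x))"
proof -
  have "computable orc (\<lambda>x. Fract (int (f x)) 1)" by (intro computable assms)
  then show ?thesis by (simp add: of_nat_rat)
qed

section \<open>Lists\<close>

lemma code_Nil [simp]: "code [] = 0"
  and code_Cons [simp]: "code (x # xs) = Suc (prod_encode (code x, code xs))"
  by (simp_all add: code_list_def)

lemma computable_Cons [computable]:
  assumes "computable orc f" "computable orc g"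
  shows "computable orc (\<lambda>x. f x # g x)"
proof -
  have "computable orc (\<lambda>x. Suc (code (f x, g x)))" by (intro computable computable_code assms)
  then have "computable orc (\<lambda>x. code (f x # g x))" by (simp add: code_prod_def)
  then show ?thesis by (simp only: computable_code_iff)
qed

lemma computable_tl [computable]:
  assumes "computable orc f"
  shows "computable orc (\<lambda>x. tl (f x))"
proof (rule computable_nary1[OF _ assms])
  show "nary orc 1 (\<lambda>xs. snd (prod_decode (xs ! 0 - 1)))"
    by (intro nary_prod_decode nary_pred nary_proj) auto
  \<comment> \<open>This makes the formula correct for \<open>tl [] = []\<close>, where the code is
    0.\<close>
  have [simp]: "prod_decode 0 = (0, 0)"
    using prod_encode_inverse[of "(0, 0)"] by (simp add: prod_encode_def)
  show "code (tl (f x)) = snd (prod_decode ([code (f x)] ! 0 - 1))" for x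
    by (cases "f x") auto
qed

lemma computable_hd [computable]:
  fixes f :: "_ \<Rightarrow> 'b::coded list"
  assumes "computable orc f"
  shows "computable orc (\<lambda>x. hd (f x))"
proof -
  have "computable orc (\<lambda>n::nat. fst (prod_decode (n - 1)))"
    by (rule computable_nary[of _ "\<lambda>xs. fst (prod_decode (xs ! 0 - 1))"])
      (intro nary_prod_decode nary_pred nary_proj, auto)
  \<comment> \<open>\<open>hd []\<close> is unspecified but fixed, so its code enters the program as
    a constant.\<close>
  from computable_comp[OF this computable_code[OF assms]]
  have "computable orc (\<lambda>x. if f x = [] then code (hd [] :: 'b) else fst (prod_decode (code (f x) - 1)))"
    by (intro computable assms \<open>computable orc (\<lambda>x. fst (prod_decode (code (f x) - 1)))\<close>)
  moreover have "(if xs = [] then code (hd [] :: 'b) else fst (prod_decode (code xs - 1))) = code (hd xs)"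
    for xs :: "'b list" by (cases xs) auto
  ultimately have "computable orc (\<lambda>x. code (hd (f x)))" by simp
  then show ?thesis by (simp only: computable_code_iff)
qed

text \<open>Supplies an iteration count for folds before the length is known to be
  computable.\<close>

lemma length_le_code: "length xs \<le> code xs"
proof (induction xs)
  case (Cons x xs)
  then show ?case using le_prod_encode_2[of "code xs" "code x"] by simp
qed simp

lemma computable_fold:
  fixes l :: "'a::coded \<Rightarrow> 'c::coded list"
  assumes "computable orc l" "computable orc s"
    and step: "computable orc (\<lambda>p. step (fst p) (fst (snd p)) (snd (snd p)))"
  shows "computable orc (\<lambda>x. fold (\<lambda>a r. step a r x) (l x) (s x))"
proof -
  \<comment> \<open>One step of the fold on the pair of remaining list and accumulator. It idles on
    an empty remainder, so surplus iterations do no harm.\<close>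
  define g where "g = (\<lambda>p x. if fst p = [] then p else (tl (fst p), step (hd (fst p)) (snd p) x))"
  have "((\<lambda>p. g p x) ^^ k) (xs, r) = ([], fold (\<lambda>a r. step a r x) xs r)" if "length xs \<le> k" for k xs r x
    using that
  proof (induction k arbitrary: xs r)
    case (Suc k)
    then show ?case by (cases xs) (auto simp: funpow_swap1 g_def simp del: funpow.simps simp: funpow_Suc_right)
  qed simp
  note run = this[OF length_le_code]
  have "computable orc (\<lambda>p. step (hd (fst (fst p))) (snd (fst p)) (snd p))"
    using computable_comp[OF step, of "\<lambda>p. (hd (fst (fst p)), snd (fst p), snd p)"]
    by (simp add: computable)
  then have "computable orc (\<lambda>p. g (fst p) (snd p))"
    unfolding g_def by (intro computable)
  then have "computable orc (\<lambda>x. snd (((\<lambda>p. g p x) ^^ code (l x)) (l x, s x)))"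
    by (intro computable computable_funpow computable_code assms)
  then show ?thesis unfolding run snd_conv .
qed

lemma computable_rev [computable]:
  assumes "computable orc l"
  shows "computable orc (\<lambda>x. rev (l x))"
proof -
  have "computable orc (\<lambda>x. fold (\<lambda>a r. a # r) (l x) [])"
    by (intro computable_fold computable assms)
  then show ?thesis by (simp add: fold_Cons_rev)
qed

lemma computable_append [computable]:
  assumes "computable orc l" "computable orc m"
  shows "computable orc (\<lambda>x. l x @ m x)"
proof -
  have "computable orc (\<lambda>x. fold (\<lambda>a r. a # r) (rev (l x)) (m x))"
    by (intro computable_fold computable assms)
  then show ?thesis by (simp add: fold_Cons_rev)
qed

lemma fold_Cons_map: "fold (\<lambda>a r. h a # r) xs r = rev (map h xs) @ r"
  by (induction xs arbitrary: r) auto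

lemma computable_map [computable]:
  assumes "computable orc l" and f: "computable orc (\<lambda>p. f (fst p) (snd p))"
  shows "computable orc (\<lambda>x. map (\<lambda>a. f a x) (l x))"
proof -
  have "computable orc (\<lambda>x. rev (fold (\<lambda>a r. f a x # r) (l x) []))"
    by (intro computable_fold[where step = "\<lambda>a r x. f a x # r"] computable computable_ignore_middle[OF f] assms)
  then show ?thesis by (simp add: fold_Cons_map)
qed

lemma computable_concat [computable]:
  assumes "computable orc l"
  shows "computable orc (\<lambda>x. concat (l x))"
proof -
  have "computable orc (\<lambda>x. fold (\<lambda>a r. r @ a) (l x) [])"
    by (intro computable_fold computable assms)
  moreover have "fold (\<lambda>a r. r @ a) xs r = r @ concat xs" for xs and r :: "'b list"
    by (induction xs arbitrary: r) auto
  ultimately show ?thesis by simp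
qed

lemma fold_conj: "fold (\<lambda>a r. r \<and> Q a) xs r \<longleftrightarrow> r \<and> (\<forall>a\<in>set xs. Q a)"
  by (induction xs arbitrary: r) auto

lemma computable_Ball [computable]:
  assumes "computable orc l" and P: "computable orc (\<lambda>p. P (fst p) (snd p))"
  shows "computable orc (\<lambda>x. \<forall>a\<in>set (l x). P a x)"
proof -
  have "computable orc (\<lambda>x. fold (\<lambda>a r. r \<and> P a x) (l x) True)"
    by (intro computable_fold[where step = "\<lambda>a r x. r \<and> P a x"] computable computable_ignore_middle[OF P] assms)
  then show ?thesis by (simp only: fold_conj simp_thms)
qed

lemma computable_Bex [computable]:
  assumes "computable orc l" and "computable orc (\<lambda>p. P (fst p) (snd p))"
  shows "computable orc (\<lambda>x. \<exists>a\<in>set (l x). P a x)"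
proof -
  have "computable orc (\<lambda>x. \<not> (\<forall>a\<in>set (l x). \<not> P a x))" by (intro computable assms)
  then show ?thesis by simp
qed

lemma computable_member [computable]:
  assumes "computable orc a" "computable orc l"
  shows "computable orc (\<lambda>x. a x \<in> set (l x))"
proof -
  have "computable orc (\<lambda>x. \<exists>b\<in>set (l x). b = a x)"
    using computable_comp[OF assms(1) computable_snd[OF computable_id]]
    by (intro computable_Bex[where P = "\<lambda>b x. b = a x"] computable assms)
  then show ?thesis by simp
qed

lemma computable_length [computable]:
  assumes "computable orc l"
  shows "computable orc (\<lambda>x. length (l x))"
proof -
  have "computable orc (\<lambda>x. fold (\<lambda>a r. Suc r) (l x) 0)"
    by (intro computable_fold computable assms)
  moreover have "fold (\<lambda>a r. Suc r) xs r = r + length xs" for xs :: "'b list" and r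
    by (induction xs arbitrary: r) auto
  ultimately show ?thesis by simp
qed

lemma computable_distinct [computable]:
  assumes "computable orc l"
  shows "computable orc (\<lambda>x. distinct (l x))"
proof -
  let ?step = "\<lambda>a r. (fst r \<and> a \<notin> set (snd r), a # snd r)"
  have "computable orc (\<lambda>x. fst (fold ?step (l x) (True, [])))"
    by (intro computable_fold computable assms)
  moreover have "fst (fold ?step xs r) \<longleftrightarrow> fst r \<and> distinct xs \<and> set xs \<inter> set (snd r) = {}"
    for xs :: "'b list" and r
    by (induction xs arbitrary: r) auto
  ultimately show ?thesis by simp
qed

lemma computable_zip [computable]:
  assumes "computable orc l" "computable orc m"
  shows "computable orc (\<lambda>x. zip (l x) (m x))"
proof -
  let ?step = "\<lambda>a r. if fst r = [] then r else (tl (fst r), (a, hd (fst r)) # snd r)"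
  have "computable orc (\<lambda>x. rev (snd (fold ?step (l x) (m x, []))))"
    by (intro computable_fold computable assms)
  moreover have "snd (fold ?step xs r) = rev (zip xs (fst r)) @ snd r"
    for xs :: "'b list" and r :: "'c list \<times> ('b \<times> 'c) list"
  proof (induction xs arbitrary: r)
    case (Cons a xs)
    then show ?case by (cases "fst r") auto
  qed simp
  ultimately show ?thesis by simp
qed

lemma computable_sum_list [computable]:
  fixes l :: "_ \<Rightarrow> rat list"
  assumes "computable orc l"
  shows "computable orc (\<lambda>x. sum_list (l x))"
proof -
  have "computable orc (\<lambda>x. fold (\<lambda>a r. r + a) (l x) 0)"
    by (intro computable_fold computable assms)
  moreover have "fold (\<lambda>a r. r + a) xs r = r + sum_list xs" for xs and r :: rat
    by (induction xs arbitrary: r) auto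
  ultimately show ?thesis by simp
qed

text \<open>The length \<open>n\<close> is a constant of the program, so the induction takes place
  outside it.\<close>

lemma computable_n_lists [computable]:
  assumes "computable orc l"
  shows "computable orc (\<lambda>x. List.n_lists n (l x))"
proof (induction n)
  case 0
  show ?case by (simp add: computable)
next
  case (Suc n)
  have "computable orc (\<lambda>p. l (snd p))"
    by (rule computable_comp[OF assms]) (intro computable)
  then have "computable orc (\<lambda>x. concat (map (\<lambda>ys. map (\<lambda>y. y # ys) (l x)) (List.n_lists n (l x))))"
    by (intro computable Suc.IH
        computable_map[where f = "\<lambda>ys x. map (\<lambda>y. y # ys) (l x)"]
        computable_map[where f = "\<lambda>y p. y # fst p"])
  then show ?case by simp
qed

lemma enumerates_list:
  fixes e :: "nat \<Rightarrow> 'a::coded"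
  assumes "enumerates orc e"
  shows "\<exists>e'::nat \<Rightarrow> 'a list. enumerates orc e'"
proof -
  have "computable orc list_decode"
    by (rule computable_nary[OF nary_proj[of 0]]) (simp_all add: code_list_def map_idI)
  moreover have "computable orc (\<lambda>p :: nat \<times> nat. e (fst p))"
    by (rule computable_comp[OF _ computable_fst[OF computable_id]])
      (use assms in \<open>simp add: enumerates_def\<close>)
  ultimately have "computable orc (\<lambda>n. map e (list_decode n))"
    by (rule computable_map)
  moreover have "\<exists>n. xs = map e (list_decode n)" for xs
  proof -
    have "xs = map e (map (inv e) xs)"
      using assms by (simp add: enumerates_def surj_f_inv_f map_idI o_def)
    then show ?thesis by (intro exI[of _ "list_encode (map (inv e) xs)"]) simp
  qed
  ultimately have "enumerates orc (\<lambda>n. map e (list_decode n))" unfolding enumerates_def surj_def by blast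
  then show ?thesis by blast
qed

section \<open>Voronoi polyhedra of discrete subsets of a cone\<close>

lemma linear_functional_inner:
  fixes f :: "'a::euclidean_space \<Rightarrow> real"
  assumes "linear f"
  obtains u where "\<And>x. f x = u \<bullet> x"
proof
  fix x
  interpret linear f by fact
  have "f x = f (\<Sum>b\<in>Basis. (x \<bullet> b) *\<^sub>R b)" by (simp add: euclidean_representation)
  also have "\<dots> = (\<Sum>b\<in>Basis. f b *\<^sub>R b) \<bullet> x"
    by (simp add: sum scale inner_sum_left mult.commute inner_commute[of x])
  finally show "f x = (\<Sum>b\<in>Basis. f b *\<^sub>R b) \<bullet> x" .
qed

lemma functional_on_independent:
  fixes B :: "'a::euclidean_space set"
  assumes "independent B"
  shows "\<exists>u. \<forall>b\<in>B. u \<bullet> b = f b"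
proof -
  obtain g where "linear g" and g: "\<forall>b\<in>B. g b = f b"
    using linear_independent_extend[OF assms] by blast
  obtain u where "\<And>x. g x = u \<bullet> x"
    using linear_functional_inner[OF \<open>linear g\<close>] by metis
  with g show ?thesis by metis
qed

lemma inner_span_zero:
  assumes "x \<in> span B" "\<And>b. b \<in> B \<Longrightarrow> u \<bullet> b = 0"
  shows "u \<bullet> x = 0"
  using assms(1)
  by (induction rule: span_induct_alt) (auto simp: assms(2) inner_add_right)

text \<open>The hyperplane at level 1 misses 0: applying \<open>y\<close> to a linear relation shows
  that its coefficients sum to 0, so it is an affine relation.\<close>

lemma affine_independent_imp_independent:
  fixes B :: "'a::euclidean_space set"
  assumes "\<not> affine_dependent B" "\<And>b. b \<in> B \<Longrightarrow> b \<bullet> y = 1"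
  shows "independent B"
proof
  have fin: "finite B" using assms(1) aff_independent_finite by blast
  assume "dependent B"
  then obtain u where u: "\<exists>v\<in>B. u v \<noteq> 0" "(\<Sum>v\<in>B. u v *\<^sub>R v) = 0"
    using dependent_finite[OF fin] by auto
  have "sum u B = (\<Sum>v\<in>B. u v *\<^sub>R v) \<bullet> y" using assms(2) by (simp add: inner_sum_left)
  also have "\<dots> = 0" unfolding u(2) by simp
  finally have "sum u B = 0" .
  with u have "affine_dependent B" unfolding affine_dependent_explicit_finite[OF fin] by blast
  with assms(1) show False by blast
qed

lemma independent_imp_aff_dim:
  fixes B :: "'a::euclidean_space set"
  assumes "independent B"
  shows "aff_dim B = int (card B) - 1"
proof -
  have "\<not> affine_dependent B" using assms affine_dependent_imp_dependent[of B] by (rule contrapos_nn)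
  from aff_dim_affine_independent[OF this] show ?thesis by simp
qed

lemma face_of_eq_of_aff_dim:
  fixes P :: "'a::euclidean_space set"
  assumes "F face_of P" "F' face_of P" "F \<subseteq> F'" "aff_dim F' \<le> aff_dim F"
  shows "F = F'"
proof (rule ccontr)
  assume "F \<noteq> F'"
  have "F face_of F'"
    using assms face_of_subset face_of_imp_subset by blast
  then have "aff_dim F < aff_dim F'"
    using \<open>F \<noteq> F'\<close> assms(2) face_of_aff_dim_lt face_of_imp_convex by blast
  with assms(4) show False by simp
qed

section \<open>The polyhedron of a discrete set of cone vectors\<close>

text \<open>Isolates the real geometry from rationality. Closure of \<open>X\<close> under positive
  integer multiples makes every vector of \<open>X\<close> a recession direction of \<open>P\<close>
  and puts 0 into the affine hull of \<open>X\<close>.\<close>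

locale discrete_cone =
  fixes C X :: "'a::euclidean_space set"
  assumes pos: "\<And>x y. x \<in> closure C \<Longrightarrow> x \<noteq> 0 \<Longrightarrow> y \<in> C \<Longrightarrow> 0 < x \<bullet> y"
    and cone: "\<And>x t. x \<in> closure C \<Longrightarrow> 0 < t \<Longrightarrow> t *\<^sub>R x \<in> closure C"
    and X_sub: "X \<subseteq> closure C - {0}"
    and X_scale: "\<And>x n. x \<in> X \<Longrightarrow> 0 < n \<Longrightarrow> real n *\<^sub>R x \<in> X"
    and X_fin: "\<And>r. finite {x \<in> X. norm x \<le> r}"
begin

definition P where "P = closure (convex hull X)"

text \<open>A \<open>perfect_form\<close> stripped of rationality, which is reattached in
  \<open>supports_iff_perfect_form\<close>.\<close>

definition supports :: "'a set \<Rightarrow> 'a \<Rightarrow> bool" where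
  "supports F y \<longleftrightarrow> y \<in> C \<and> F = {x \<in> P. x \<bullet> y = 1} \<and> (\<forall>x\<in>P. 1 \<le> x \<bullet> y)"

lemma convex_P: "convex P"
  by (simp add: P_def convex_closure convex_convex_hull)

lemma closed_P: "closed P"
  by (simp add: P_def)

lemma X_sub_P: "X \<subseteq> P"
  unfolding P_def by (meson closure_subset hull_subset order_trans)

lemma P_ge:
  assumes "\<And>z. z \<in> X \<Longrightarrow> c \<le> z \<bullet> y" "x \<in> P"
  shows "c \<le> x \<bullet> y"
proof -
  have "convex hull X \<subseteq> {x. c \<le> y \<bullet> x}"
    by (rule hull_minimal) (use assms(1) convex_halfspace_ge[of c y] in \<open>auto simp: inner_commute\<close>)
  then have "P \<subseteq> {x. c \<le> y \<bullet> x}"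
    unfolding P_def by (rule closure_minimal) (rule closed_halfspace_ge)
  with assms(2) show ?thesis by (auto simp: inner_commute)
qed

text \<open>Mix \<open>x\<close> with \<open>n z\<close> at weight \<open>s / n\<close>: the
  multiple of \<open>z\<close> is always \<open>s\<close> and the share of \<open>x\<close> tends to
  1. The limit stays in the closed set \<open>P\<close>.\<close>

lemma P_add:
  assumes x: "x \<in> P" and z: "z \<in> X" and s: "0 \<le> s"
  shows "x + s *\<^sub>R z \<in> P"
proof -
  define f where "f n = x + s *\<^sub>R z - (s / real n) *\<^sub>R x" for n
  have "f \<longlonglongrightarrow> x + s *\<^sub>R z - 0 *\<^sub>R x"
    unfolding f_def by (intro tendsto_intros lim_const_over_n)
  then have lim: "f \<longlonglongrightarrow> x + s *\<^sub>R z" by simp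
  have "\<forall>\<^sub>F n in sequentially. f n \<in> P"
  proof (rule eventually_sequentiallyI)
    fix n assume n: "nat \<lceil>s\<rceil> + 1 \<le> n"
    then have "n > 0" "s \<le> real n" by linarith+
    have "(1 - s / real n) *\<^sub>R x + (s / real n) *\<^sub>R (real n *\<^sub>R z) \<in> P"
      using X_scale[OF z \<open>n > 0\<close>] X_sub_P \<open>n > 0\<close> \<open>s \<le> real n\<close> s
      by (intro convexD[OF convex_P x]) auto
    then show "f n \<in> P" using \<open>n > 0\<close> by (simp add: f_def algebra_simps)
  qed
  then show ?thesis
    using Lim_in_closed_set[OF closed_P _ _ lim] by simp
qed

text \<open>By compactness the pairing with \<open>y\<close> has a positive minimum on the unit
  vectors of the closed cone, and both sides scale alike.\<close>

lemma norm_bound: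
  assumes "y \<in> C"
  obtains K where "K > 0" "\<And>x. x \<in> closure C \<Longrightarrow> norm x \<le> K * (x \<bullet> y)"
proof -
  define S where "S = closure C \<inter> sphere 0 1"
  have scale: "(1 / norm x) *\<^sub>R x \<in> S" if "x \<in> closure C" "x \<noteq> 0" for x
    using that cone by (simp add: S_def)
  show ?thesis
  proof (cases "S = {}")
    case True
    then have "norm x \<le> 1 * (x \<bullet> y)" if "x \<in> closure C" for x
      using scale[OF that] by (cases "x = 0") auto
    then show ?thesis using that[of 1] by simp
  next
    case False
    have "compact S" unfolding S_def by (simp add: closed_Int_compact)
    moreover have "continuous_on S (\<lambda>x. x \<bullet> y)" by (intro continuous_intros)
    ultimately obtain m where m: "m \<in> S" "\<And>x. x \<in> S \<Longrightarrow> m \<bullet> y \<le> x \<bullet> y"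
      using continuous_attains_inf False by metis
    have "m \<noteq> 0" using m(1) by (auto simp: S_def)
    then have mpos: "0 < m \<bullet> y" using m(1) assms pos by (auto simp: S_def)
    have "norm x \<le> (1 / (m \<bullet> y)) * (x \<bullet> y)" if "x \<in> closure C" for x
    proof (cases "x = 0")
      case False
      have "m \<bullet> y \<le> (x \<bullet> y) / norm x" using m(2)[OF scale[OF that False]] by simp
      then show ?thesis using mpos False by (simp add: field_simps)
    qed simp
    then show ?thesis using that[of "1 / (m \<bullet> y)"] mpos by simp
  qed
qed

lemma finite_below:
  assumes "y \<in> C"
  shows "finite {z \<in> X. z \<bullet> y \<le> r}"
proof -
  obtain K where K: "K > 0" "\<And>x. x \<in> closure C \<Longrightarrow> norm x \<le> K * (x \<bullet> y)"
    using norm_bound[OF assms] by blast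
  have "norm z \<le> K * r" if "z \<in> X" "z \<bullet> y \<le> r" for z
  proof -
    have "norm z \<le> K * (z \<bullet> y)" using K(2) that X_sub by blast
    also have "\<dots> \<le> K * r" using that K(1) by simp
    finally show ?thesis .
  qed
  then show ?thesis by (intro finite_subset[OF _ X_fin[of "K * r"]]) auto
qed

lemma P_sub_span: "P \<subseteq> span X"
  unfolding P_def
  by (intro closure_minimal hull_minimal) (auto simp: span_base subspace_imp_convex closed_subspace)

text \<open>\<open>z\<close> and \<open>2 z\<close> both lie in \<open>X\<close>, so the affine hull
  contains 0 and the affine dimension is the linear one.\<close>

lemma aff_dim_P:
  assumes "X \<noteq> {}"
  shows "aff_dim P = int (dim X)"
proof -
  obtain z where z: "z \<in> X" using assms by blast
  have "2 *\<^sub>R z \<in> X" using X_scale[OF z, of 2] by simp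
  then have "2 *\<^sub>R z + (- 1) *\<^sub>R (2 *\<^sub>R z) \<in> affine hull X"
    using z by (intro mem_affine[OF affine_affine_hull]) (auto simp: hull_inc)
  moreover have "2 *\<^sub>R z + (- 1) *\<^sub>R (2 *\<^sub>R z) = 0" by simp
  ultimately have "0 \<in> affine hull X" by metis
  then show ?thesis unfolding P_def closure_aff_dim aff_dim_convex_hull by (rule aff_dim_zero)
qed

lemma dim_X_pos: "X \<noteq> {} \<Longrightarrow> 0 < dim X"
  using X_sub dim_eq_0 by fastforce

lemma facet_ofI:
  assumes "X \<noteq> {}" "\<And>z. z \<in> X \<Longrightarrow> c \<le> z \<bullet> y" "F = {x \<in> P. x \<bullet> y = c}"
    and A: "A \<subseteq> F" "int (dim X) - 1 \<le> aff_dim A" and "F \<noteq> P"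
  shows "F facet_of P"
proof -
  have eq: "F = P \<inter> {x. y \<bullet> x = c}" using assms(3) by (auto simp: inner_commute)
  have face: "F face_of P"
    unfolding eq using P_ge[OF assms(2)]
    by (intro face_of_Int_supporting_hyperplane_ge convex_P) (simp add: inner_commute)
  have "aff_dim F < aff_dim P"
    using face_of_aff_dim_lt[OF convex_P face \<open>F \<noteq> P\<close>] .
  moreover have "aff_dim A \<le> aff_dim F" using A(1) by (rule aff_dim_subset)
  ultimately have dim: "aff_dim F = aff_dim P - 1" using A(2) aff_dim_P[OF assms(1)] by simp
  then have "aff_dim F \<noteq> -1" using aff_dim_P[OF assms(1)] dim_X_pos[OF assms(1)] by linarith
  then have "F \<noteq> {}" by (metis aff_dim_empty)
  with face dim show ?thesis by (simp add: facet_of_def)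
qed

section \<open>Crossing a face of codimension two\<close>

text \<open>A form in \<open>C\<close> is positive on all nonzero vectors of the closed cone, so its
  level set contains no translate by one. This is what rules out unbounded facets.\<close>

lemma supports_facet_bounded:
  assumes "supports F y" "g \<in> F" "g + x \<in> F" "x \<in> closure C"
  shows "x = 0"
proof -
  have "x \<bullet> y = 0" using assms(1-3) by (auto simp: supports_def inner_add_left)
  then show ?thesis using pos assms(1,4) unfolding supports_def by (metis less_irrefl)
qed

text \<open>A sequence of cusp vectors whose ratios approach the infimum without attaining it
  escapes to infinity, and its limiting direction lies in the supporting hyperplane.\<close>

lemma extremal_form:
  assumes y: "y \<in> C" "\<And>z. z \<in> X \<Longrightarrow> 1 \<le> z \<bullet> y" and neg: "\<exists>z\<in>X. z \<bullet> r < 0"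
  obtains t where "\<And>z. z \<in> X \<Longrightarrow> 1 \<le> z \<bullet> (y + t *\<^sub>R r)"
    "(\<exists>z\<in>X. z \<bullet> r < 0 \<and> z \<bullet> (y + t *\<^sub>R r) = 1) \<or>
     (\<exists>x\<in>closure C. x \<noteq> 0 \<and> x \<bullet> r < 0 \<and> x \<bullet> (y + t *\<^sub>R r) = 0 \<and> (\<forall>g\<in>P. g + x \<in> P))"
proof -
  define N where "N = {z \<in> X. z \<bullet> r < 0}"
  \<comment> \<open>\<open>\<rho> z\<close> is the parameter at which the constraint of
    \<open>z\<close> becomes an equality; the infimum \<open>t\<close> is the largest parameter
    violating none.\<close>
  define \<rho> where "\<rho> z = (z \<bullet> y - 1) / (- (z \<bullet> r))" for z
  define t where "t = Inf (\<rho> ` N)"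
  define Y where "Y = y + t *\<^sub>R r"
  have N: "N \<noteq> {}" "N \<subseteq> X" using neg by (auto simp: N_def)
  have \<rho>0: "0 \<le> \<rho> z" if "z \<in> N" for z
    using that y(2)[of z] by (auto simp: \<rho>_def N_def intro!: divide_nonneg_nonpos)
  then have bdd: "bdd_below (\<rho> ` N)" by (auto intro!: bdd_belowI2[of _ 0])
  have t0: "0 \<le> t" unfolding t_def using N \<rho>0 by (auto intro!: cINF_greatest)
  have t_le: "t \<le> \<rho> z" if "z \<in> N" for z
    unfolding t_def using that bdd by (auto intro: cINF_lower)
  have zY: "z \<bullet> Y = z \<bullet> y + t * (z \<bullet> r)" for z by (simp add: Y_def inner_add_right)
  have Y1: "1 \<le> z \<bullet> Y" if "z \<in> X" for z
  proof (cases "z \<in> N")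
    case True
    then have "z \<bullet> r < 0" by (simp add: N_def)
    with t_le[OF True] show ?thesis unfolding zY \<rho>_def by (simp add: field_simps)
  next
    case False
    then have "0 \<le> z \<bullet> r" using that by (simp add: N_def)
    then show ?thesis using y(2)[OF that] t0 mult_nonneg_nonneg[of t "z \<bullet> r"] unfolding zY by linarith
  qed
  show ?thesis
  proof (cases "\<exists>z\<in>N. \<rho> z = t")
    case True
    then obtain z where z: "z \<in> N" "\<rho> z = t" by blast
    then have "z \<bullet> r < 0" by (simp add: N_def)
    with z(2) have "z \<bullet> Y = 1" unfolding zY \<rho>_def by (simp add: field_simps)
    with z show ?thesis using that[of t] Y1 \<open>z \<bullet> r < 0\<close> N by (auto simp: Y_def)
  next
    case False
    obtain K where K: "K > 0" "\<And>x. x \<in> closure C \<Longrightarrow> norm x \<le> K * (x \<bullet> y)"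
      using norm_bound[OF y(1)] by blast
    \<comment> \<open>If all vectors with ratio below \<open>t + 1 / real (Suc k)\<close> had
      bounded product with \<open>y\<close>, they would be finitely many and the infimum would be
      attained.\<close>
    have ex: "\<exists>z\<in>N. \<rho> z < t + 1 / real (Suc k) \<and> real (Suc k) < z \<bullet> y" for k
    proof (rule ccontr)
      assume *: "\<not> ?thesis"
      define E where "E = {z \<in> N. \<rho> z < t + 1 / real (Suc k)}"
      have "E \<subseteq> {z \<in> X. z \<bullet> y \<le> real (Suc k)}" using * N(2) by (fastforce simp: E_def)
      then have fin: "finite E" using finite_below[OF y(1)] finite_subset by blast
      have "Min (insert (t + 1 / real (Suc k)) (\<rho> ` E)) \<le> Inf (\<rho> ` N)"
      proof (rule cINF_greatest[OF N(1)])
        fix z assume "z \<in> N"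
        then show "Min (insert (t + 1 / real (Suc k)) (\<rho> ` E)) \<le> \<rho> z"
          using fin by (cases "z \<in> E") (auto simp: E_def intro: min.coboundedI1 Min.coboundedI order_trans[OF Min.coboundedI])
      qed
      moreover have "t < Min (insert (t + 1 / real (Suc k)) (\<rho> ` E))"
      proof -
        have "t < \<rho> z" if "z \<in> N" for z using t_le[OF that] False that by (auto simp: less_le)
        then have "\<forall>a\<in>insert (t + 1 / real (Suc k)) (\<rho> ` E). t < a" by (auto simp: E_def)
        then show ?thesis using fin by (simp del: of_nat_Suc)
      qed
      ultimately show False by (simp add: t_def)
    qed
    then obtain zs where zs: "\<And>k. zs k \<in> N" "\<And>k. \<rho> (zs k) < t + 1 / real (Suc k)"
      "\<And>k. real (Suc k) < zs k \<bullet> y"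
      by metis
    \<comment> \<open>Scaled to the compact slice \<open>x \<bullet> y = 1\<close> of the closed
      cone, the escaping vectors have a convergent subsequence, whose limit is the direction
      sought.\<close>
    define xs where "xs k = (1 / (zs k \<bullet> y)) *\<^sub>R zs k" for k
    have zpos: "0 < zs k \<bullet> y" for k using zs(3)[of k] by (simp add: order.strict_trans1[of 0])
    define S where "S = closure C \<inter> {x. y \<bullet> x = 1}"
    have xsS: "xs k \<in> S" for k
      using zs(1)[of k] N(2) X_sub zpos[of k] cone by (auto simp: xs_def S_def inner_commute)
    have "bounded S"
      unfolding bounded_iff using K(2) by (force simp: S_def inner_commute)
    then have "compact S"
      unfolding compact_eq_bounded_closed S_def by (simp add: closed_Int closed_hyperplane)
    then obtain x f where x: "x \<in> S" "strict_mono f" "(xs \<circ> f) \<longlonglongrightarrow> x"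
      using xsS unfolding compact_def by metis
    \<comment> \<open>Near-optimality bounds \<open>zs k \<bullet> Y\<close> by 1 plus
      \<open>- (zs k \<bullet> r) / real (Suc k)\<close>. Divided by
      \<open>zs k \<bullet> y\<close>, which exceeds \<open>real (Suc k)\<close>, both summands
      become small, as \<open>r\<close> is bounded on the slice.\<close>
    have up: "xs k \<bullet> Y \<le> (1 + K * norm r) / real (Suc k)" for k
    proof -
      have r: "zs k \<bullet> r < 0" using zs(1)[of k] by (simp add: N_def)
      have "zs k \<bullet> y - 1 < (t + 1 / real (Suc k)) * (- (zs k \<bullet> r))"
        using zs(2)[of k] pos_divide_less_eq[of "- (zs k \<bullet> r)"] r unfolding \<rho>_def by (metis neg_0_less_iff_less)
      then have "zs k \<bullet> Y \<le> 1 + (- (zs k \<bullet> r)) / real (Suc k)"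
        unfolding zY by (simp add: algebra_simps)
      then have "(zs k \<bullet> Y) / (zs k \<bullet> y) \<le> (1 + (- (zs k \<bullet> r)) / real (Suc k)) / (zs k \<bullet> y)"
        using zpos[of k] by (intro divide_right_mono) auto
      also have "\<dots> = 1 / (zs k \<bullet> y) + (- (xs k \<bullet> r)) / real (Suc k)"
        by (simp add: xs_def add_divide_distrib diff_divide_distrib mult.commute)
      also have "\<dots> \<le> 1 / real (Suc k) + (K * norm r) / real (Suc k)"
      proof (intro add_mono divide_right_mono)
        show "1 / (zs k \<bullet> y) \<le> 1 / real (Suc k)" using zs(3)[of k] by (intro divide_left_mono) auto
        have "norm (xs k) \<le> K" using K(2)[of "xs k"] xsS[of k] by (simp add: S_def inner_commute)
        then have "norm (xs k) * norm r \<le> K * norm r" by (intro mult_right_mono) auto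
        then show "- (xs k \<bullet> r) \<le> K * norm r"
          using Cauchy_Schwarz_ineq2[of "xs k" r] by linarith
      qed auto
      finally show ?thesis by (simp add: xs_def add_divide_distrib)
    qed
    have "(\<lambda>k. (1 + K * norm r) / real (Suc k)) \<longlonglongrightarrow> 0"
      using LIMSEQ_Suc[OF lim_const_over_n] .
    then have "((\<lambda>k. (1 + K * norm r) / real (Suc k)) \<circ> f) \<longlonglongrightarrow> 0"
      using LIMSEQ_subseq_LIMSEQ x(2) by blast
    moreover have "(\<lambda>k. (xs \<circ> f) k \<bullet> Y) \<longlonglongrightarrow> x \<bullet> Y" by (intro tendsto_intros x)
    ultimately have "x \<bullet> Y \<le> 0" using up by (auto intro!: LIMSEQ_le)
    moreover have "0 \<le> xs k \<bullet> Y" for k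
      using Y1[of "zs k"] zs(1)[of k] N(2) zpos[of k] by (auto simp: xs_def intro!: divide_nonneg_pos)
    then have "0 \<le> x \<bullet> Y"
      using \<open>(\<lambda>k. (xs \<circ> f) k \<bullet> Y) \<longlonglongrightarrow> x \<bullet> Y\<close> by (auto intro: LIMSEQ_le_const)
    ultimately have "x \<bullet> Y = 0" by simp
    moreover have "x \<bullet> y = 1" using x(1) by (simp add: S_def inner_commute)
    \<comment> \<open>The product equals -1, because \<open>x \<bullet> Y = 0\<close> and
      \<open>x \<bullet> y = 1\<close>.\<close>
    ultimately have "t * (x \<bullet> r) < 0" "x \<noteq> 0" using zY[of x] by auto
    then have "x \<bullet> r < 0" using t0 by (meson mult_nonneg_nonneg not_le)
    moreover have "g + x \<in> P" if "g \<in> P" for g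
    proof -
      have "g + (xs \<circ> f) k \<in> P" for k
        using P_add[OF that, of "zs (f k)" "1 / (zs (f k) \<bullet> y)"] zs(1)[of "f k"] N(2) zpos[of "f k"]
        by (auto simp: xs_def)
      moreover have "(\<lambda>k. g + (xs \<circ> f) k) \<longlonglongrightarrow> g + x" by (intro tendsto_intros x)
      ultimately show ?thesis using closed_P by (meson closed_sequentially)
    qed
    ultimately show ?thesis
      using that[of t] Y1 x(1) \<open>x \<bullet> Y = 0\<close> \<open>x \<noteq> 0\<close> unfolding Y_def S_def by blast
  qed
qed

text \<open>\<open>B\<close> and \<open>w\<close> give \<open>dim X\<close> independent points at
  level 1, so the face has codimension at most one. It is proper because \<open>z\<close> and
  \<open>2 z\<close> cannot both have value 1.\<close>

lemma facet_of_insert: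
  assumes B: "independent B" "B \<subseteq> X" "card B + 1 = dim X"
    and Y: "\<And>z. z \<in> X \<Longrightarrow> 1 \<le> z \<bullet> Y" "\<And>b. b \<in> B \<Longrightarrow> b \<bullet> Y = 1"
    and w: "w \<in> P" "w \<bullet> Y = 1" "w \<notin> span B"
  shows "{x \<in> P. x \<bullet> Y = 1} facet_of P"
proof (rule facet_ofI[OF _ Y(1) refl, where A = "insert w B"])
  have nonempty: "X \<noteq> {}" using B(3) by auto
  then show "X \<noteq> {}" .
  show "insert w B \<subseteq> {x \<in> P. x \<bullet> Y = 1}" using w B(2) X_sub_P Y(2) by auto
  have "w \<notin> B" using w(3) span_base by blast
  moreover have "independent (insert w B)" using w(3) B(1) by (rule independent_insertI)
  ultimately have "aff_dim (insert w B) = int (dim X) - 1"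
    using independent_imp_aff_dim B(1,3) independent_imp_finite by fastforce
  then show "int (dim X) - 1 \<le> aff_dim (insert w B)" by simp
  obtain z where "z \<in> X" using nonempty by blast
  show "{x \<in> P. x \<bullet> Y = 1} \<noteq> P"
  proof
    assume *: "{x \<in> P. x \<bullet> Y = 1} = P"
    have "real 2 *\<^sub>R z \<in> P" "z \<in> P" using \<open>z \<in> X\<close> X_scale[of z 2] X_sub_P by auto
    then have "z \<bullet> Y = 1" "real 2 *\<^sub>R z \<bullet> Y = 1" using * by blast+
    then show False by simp
  qed
qed

text \<open>Boundedness of facets enters twice. It forces \<open>r\<close> to be negative somewhere
  on \<open>X\<close>, since otherwise its zero set would cut out a facet containing
  \<open>b\<close> and \<open>2 b\<close>; and it forces the extremal form to be reached at a vector
  of \<open>X\<close>. The form \<open>y'\<close> is the one that \<open>perfect\<close> grants to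
  the facet cut out by \<open>y + t r\<close>.\<close>

lemma facet_across_exists:
  assumes perfect: "\<And>F. F facet_of P \<Longrightarrow> \<exists>y. supports F y"
    and y: "y \<in> C" "\<And>z. z \<in> X \<Longrightarrow> 1 \<le> z \<bullet> y"
    and B: "independent B" "B \<subseteq> X" "card B + 1 = dim X" "B \<noteq> {}" "\<And>b. b \<in> B \<Longrightarrow> b \<bullet> y = 1"
    and r: "\<And>b. b \<in> B \<Longrightarrow> r \<bullet> b = 0" "\<exists>z\<in>X. r \<bullet> z \<noteq> 0"
  obtains F y' where "F facet_of P" "supports F y'" "B \<subseteq> F" "\<exists>z\<in>X. z \<in> F \<and> z \<bullet> r < 0"
proof -
  obtain b where b: "b \<in> B" using B(4) by blast
  have b_r: "b \<bullet> r = 0" if "b \<in> B" for b using r(1)[OF that] by (simp add: inner_commute)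
  have outside: "w \<notin> span B" if "w \<bullet> r \<noteq> 0" for w
    using inner_span_zero[of w B r] r(1) that by (auto simp: inner_commute)
  have "\<exists>z\<in>X. z \<bullet> r < 0"
  proof (rule ccontr)
    assume "\<not> ?thesis"
    then have ge: "\<And>z. z \<in> X \<Longrightarrow> 0 \<le> z \<bullet> r" by (meson not_le)
    let ?F = "{x \<in> P. x \<bullet> r = 0}" and ?A = "insert (2 *\<^sub>R b) B"
    have 2: "2 *\<^sub>R b \<in> P" using X_scale[of b 2] b B(2) X_sub_P by auto
    have "?F facet_of P"
    proof (rule facet_ofI[OF _ ge refl])
      show "X \<noteq> {}" using b B(2) by blast
      show "?A \<subseteq> ?F" using 2 b b_r B(2) X_sub_P by auto
      have "2 *\<^sub>R b + (- 1) *\<^sub>R (2 *\<^sub>R b) \<in> affine hull ?A"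
        using b by (intro mem_affine[OF affine_affine_hull]) (auto simp: hull_inc)
      moreover have "2 *\<^sub>R b + (- 1) *\<^sub>R (2 *\<^sub>R b) = 0" by simp
      ultimately have "0 \<in> affine hull ?A" by metis
      then have "aff_dim ?A = int (dim ?A)" by (rule aff_dim_zero)
      moreover have "card B \<le> dim ?A"
        using dim_subset[of B ?A] dim_eq_card_independent[OF B(1)] by auto
      ultimately show "int (dim X) - 1 \<le> aff_dim ?A" using B(3) by linarith
      show "?F \<noteq> P" using r(2) X_sub_P by (auto simp: inner_commute)
    qed
    then obtain y' where "supports ?F y'" using perfect by blast
    moreover have "b \<in> ?F" "b + b \<in> ?F"
      using 2 b b_r B(2) X_sub_P by (auto simp: scaleR_2 inner_add_left)
    moreover have "b \<in> closure C" "b \<noteq> 0" using b B(2) X_sub by auto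
    ultimately show False using supports_facet_bounded by blast
  qed
  then obtain t where t: "\<And>z. z \<in> X \<Longrightarrow> 1 \<le> z \<bullet> (y + t *\<^sub>R r)"
    and alt: "(\<exists>z\<in>X. z \<bullet> r < 0 \<and> z \<bullet> (y + t *\<^sub>R r) = 1) \<or>
     (\<exists>x\<in>closure C. x \<noteq> 0 \<and> x \<bullet> r < 0 \<and> x \<bullet> (y + t *\<^sub>R r) = 0 \<and> (\<forall>g\<in>P. g + x \<in> P))"
    using extremal_form[OF y] by metis
  define Y where "Y = y + t *\<^sub>R r"
  define F where "F = {x \<in> P. x \<bullet> Y = 1}"
  have BY: "b \<bullet> Y = 1" if "b \<in> B" for b
    using that B(5) b_r by (simp add: Y_def inner_add_right)
  have BF: "B \<subseteq> F" using B(2) X_sub_P BY by (auto simp: F_def)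
  have facet: "F facet_of P" if "w \<in> F" "w \<bullet> r \<noteq> 0" for w
    unfolding F_def
    by (rule facet_of_insert[OF B(1-3) t[folded Y_def] BY _ _ outside[OF that(2)]])
      (use that(1) in \<open>auto simp: F_def\<close>)
  from alt show ?thesis
  proof (elim disjE bexE conjE)
    fix z assume z: "z \<in> X" "z \<bullet> r < 0" "z \<bullet> (y + t *\<^sub>R r) = 1"
    then have zF: "z \<in> F" using X_sub_P by (auto simp: F_def Y_def)
    then have "F facet_of P" using facet z(2) by simp
    moreover obtain y' where "supports F y'" using perfect[OF \<open>F facet_of P\<close>] by blast
    ultimately show ?thesis using that[of F y'] z zF BF by blast
  next
    fix x assume x: "x \<in> closure C" "x \<noteq> 0" "x \<bullet> r < 0" "x \<bullet> (y + t *\<^sub>R r) = 0" "\<forall>g\<in>P. g + x \<in> P"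
    \<comment> \<open>In the escaping case the direction \<open>x\<close> provides the missing point
      \<open>b + x\<close> off the span of \<open>B\<close>. So \<open>F\<close> is a facet, but it
      contains both \<open>b\<close> and \<open>b + x\<close>.\<close>
    have bx: "b + x \<in> F"
      using x(4,5) b B(2) X_sub_P BY by (auto simp: F_def Y_def inner_add_left)
    moreover have "(b + x) \<bullet> r \<noteq> 0" using x(3) b_r[OF b] by (simp add: inner_add_left)
    ultimately have "F facet_of P" by (rule facet)
    then obtain y' where "supports F y'" using perfect by blast
    with bx x(1,2) BF b supports_facet_bounded show ?thesis by blast
  qed
qed

section \<open>Minimal vectors and neighbors\<close>

text \<open>\<open>P\<close> is a closure, so a point of the face might a priori be only a limit of
  convex combinations. If it lay outside the hull of the minimal vectors, tilting \<open>y\<close>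
  slightly by a separating functional would keep all of \<open>X\<close> at level at least 1 while
  pushing the point below 1, against \<open>P_ge\<close>.\<close>

lemma face_eq_convex_hull:
  assumes y: "y \<in> C" "\<And>z. z \<in> X \<Longrightarrow> 1 \<le> z \<bullet> y"
  shows "{x \<in> P. x \<bullet> y = 1} = convex hull {z \<in> X. z \<bullet> y = 1}" (is "?F = convex hull ?Z")
proof
  have "convex {x. x \<bullet> y = 1}" using convex_hyperplane[of y 1] by (simp add: inner_commute)
  then have "convex (P \<inter> {x. x \<bullet> y = 1})" using convex_P convex_Int by blast
  then show "convex hull ?Z \<subseteq> ?F" using X_sub_P by (intro hull_minimal) (auto simp: Int_def)
  show "?F \<subseteq> convex hull ?Z"
  proof (rule ccontr)
    assume "\<not> ?thesis"
    then obtain x where x: "x \<in> P" "x \<bullet> y = 1" "x \<notin> convex hull ?Z" by blast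
    have "finite ?Z" by (rule finite_subset[OF _ finite_below[OF y(1), of 1]]) auto
    then have "closed (convex hull ?Z)"
      by (simp add: finite_imp_compact_convex_hull compact_imp_closed)
    from separating_hyperplane_closed_point[OF convex_convex_hull this x(3)]
    obtain a b where ab: "a \<bullet> x < b" "\<forall>z\<in>convex hull ?Z. b < a \<bullet> z" by blast
    have ab_Z: "b < a \<bullet> z" if "z \<in> ?Z" for z using ab(2) hull_inc[OF that] by blast
    \<comment> \<open>At level 1 of \<open>y\<close>, subtracting \<open>b *\<^sub>R y\<close>
      lowers all values by \<open>b\<close> and moves the separating level to 0.\<close>
    define a' where "a' = a - b *\<^sub>R y"
    have a': "x \<bullet> a' < 0" "\<And>z. z \<in> ?Z \<Longrightarrow> 0 < z \<bullet> a'"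
      using ab(1) ab_Z x(2) by (auto simp: a'_def inner_diff_right inner_commute)
    \<comment> \<open>By \<open>finite_below\<close> the values other than 1 stay away from
      1.\<close>
    obtain \<delta> where \<delta>: "\<delta> > 0" "\<And>z. z \<in> X \<Longrightarrow> z \<bullet> y \<noteq> 1 \<Longrightarrow> 1 + \<delta> \<le> z \<bullet> y"
    proof -
      let ?E = "(\<lambda>z. z \<bullet> y) ` {z \<in> X. z \<bullet> y \<le> 2 \<and> z \<bullet> y \<noteq> 1}"
      have "finite {z \<in> X. z \<bullet> y \<le> 2 \<and> z \<bullet> y \<noteq> 1}"
        by (rule finite_subset[OF _ finite_below[OF y(1), of 2]]) auto
      then have fin: "finite (insert 2 ?E)" by simp
      show ?thesis
      proof
        have "\<forall>a\<in>insert 2 ?E. 1 < a" using y(2) by (auto simp: less_le)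
        then show "Min (insert 2 ?E) - 1 > 0" using fin by simp
        fix z assume "z \<in> X" "z \<bullet> y \<noteq> 1"
        then have "Min (insert 2 ?E) \<le> z \<bullet> y"
          using fin by (cases "z \<bullet> y \<le> 2") (auto intro: Min_le order_trans[of _ 2])
        then show "1 + (Min (insert 2 ?E) - 1) \<le> z \<bullet> y" by simp
      qed
    qed
    obtain K where K: "K > 0" "\<And>x. x \<in> closure C \<Longrightarrow> norm x \<le> K * (x \<bullet> y)"
      using norm_bound[OF y(1)] by blast
    define M where "M = K * norm a' + 1"
    have "M > 0" using K(1) by (simp add: M_def add_nonneg_pos)
    have M: "- (z \<bullet> a') \<le> M * (z \<bullet> y)" if "z \<in> X" for z
    proof -
      have "- (z \<bullet> a') \<le> norm z * norm a'" using Cauchy_Schwarz_ineq2[of z a'] by linarith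
      also have "\<dots> \<le> K * (z \<bullet> y) * norm a'"
        using K(2)[of z] that X_sub by (intro mult_right_mono) auto
      also have "\<dots> \<le> M * (z \<bullet> y)" using y(2)[OF that] by (simp add: M_def algebra_simps)
      finally show ?thesis .
    qed
    \<comment> \<open>Solves \<open>(1 - t * M) * (1 + \<delta>) = 1\<close>: with \<open>M\<close>
      bounding the loss, nonminimal vectors do not fall below 1.\<close>
    define t where "t = \<delta> / ((1 + \<delta>) * M)"
    have tM: "t * M = \<delta> / (1 + \<delta>)" using \<open>M > 0\<close> by (simp add: t_def)
    have t: "t > 0" "(1 - t * M) * (1 + \<delta>) = 1" "t * M \<le> 1"
      unfolding tM using \<delta>(1) \<open>M > 0\<close> by (auto simp: t_def field_simps add_pos_pos)
    have "1 \<le> z \<bullet> (y + t *\<^sub>R a')" if "z \<in> X" for z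
    proof (cases "z \<bullet> y = 1")
      case True
      then show ?thesis using a'(2)[of z] that t(1) by (simp add: inner_add_right)
    next
      case False
      have "1 \<le> (1 - t * M) * (z \<bullet> y)"
        using \<delta>(2)[OF that False] t(2,3) mult_left_mono[of "1 + \<delta>" "z \<bullet> y" "1 - t * M"] by simp
      also have "\<dots> \<le> z \<bullet> y + t * (z \<bullet> a')"
        using mult_left_mono[OF M[OF that], of t] t(1) by (simp add: algebra_simps)
      finally show ?thesis by (simp add: inner_add_right)
    qed
    from P_ge[OF this x(1)] have "1 \<le> x \<bullet> y + t * (x \<bullet> a')" by (simp add: inner_add_right)
    moreover have "t * (x \<bullet> a') < 0" using a'(1) t(1) by (simp add: mult_pos_neg)
    ultimately show False using x(2) by simp
  qed
qed

lemma supports_eq_convex_hull: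
  "supports F y \<Longrightarrow> F = convex hull {z \<in> X. z \<bullet> y = 1}"
  using face_eq_convex_hull[of y] X_sub_P by (auto simp: supports_def)

text \<open>Both facets contain \<open>B\<close>, so their intersection has codimension at most two;
  it is a proper face of \<open>F\<close> because \<open>z\<close> tells the facets apart.\<close>

lemma neighborI:
  assumes F: "F facet_of P" "supports F y"
    and y': "\<And>z. z \<in> X \<Longrightarrow> 1 \<le> z \<bullet> y'"
    and B: "independent B" "B \<subseteq> X" "card B + 1 = dim X"
      "\<And>b. b \<in> B \<Longrightarrow> b \<bullet> y = 1" "\<And>b. b \<in> B \<Longrightarrow> b \<bullet> y' = 1"
    and z: "z \<in> X" "z \<bullet> y' = 1" "z \<bullet> y \<noteq> 1"
  shows "neighbor P F {x \<in> P. x \<bullet> y' = 1}" (is "neighbor P F ?F'")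
proof -
  have nonempty: "X \<noteq> {}" using z(1) by blast
  have "z \<notin> span B"
    using inner_span_zero[of z B "y' - y"] B(4,5) z(2,3) by (auto simp: inner_diff_left inner_diff_right inner_commute)
  then have facet: "?F' facet_of P"
    using facet_of_insert[OF B(1-3) y' B(5)] z X_sub_P by blast
  have ne: "?F' \<noteq> F" using z F(2) X_sub_P by (auto simp: supports_def)
  have faces: "F face_of P" "?F' face_of P" using F(1) facet by (auto simp: facet_of_def)
  then have face: "(F \<inter> ?F') face_of P" by (rule face_of_Int)
  have dims: "aff_dim F = int (dim X) - 1" "aff_dim ?F' = int (dim X) - 1"
    using F(1) facet aff_dim_P[OF nonempty] by (auto simp: facet_of_def)
  have "B \<subseteq> F \<inter> ?F'" using B(2,4,5) F(2) X_sub_P by (auto simp: supports_def)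
  then have "int (dim X) - 2 \<le> aff_dim (F \<inter> ?F')"
    using aff_dim_subset[of B "F \<inter> ?F'"] independent_imp_aff_dim[OF B(1)] B(3) by linarith
  moreover have "aff_dim (F \<inter> ?F') < aff_dim F"
  proof (rule ccontr)
    assume "\<not> ?thesis"
    then have "F \<inter> ?F' = F" using face_of_eq_of_aff_dim[OF face faces(1)] by auto
    then have "F = ?F'" using face_of_eq_of_aff_dim[OF faces] dims by auto
    with ne show False by simp
  qed
  ultimately show ?thesis
    using facet ne face dims aff_dim_P[OF nonempty] by (simp add: neighbor_def)
qed

text \<open>A face of the hull of the finitely many minimal vectors is the hull of some of them. An
  affine basis among these lies at level 1 and is therefore linearly independent.\<close>

lemma neighbor_basis:
  assumes F: "supports F y" and F': "supports F' y'" and nb: "neighbor P F F'" and "X \<noteq> {}"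
  obtains B where "B \<subseteq> {z \<in> X. z \<bullet> y = 1}" "independent B" "card B + 1 = dim X"
    "\<And>b. b \<in> B \<Longrightarrow> b \<bullet> y' = 1"
proof -
  let ?Z = "{z \<in> X. z \<bullet> y = 1}"
  have "y \<in> C" using F by (simp add: supports_def)
  then have fin: "finite ?Z" by (intro finite_subset[OF _ finite_below[of y 1]]) auto
  have eq: "F = convex hull ?Z" using F by (rule supports_eq_convex_hull)
  have "(F \<inter> F') face_of F"
    using nb F face_of_subset[of "F \<inter> F'" P F] by (auto simp: neighbor_def supports_def)
  then have "(F \<inter> F') face_of (convex hull ?Z)" using eq by simp
  from face_of_convex_hull_subset[OF finite_imp_compact[OF fin] this]
  obtain Z0 where Z0: "Z0 \<subseteq> ?Z" "F \<inter> F' = convex hull Z0" .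
  obtain B where B: "B \<subseteq> Z0" "\<not> affine_dependent B" "affine hull Z0 = affine hull B"
    using affine_basis_exists by blast
  have ind: "independent B"
    by (rule affine_independent_imp_independent[OF B(2)]) (use B(1) Z0(1) in auto)
  have "aff_dim B = aff_dim (F \<inter> F')"
    unfolding Z0(2) aff_dim_convex_hull using B(3) aff_dim_affine_hull by metis
  then have "aff_dim B = int (dim X) - 2"
    using nb aff_dim_P[OF \<open>X \<noteq> {}\<close>] by (simp add: neighbor_def)
  then have "card B + 1 = dim X" using independent_imp_aff_dim[OF ind] by linarith
  moreover have "b \<bullet> y' = 1" if "b \<in> B" for b
  proof -
    have "b \<in> F \<inter> F'" unfolding Z0(2) using that B(1) by (meson hull_inc subsetD)
    then show ?thesis using F' by (simp add: supports_def)
  qed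
  ultimately show ?thesis using that[of B] B(1) Z0(1) ind by blast
qed

text \<open>\<open>B\<close> has codimension one in the span of \<open>X\<close>, so functionals
  vanishing on it are proportional there; cross multiplication avoids naming the factor.\<close>

lemma proportional_on_span:
  assumes B: "independent B" "B \<subseteq> X" "card B + 1 = dim X"
    and f: "\<And>b. b \<in> B \<Longrightarrow> f \<bullet> b = 0" and g: "\<And>b. b \<in> B \<Longrightarrow> g \<bullet> b = 0"
    and z: "z \<in> X" "g \<bullet> z \<noteq> 0" and x: "x \<in> span X"
  shows "(f \<bullet> x) * (g \<bullet> z) = (f \<bullet> z) * (g \<bullet> x)"
proof -
  have zB: "z \<notin> span B" using inner_span_zero[of z B g] g z(2) by blast
  then have "z \<notin> B" using span_base by blast
  moreover have ind: "independent (insert z B)" using zB B(1) by (rule independent_insertI)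
  ultimately have "card (insert z B) = dim X" using B(1,3) independent_imp_finite by fastforce
  then have "X \<subseteq> span (insert z B)"
    using card_ge_dim_independent[OF _ ind] B(2) z(1) by auto
  then have "x \<in> span (insert z B)" using x span_minimal subspace_span by blast
  then obtain k where "x - k *\<^sub>R z \<in> span (insert z B - {z})"
    using span_breakdown[of z "insert z B"] by blast
  then have "x - k *\<^sub>R z \<in> span B" using \<open>z \<notin> B\<close> by simp
  then have "f \<bullet> (x - k *\<^sub>R z) = 0" "g \<bullet> (x - k *\<^sub>R z) = 0"
    using inner_span_zero f g by blast+
  then show ?thesis by (simp add: inner_diff_right)
qed

text \<open>If \<open>y'\<close> were 1 on all minimal vectors of \<open>F\<close>, then
  \<open>F\<close> would lie in \<open>F'\<close> and the two facets would coincide.\<close>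

lemma neighbor_facets:
  assumes "supports F y" "supports F' y'" "neighbor P F F'" "F facet_of P"
  obtains z where "z \<in> X" "z \<bullet> y = 1" "0 < (y' - y) \<bullet> z"
proof -
  have "\<not> F \<subseteq> F'"
  proof
    assume "F \<subseteq> F'"
    then have "F = F'"
      using assms(3,4) by (intro face_of_eq_of_aff_dim[of F P F']) (auto simp: neighbor_def facet_of_def)
    with assms(3) show False by (simp add: neighbor_def)
  qed
  then have "\<not> {z \<in> X. z \<bullet> y = 1} \<subseteq> F'"
    using supports_eq_convex_hull[OF assms(1)] hull_minimal face_of_imp_convex assms(3)
    unfolding neighbor_def facet_of_def by metis
  then obtain z where z: "z \<in> X" "z \<bullet> y = 1" "z \<notin> F'" by blast
  then have "z \<bullet> y' > 1" using assms(2) X_sub_P by (force simp: supports_def less_le)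
  then show ?thesis using that[of z] z by (simp add: inner_diff_left inner_diff_right inner_commute)
qed

text \<open>On \<open>X\<close> the functional \<open>u\<close> is a multiple of
  \<open>y' - y\<close>, and that difference is nonnegative on the minimal vectors of
  \<open>F\<close>.\<close>

lemma no_sign_change_across_neighbor:
  assumes "supports F y" "supports F' y'" "neighbor P F F'" "F facet_of P"
    and B: "independent B" "B \<subseteq> X" "card B + 1 = dim X"
      "\<And>b. b \<in> B \<Longrightarrow> b \<bullet> y = 1" "\<And>b. b \<in> B \<Longrightarrow> b \<bullet> y' = 1"
    and u: "\<And>b. b \<in> B \<Longrightarrow> u \<bullet> b = 0"
    and x: "x1 \<in> X" "x1 \<bullet> y = 1" "x2 \<in> X" "x2 \<bullet> y = 1" "u \<bullet> x1 > 0" "u \<bullet> x2 < 0"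
  shows False
proof -
  obtain z where z: "z \<in> X" "z \<bullet> y = 1" "0 < (y' - y) \<bullet> z"
    using neighbor_facets[OF assms(1-4)] .
  have g: "(y' - y) \<bullet> b = 0" if "b \<in> B" for b
    using B(4,5)[OF that] by (simp add: inner_diff_left inner_diff_right inner_commute)
  have scale: "(u \<bullet> x) * ((y' - y) \<bullet> z) = (u \<bullet> z) * ((y' - y) \<bullet> x)" if "x \<in> X" for x
    using proportional_on_span[OF B(1-3) u g z(1)] z(3) that span_base by fastforce
  have ge: "0 \<le> (y' - y) \<bullet> x" if "x \<in> X" "x \<bullet> y = 1" for x
    using assms(2) that X_sub_P by (auto simp: supports_def inner_diff_left inner_diff_right inner_commute)
  have "0 < (u \<bullet> z) * ((y' - y) \<bullet> x1)" using scale[OF x(1)] x(5) z(3) by (metis mult_pos_pos)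
  moreover have "(u \<bullet> z) * ((y' - y) \<bullet> x2) < 0" using scale[OF x(3)] x(6) z(3) by (metis mult_neg_pos)
  ultimately show False
    using ge[OF x(1,2)] ge[OF x(3,4)] by (smt (verit) mult_nonneg_nonneg mult_nonpos_nonneg)
qed

text \<open>For \<open>k < 1\<close> the form \<open>y2\<close> is on \<open>P\<close> a proper
  average of \<open>y\<close> and \<open>y1\<close>, both at least 1. It would equal 1 only where
  \<open>y\<close> does, so \<open>F2\<close> would lie in \<open>F\<close>.\<close>

lemma pencil_scale_ge_1:
  assumes "supports F y" "supports F1 y1" "supports F2 y2" "neighbor P F F2" "F facet_of P"
    and scale: "\<And>x. x \<in> P \<Longrightarrow> (y2 - y) \<bullet> x = k * ((y1 - y) \<bullet> x)" and "0 < k"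
  shows "1 \<le> k"
proof (rule ccontr)
  assume "\<not> 1 \<le> k"
  have "F2 \<subseteq> F"
  proof
    fix x assume "x \<in> F2"
    then have x: "x \<in> P" "x \<bullet> y2 = 1" using assms(3) by (auto simp: supports_def)
    have "1 \<le> x \<bullet> y" "1 \<le> x \<bullet> y1" using x(1) assms(1,2) by (auto simp: supports_def)
    moreover have "x \<bullet> y2 - x \<bullet> y = k * (x \<bullet> y1 - x \<bullet> y)"
      using scale[OF x(1)] by (simp add: inner_diff_left inner_diff_right inner_commute)
    then have "(1 - k) * (x \<bullet> y - 1) + k * (x \<bullet> y1 - 1) = 0" using x(2) by (simp add: algebra_simps)
    moreover have "0 \<le> k * (x \<bullet> y1 - 1)" "0 \<le> (1 - k) * (x \<bullet> y - 1)"
      using calculation(1,2) \<open>0 < k\<close> \<open>\<not> 1 \<le> k\<close> by auto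
    ultimately have "(1 - k) * (x \<bullet> y - 1) = 0" by linarith
    then have "x \<bullet> y = 1" using \<open>\<not> 1 \<le> k\<close> by simp
    with x(1) show "x \<in> F" using assms(1) by (auto simp: supports_def)
  qed
  then have "F2 = F"
    using assms(4,5) by (intro face_of_eq_of_aff_dim[of F2 P F]) (auto simp: neighbor_def facet_of_def)
  with assms(4) show False by (simp add: neighbor_def)
qed

text \<open>The differences \<open>y1 - y\<close> and \<open>y2 - y\<close> vanish on
  \<open>B\<close>, hence differ by a factor \<open>k\<close>, which is positive. Comparing in both
  orders gives \<open>1 \<le> k\<close> and \<open>1 \<le> 1 / k\<close>.\<close>

lemma neighbor_unique:
  assumes F: "supports F y" "F facet_of P"
    and F1: "supports F1 y1" "neighbor P F F1" and F2: "supports F2 y2" "neighbor P F F2"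
    and B: "independent B" "B \<subseteq> X" "card B + 1 = dim X" "\<And>b. b \<in> B \<Longrightarrow> b \<bullet> y = 1"
      "\<And>b. b \<in> B \<Longrightarrow> b \<bullet> y1 = 1" "\<And>b. b \<in> B \<Longrightarrow> b \<bullet> y2 = 1"
  shows "F1 = F2"
proof -
  have zero: "(y1 - y) \<bullet> b = 0" "(y2 - y) \<bullet> b = 0" if "b \<in> B" for b
    using B(4-6)[OF that] by (auto simp: inner_diff_left inner_diff_right inner_commute)
  obtain z1 where z1: "z1 \<in> X" "0 < (y1 - y) \<bullet> z1"
    using neighbor_facets[OF F(1) F1 F(2)] .
  obtain z2 where z2: "z2 \<in> X" "0 < (y2 - y) \<bullet> z2" "z2 \<bullet> y = 1"
    using neighbor_facets[OF F(1) F2 F(2)] .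
  define k where "k = ((y2 - y) \<bullet> z1) / ((y1 - y) \<bullet> z1)"
  have k: "(y2 - y) \<bullet> x = k * ((y1 - y) \<bullet> x)" if "x \<in> P" for x
  proof -
    have "((y2 - y) \<bullet> x) * ((y1 - y) \<bullet> z1) = ((y2 - y) \<bullet> z1) * ((y1 - y) \<bullet> x)"
      using proportional_on_span[OF B(1-3) zero(2,1) z1(1)] z1(2) that P_sub_span by fastforce
    then show ?thesis using z1(2) unfolding k_def by (simp add: field_simps)
  qed
  have "0 \<le> (y1 - y) \<bullet> z2"
    using F1(1) z2(1,3) X_sub_P by (auto simp: supports_def inner_diff_left inner_diff_right inner_commute)
  then have "0 < k" using k[of z2] z2(1,2) X_sub_P
    by (metis mult_nonpos_nonneg not_le subsetD)
  then have "1 \<le> k" using pencil_scale_ge_1[OF F(1) F1(1) F2(1,2) F(2) k] by blast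
  moreover have "(y1 - y) \<bullet> x = (1 / k) * ((y2 - y) \<bullet> x)" if "x \<in> P" for x
    using k[OF that] \<open>0 < k\<close> by simp
  from pencil_scale_ge_1[OF F(1) F2(1) F1(1,2) F(2) this] \<open>0 < k\<close> have "1 \<le> 1 / k" by simp
  ultimately have "k = 1" using \<open>0 < k\<close> by (simp add: field_simps)
  then have "x \<bullet> y1 = x \<bullet> y2" if "x \<in> P" for x
    using k[OF that] by (simp add: inner_diff_left inner_diff_right inner_commute)
  then show ?thesis using F1(1) F2(1) unfolding supports_def by auto
qed

lemma span_facet_eq:
  assumes "supports F y" "F facet_of P" "X \<noteq> {}"
  shows "dim {z \<in> X. z \<bullet> y = 1} = dim X"
proof -
  let ?Z = "{z \<in> X. z \<bullet> y = 1}"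
  obtain B where B: "B \<subseteq> ?Z" "\<not> affine_dependent B" "affine hull ?Z = affine hull B"
    using affine_basis_exists by blast
  have ind: "independent B"
    by (rule affine_independent_imp_independent[OF B(2)]) (use B(1) in auto)
  have "aff_dim B = aff_dim F"
    unfolding supports_eq_convex_hull[OF assms(1)] aff_dim_convex_hull
    using B(3) aff_dim_affine_hull by metis
  then have "card B = dim X"
    using assms(2) aff_dim_P[OF assms(3)] independent_imp_aff_dim[OF ind] by (simp add: facet_of_def)
  then have "dim X \<le> dim ?Z"
    using dim_subset[OF B(1)] dim_eq_card_independent[OF ind] by simp
  moreover have "dim ?Z \<le> dim X" by (rule dim_subset) auto
  ultimately show ?thesis by simp
qed

text \<open>If no functional vanishing on \<open>S\<close> changes sign on the minimal vectors, then \<open>S\<close> spans a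
  codimension-two face: otherwise two minimal vectors independent modulo \<open>S\<close> could be given
  values of opposite signs.\<close>

lemma sign_change_or_neighbor:
  assumes perfect: "\<And>F. F facet_of P \<Longrightarrow> \<exists>y. supports F y"
    and F: "supports F y" "F facet_of P" and dimX: "2 \<le> dim X"
    and S: "finite S" "S \<subseteq> {z \<in> X. z \<bullet> y = 1}" "card S + 1 \<le> dim X"
  obtains u where "\<And>s. s \<in> S \<Longrightarrow> u \<bullet> s = 0" "\<exists>z\<in>X. z \<bullet> y = 1 \<and> u \<bullet> z > 0" "\<exists>z\<in>X. z \<bullet> y = 1 \<and> u \<bullet> z < 0"
  | F' y' where "neighbor P F F'" "supports F' y'" "S \<subseteq> F'" "independent S" "card S + 1 = dim X"
      "\<exists>z\<in>X. z \<in> F' \<and> z \<bullet> y \<noteq> 1"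
proof (cases "\<exists>u. (\<forall>s\<in>S. u \<bullet> s = 0) \<and> (\<exists>z\<in>X. z \<bullet> y = 1 \<and> u \<bullet> z > 0) \<and> (\<exists>z\<in>X. z \<bullet> y = 1 \<and> u \<bullet> z < 0)")
  case True
  then show ?thesis using that(1) by blast
next
  case none: False
  let ?Z = "{z \<in> X. z \<bullet> y = 1}"
  have nonempty: "X \<noteq> {}" using dimX by auto
  have dimZ: "dim ?Z = dim X" using F nonempty by (rule span_facet_eq)
  have out: "\<exists>z\<in>?Z. z \<notin> span T" if "dim T < dim X" for T
    using dim_subset[of ?Z "span T"] that dimZ by auto
  have dimS: "dim S + 1 = dim X"
  proof (rule ccontr)
    assume "dim S + 1 \<noteq> dim X"
    moreover have "dim S \<le> card S" using dim_le_card'[OF S(1)] .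
    ultimately have lt: "dim S + 1 < dim X" using S(3) by linarith
    obtain B where B: "B \<subseteq> S" "independent B" "S \<subseteq> span B" "card B = dim S"
      using basis_exists by blast
    obtain z1 where z1: "z1 \<in> ?Z" "z1 \<notin> span B"
      using out[of B] dim_eq_card_independent[OF B(2)] B(4) lt by (metis add_lessD1)
    have ind1: "independent (insert z1 B)" using z1(2) B(2) by (rule independent_insertI)
    have "dim (insert z1 B) = card B + 1"
      using z1(2) dim_eq_card_independent[OF B(2)] by (simp add: dim_insert)
    then have "dim (insert z1 B) < dim X" using B(4) lt by linarith
    then obtain z2 where z2: "z2 \<in> ?Z" "z2 \<notin> span (insert z1 B)"
      using out by blast
    have ind2: "independent (insert z2 (insert z1 B))"
      using z2(2) ind1 by (rule independent_insertI)
    have ne: "z1 \<notin> B" "z2 \<notin> insert z1 B" 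
      using z1(2) z2(2) span_base[of z1 B] span_base[of z2 "insert z1 B"] by blast+
    let ?f = "\<lambda>b. if b = z1 then 1 else if b = z2 then - 1 else 0 :: real"
    obtain u where u: "\<forall>b\<in>insert z2 (insert z1 B). u \<bullet> b = ?f b"
      using functional_on_independent[OF ind2, where f = ?f] by blast
    have "u \<bullet> b = 0" if "b \<in> B" for b
    proof -
      have "b \<noteq> z1" "b \<noteq> z2" using that ne by auto
      then show ?thesis using u that by simp
    qed
    then have "u \<bullet> s = 0" if "s \<in> S" for s using inner_span_zero[of s B u] that B(3) by blast
    moreover have "u \<bullet> z1 > 0" "u \<bullet> z2 < 0" using u ne(2) by simp_all
    ultimately show False using none z1(1) z2(1) by blast
  qed
  \<comment> \<open>Since the span has dimension at least the number of vectors, \<open>S\<close>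
    must be independent.\<close>
  have "card S \<le> dim S" using dimS S(3) by simp
  then have ind: "independent S"
    using card_le_dim_spanning[of S "span S"] S(1) span_superset by auto
  then have card: "card S + 1 = dim X" using dimS dim_eq_card_independent by metis
  have "span S \<subset> span X"
  proof
    show "span S \<subseteq> span X" using S(2) by (intro span_mono) auto
    have "dim (span S) < dim (span X)" using dimS by simp
    then show "span S \<noteq> span X" by (intro notI) simp
  qed
  then obtain r0 where r0: "r0 \<noteq> 0" "r0 \<in> span X" "\<And>x. x \<in> span S \<Longrightarrow> orthogonal r0 x"
    using orthogonal_to_subspace_exists_gen by blast
  have r0S: "r0 \<bullet> s = 0" if "s \<in> S" for s using r0(3) span_base[OF that] by (simp add: orthogonal_def)
  have r0X: "\<exists>z\<in>X. r0 \<bullet> z \<noteq> 0" using inner_span_zero[OF r0(2), of r0] r0(1) by auto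
  \<comment> \<open>As \<open>r0\<close> does not change sign on the minimal vectors,
    \<open>r0\<close> or its negative is nonnegative on them.\<close>
  have "\<exists>r. (\<forall>s\<in>S. r \<bullet> s = 0) \<and> (\<exists>z\<in>X. r \<bullet> z \<noteq> 0) \<and> (\<forall>z\<in>?Z. 0 \<le> r \<bullet> z)"
  proof (cases "\<forall>z\<in>?Z. 0 \<le> r0 \<bullet> z")
    case True
    then show ?thesis using r0S r0X by blast
  next
    case False
    then have "\<forall>z\<in>?Z. r0 \<bullet> z \<le> 0" using none r0S by (auto simp: not_le intro: leI)
    then show ?thesis using r0S r0X by (intro exI[of _ "- r0"]) auto
  qed
  then obtain r where r: "\<And>s. s \<in> S \<Longrightarrow> r \<bullet> s = 0" "\<exists>z\<in>X. r \<bullet> z \<noteq> 0" "\<And>z. z \<in> ?Z \<Longrightarrow> 0 \<le> r \<bullet> z"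
    by blast
  have y: "y \<in> C" "\<And>z. z \<in> X \<Longrightarrow> 1 \<le> z \<bullet> y" using F(1) X_sub_P by (auto simp: supports_def)
  have SX: "S \<subseteq> X" "S \<noteq> {}" "\<And>s. s \<in> S \<Longrightarrow> s \<bullet> y = 1" using S(2) card dimX by auto
  obtain F' y' where F': "F' facet_of P" "supports F' y'" "S \<subseteq> F'" "\<exists>z\<in>X. z \<in> F' \<and> z \<bullet> r < 0"
    using facet_across_exists[OF perfect y ind SX(1) card SX(2,3) r(1,2)] by blast
  then obtain z where z: "z \<in> X" "z \<in> F'" "z \<bullet> r < 0" by blast
  \<comment> \<open>A vector on the negative side of \<open>r\<close> cannot be minimal for
    \<open>y\<close>, so it is new.\<close>
  then have zy: "z \<bullet> y \<noteq> 1" using r(3)[of z] by (auto simp: inner_commute)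
  have eq: "F' = {x \<in> P. x \<bullet> y' = 1}" and ge: "\<And>z. z \<in> X \<Longrightarrow> 1 \<le> z \<bullet> y'"
    using F'(2) X_sub_P by (auto simp: supports_def)
  have "neighbor P F F'"
    unfolding eq by (rule neighborI[OF F(2,1) ge ind SX(1) card SX(3) _ z(1) _ zy])
      (use F'(3) z(2) eq in auto)
  then show ?thesis using that(2)[of F' y'] F' ind card z zy by blast
qed

text \<open>\<open>B\<close> is empty, so \<open>y\<close> and \<open>y' - y\<close> are
  proportional on the line spanned by \<open>X\<close>. Comparing a minimal vector \<open>z\<close>
  of \<open>y\<close> with a minimal vector \<open>w\<close> of \<open>y'\<close> gives
  \<open>y \<bullet> w < 1\<close>, which \<open>supports\<close> forbids.\<close>

lemma no_neighbors_of_dim_le_1: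
  assumes "dim X \<le> 1" "F facet_of P" "supports F y" "supports F' y'"
  shows "\<not> neighbor P F F'"
proof
  assume nb: "neighbor P F F'"
  then have "F' facet_of P" "F' \<noteq> F" by (auto simp: neighbor_def)
  have "P \<noteq> {}" using assms(2) by (auto simp: facet_of_def face_of_def)
  then have "X \<noteq> {}" by (auto simp: P_def)
  obtain B where B: "card B + 1 = dim X" "B \<subseteq> {z \<in> X. z \<bullet> y = 1}"
      "independent B" "\<And>b. b \<in> B \<Longrightarrow> b \<bullet> y' = 1"
    using neighbor_basis[OF assms(3,4) nb \<open>X \<noteq> {}\<close>] by metis
  then have "card B = 0" "dim X = 1" using assms(1) by auto
  then have "B = {}" using independent_imp_finite[OF B(3)] by simp
  obtain z where z: "z \<in> X" "z \<bullet> y = 1" "0 < (y' - y) \<bullet> z"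
    using neighbor_facets[OF assms(3,4) nb assms(2)] .
  obtain w where w: "w \<in> X" "w \<bullet> y' = 1"
    using span_facet_eq[OF assms(4) \<open>F' facet_of P\<close> \<open>X \<noteq> {}\<close>] \<open>dim X = 1\<close>
    by (metis (mono_tags, lifting) dim_empty empty_Collect_eq zero_neq_one)
  have "(y' - y) \<bullet> w * (y \<bullet> z) = (y' - y) \<bullet> z * (y \<bullet> w)"
    using proportional_on_span[of B "y' - y" y z w] B(1,3) \<open>B = {}\<close> z w span_base[of w X]
    by (auto simp: inner_commute)
  then have "1 - y \<bullet> w = (y' - y) \<bullet> z * (y \<bullet> w)"
    using z(2) w(2) by (simp add: inner_diff_left inner_diff_right inner_commute)
  moreover have "1 \<le> y \<bullet> w" using assms(3) w(1) X_sub_P by (auto simp: supports_def inner_commute)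
  moreover have "0 < (y' - y) \<bullet> z * (y \<bullet> w)" using z(3) \<open>1 \<le> y \<bullet> w\<close> by simp
  ultimately show False by linarith
qed

end

section \<open>Rational linear algebra\<close>

text \<open>The pairing of coordinates, not the scalar product, because \<open>bs\<close> need not
  be orthonormal. It evaluates functionals given by their values on \<open>bs\<close>; scalar
  products go through the Gram matrix.\<close>

definition dot :: "rat list \<Rightarrow> rat list \<Rightarrow> rat" where
  "dot u v = sum_list (map (\<lambda>p. fst p * snd p) (zip u v))"

definition mat_vec :: "rat list list \<Rightarrow> rat list \<Rightarrow> rat list" where
  "mat_vec M v = map (\<lambda>row. dot row v) M"

lemma dot_eq_sum: "length u = n \<Longrightarrow> length v = n \<Longrightarrow> dot u v = (\<Sum>i<n. u ! i * v ! i)"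
  by (simp add: dot_def sum_list_sum_nth atLeast0LessThan)

lemma mat_vec_nth: "i < length M \<Longrightarrow> mat_vec M v ! i = dot (M ! i) v"
  by (simp add: mat_vec_def)

lemma length_mat_vec [simp]: "length (mat_vec M v) = length M"
  by (simp add: mat_vec_def)

text \<open>Approximating the coordinates one at a time, a coordinate in the rational span of the
  previous ones has to be replaced by the same rational combination, and any other one is free.\<close>

lemma rational_approximation_of_relations:
  fixes x :: "nat \<Rightarrow> real"
  assumes "\<epsilon> > 0"
  shows "\<exists>q::nat \<Rightarrow> rat. (\<forall>i<n. \<bar>of_rat (q i) - x i\<bar> < \<epsilon>) \<and>
    (\<forall>a::nat \<Rightarrow> rat. (\<Sum>i<n. of_rat (a i) * x i) = 0 \<longrightarrow> (\<Sum>i<n. a i * q i) = 0)"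
  using assms
proof (induction n arbitrary: \<epsilon>)
  case 0
  then show ?case by simp
next
  case (Suc n)
  show ?case
  proof (cases "\<exists>c::nat \<Rightarrow> rat. x n = (\<Sum>i<n. of_rat (c i) * x i)")
    case True
    then obtain c :: "nat \<Rightarrow> rat" where c: "x n = (\<Sum>i<n. of_rat (c i) * x i)" by blast
    define A where "A = (\<Sum>i<n. \<bar>real_of_rat (c i)\<bar>)"
    have A: "0 \<le> A" unfolding A_def by (intro sum_nonneg) auto
    \<comment> \<open>The dependent coordinate inherits the earlier errors amplified by at most
      \<open>A\<close>.\<close>
    define \<epsilon>' where "\<epsilon>' = \<epsilon> / (1 + A)"
    have \<epsilon>': "\<epsilon>' > 0" "A * \<epsilon>' < \<epsilon>" "\<epsilon>' \<le> \<epsilon>"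
      using Suc.prems A by (auto simp: \<epsilon>'_def field_simps add_pos_nonneg intro!: mult_nonneg_nonneg)
    obtain q :: "nat \<Rightarrow> rat" where q: "\<And>i. i < n \<Longrightarrow> \<bar>of_rat (q i) - x i\<bar> < \<epsilon>'"
      "\<And>a::nat \<Rightarrow> rat. (\<Sum>i<n. of_rat (a i) * x i) = 0 \<Longrightarrow> (\<Sum>i<n. a i * q i) = 0"
      using Suc.IH[OF \<epsilon>'(1)] by blast
    define q' where "q' = q(n := (\<Sum>i<n. c i * q i))"
    have "\<bar>of_rat (q' n) - x n\<bar> = \<bar>\<Sum>i<n. of_rat (c i) * (of_rat (q i) - x i)\<bar>"
      unfolding q'_def c by (simp add: of_rat_sum of_rat_mult sum_subtractf right_diff_distrib)
    also have "\<dots> \<le> (\<Sum>i<n. \<bar>of_rat (c i)\<bar> * \<bar>of_rat (q i) - x i\<bar>)"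
      by (rule order_trans[OF sum_abs]) (simp add: abs_mult)
    also have "\<dots> \<le> (\<Sum>i<n. \<bar>of_rat (c i)\<bar> * \<epsilon>')"
      using q(1) by (intro sum_mono mult_left_mono) (auto intro: less_imp_le)
    also have "\<dots> = A * \<epsilon>'" by (simp add: A_def sum_distrib_right)
    finally have near: "\<bar>of_rat (q' n) - x n\<bar> < \<epsilon>" using \<epsilon>'(2) by simp
    have "\<bar>of_rat (q' i) - x i\<bar> < \<epsilon>" if "i < Suc n" for i
      using near q(1)[of i] that \<epsilon>'(3) by (cases "i = n") (auto simp: q'_def)
    moreover have "(\<Sum>i<Suc n. a i * q' i) = 0" if "(\<Sum>i<Suc n. of_rat (a i) * x i) = 0" for a :: "nat \<Rightarrow> rat"
    proof -
      have "(\<Sum>i<n. of_rat (a i + a n * c i) * x i) = (\<Sum>i<Suc n. of_rat (a i) * x i)"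
        by (simp add: c of_rat_add of_rat_mult sum.distrib sum_distrib_left algebra_simps)
      then have "(\<Sum>i<n. (a i + a n * c i) * q i) = 0" using q(2) that by simp
      then show ?thesis by (simp add: q'_def sum.distrib sum_distrib_left algebra_simps)
    qed
    ultimately show ?thesis by blast
  next
    case False
    obtain q :: "nat \<Rightarrow> rat" where q: "\<And>i. i < n \<Longrightarrow> \<bar>of_rat (q i) - x i\<bar> < \<epsilon>"
      "\<And>a::nat \<Rightarrow> rat. (\<Sum>i<n. of_rat (a i) * x i) = 0 \<Longrightarrow> (\<Sum>i<n. a i * q i) = 0"
      using Suc.IH[OF Suc.prems] by blast
    obtain r :: rat where r: "x n < of_rat r" "of_rat r < x n + \<epsilon>"
      using of_rat_dense[of "x n" "x n + \<epsilon>"] Suc.prems by auto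
    define q' where "q' = q(n := r)"
    have "\<bar>of_rat (q' i) - x i\<bar> < \<epsilon>" if "i < Suc n" for i
      using r q(1)[of i] that by (cases "i = n") (auto simp: q'_def)
    moreover have "(\<Sum>i<Suc n. a i * q' i) = 0" if *: "(\<Sum>i<Suc n. of_rat (a i) * x i) = 0" for a :: "nat \<Rightarrow> rat"
    proof -
      have "a n = 0"
      proof (rule ccontr)
        assume "a n \<noteq> 0"
        then have "x n = - (\<Sum>i<n. of_rat (a i) * x i) / of_rat (a n)"
          using * by (simp add: field_simps)
        also have "\<dots> = (\<Sum>i<n. of_rat (- a i / a n) * x i)"
          by (simp add: of_rat_divide of_rat_minus sum_divide_distrib sum_negf)
        finally show False using False by (metis (no_types))
      qed
      then show ?thesis using q(2)[of a] * by (simp add: q'_def)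
    qed
    ultimately show ?thesis by blast
  qed
qed

lemma sgn_eq_of_close: "\<bar>b - a\<bar> < \<bar>a\<bar> \<Longrightarrow> sgn b = sgn (a::real)"
  by (auto simp: sgn_if abs_if split: if_splits)

text \<open>A zero value is a rational relation among the \<open>x i\<close> and is preserved
  exactly. The finitely many nonzero values are at least \<open>\<mu>\<close> in absolute value and
  keep their sign under an error below \<open>\<mu>\<close>.\<close>

lemma rational_functional_with_same_signs:
  fixes x :: "nat \<Rightarrow> real"
  assumes "finite Q" "\<And>a. a \<in> Q \<Longrightarrow> length a = n"
  shows "\<exists>w. length w = n \<and> (\<forall>a\<in>Q. sgn (real_of_rat (dot w a)) = sgn (\<Sum>i<n. of_rat (a ! i) * x i))"
proof -
  define s where "s a = (\<Sum>i<n. of_rat (a ! i) * x i)" for a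
  define A where "A = 1 + (\<Sum>a\<in>Q. \<Sum>i<n. \<bar>real_of_rat (a ! i)\<bar>)"
  define \<mu> where "\<mu> = Min (insert 1 ((\<lambda>a. \<bar>s a\<bar>) ` {a \<in> Q. s a \<noteq> 0}))"
  have A: "A > 0" unfolding A_def by (intro add_pos_nonneg sum_nonneg) auto
  have fin: "finite (insert 1 ((\<lambda>a. \<bar>s a\<bar>) ` {a \<in> Q. s a \<noteq> 0}))" using assms(1) by simp
  have "\<forall>b\<in>insert 1 ((\<lambda>a. \<bar>s a\<bar>) ` {a \<in> Q. s a \<noteq> 0}). 0 < b" by auto
  then have \<mu>: "\<mu> > 0" unfolding \<mu>_def using fin by simp
  have \<mu>_le: "\<mu> \<le> \<bar>s a\<bar>" if "a \<in> Q" "s a \<noteq> 0" for a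
    unfolding \<mu>_def by (rule Min_le[OF fin]) (use that in auto)
  obtain q :: "nat \<Rightarrow> rat" where q: "\<And>i. i < n \<Longrightarrow> \<bar>of_rat (q i) - x i\<bar> < \<mu> / A"
      "\<And>a::nat \<Rightarrow> rat. (\<Sum>i<n. of_rat (a i) * x i) = 0 \<Longrightarrow> (\<Sum>i<n. a i * q i) = 0"
    using rational_approximation_of_relations[of "\<mu> / A" n x] A \<mu> by auto
  define w where "w = map q [0..<n]"
  have dot: "dot w a = (\<Sum>i<n. a ! i * q i)" if "a \<in> Q" for a
    using assms(2)[OF that] by (simp add: dot_eq_sum[of _ n] w_def mult.commute)
  have "sgn (real_of_rat (dot w a)) = sgn (s a)" if a: "a \<in> Q" for a
  proof (cases "s a = 0")
    case True
    then show ?thesis using q(2)[of "\<lambda>i. a ! i"] dot[OF a] by (simp add: s_def)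
  next
    case False
    have "\<bar>of_rat (dot w a) - s a\<bar> = \<bar>\<Sum>i<n. of_rat (a ! i) * (of_rat (q i) - x i)\<bar>"
      by (simp add: dot[OF a] s_def of_rat_sum of_rat_mult sum_subtractf right_diff_distrib)
    also have "\<dots> \<le> (\<Sum>i<n. \<bar>of_rat (a ! i)\<bar> * \<bar>of_rat (q i) - x i\<bar>)"
      by (rule order_trans[OF sum_abs]) (simp add: abs_mult)
    also have "\<dots> \<le> (\<Sum>i<n. \<bar>of_rat (a ! i)\<bar> * (\<mu> / A))"
      using q(1) by (intro sum_mono mult_left_mono) (auto intro: less_imp_le)
    also have "\<dots> = (\<Sum>i<n. \<bar>real_of_rat (a ! i)\<bar>) * (\<mu> / A)"
      by (simp only: sum_distrib_right)
    also have "\<dots> < A * (\<mu> / A)"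
    proof (rule mult_strict_right_mono)
      have "(\<Sum>i<n. \<bar>real_of_rat (a ! i)\<bar>) \<le> (\<Sum>a\<in>Q. \<Sum>i<n. \<bar>real_of_rat (a ! i)\<bar>)"
        using assms(1) a by (intro member_le_sum) (auto intro: sum_nonneg)
      then show "(\<Sum>i<n. \<bar>real_of_rat (a ! i)\<bar>) < A" by (simp add: A_def)
    qed (use A \<mu> in simp)
    also have "\<dots> = \<mu>" using A by simp
    finally have "\<bar>of_rat (dot w a) - s a\<bar> < \<bar>s a\<bar>" using \<mu>_le[OF a False] by simp
    then show ?thesis by (rule sgn_eq_of_close)
  qed
  then show ?thesis by (intro exI[of _ w]) (simp add: w_def s_def)
qed

section \<open>Verification of certificates\<close>

definition small_ints :: "nat \<Rightarrow> rat list" where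
  "small_ints m = rec_nat [0] (\<lambda>k r. of_nat (Suc k) # - of_nat (Suc k) # r) m"

lemma set_small_ints: "set (small_ints m) = rat_of_int ` {- int m..int m}"
proof (induction m)
  case 0
  show ?case by (simp add: small_ints_def)
next
  case (Suc m)
  have "{- int (Suc m)..int (Suc m)} = insert (int (Suc m)) (insert (- int (Suc m)) {- int m..int m})"
    by auto
  moreover have "small_ints (Suc m) = of_nat (Suc m) # - of_nat (Suc m) # small_ints m"
    by (simp add: small_ints_def)
  ultimately show ?case using Suc.IH by simp
qed

text \<open>In the following, \<open>n\<close> is the dimension of the space, \<open>M\<close> the matrix whose columns are the
  coordinates of the \<open>l\<close> basis vectors of the lattice, \<open>G\<close> the Gram matrix, \<open>e\<close> a rational
  point of the cone, and \<open>m\<close> the dimension of the span of the cusp vectors.  If \<open>y \<in> C\<close> and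
  \<open>N y - e \<in> C\<close>, then all cusp vectors \<open>z\<close> with \<open>\<langle>z, y\<rangle> \<le> 1\<close> are among the candidates.\<close>

definition candidates :: "rat list list \<Rightarrow> nat \<Rightarrow> nat \<Rightarrow> rat list list" where
  "candidates M l r = map (\<lambda>k. mat_vec M k) (List.n_lists l (small_ints r))"

text \<open>Asked only about lattice points, it decides membership in \<open>cusp_vectors\<close>;
  the second clause excludes the origin.\<close>

definition cusp_query :: "(nat \<Rightarrow> nat \<Rightarrow> nat) \<Rightarrow> rat list \<Rightarrow> bool" where
  "cusp_query orc q \<longleftrightarrow> orc 1 (code q) = 1 \<and> (\<exists>a\<in>set q. a \<noteq> 0)"

text \<open>The quantifier over candidates stands for one over all cusp vectors, because those
  outside the box have value greater than 1. That the minimal vectors span a facet is left to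
  \<open>certifies_neighbor\<close>.\<close>

definition certifies_perfect ::
    "(nat \<Rightarrow> nat \<Rightarrow> nat) \<Rightarrow> nat \<Rightarrow> rat list list \<Rightarrow> rat list list \<Rightarrow> nat \<Rightarrow> nat \<Rightarrow> rat list \<Rightarrow> nat \<Rightarrow> facet_data \<Rightarrow> bool" where
  "certifies_perfect orc n G M l K e N d \<longleftrightarrow>
     length (fst d) = n \<and> (\<forall>q\<in>set (snd d). length q = n) \<and>
     orc 0 (code (fst d)) = 1 \<and>
     orc 0 (code (map (\<lambda>p. of_nat N * fst p - snd p) (zip (fst d) e))) = 1 \<and>
     (\<forall>q\<in>set (candidates M l (K * N)). cusp_query orc q \<longrightarrow>
        1 \<le> dot (mat_vec G (fst d)) q \<and> (dot (mat_vec G (fst d)) q = 1 \<longrightarrow> q \<in> set (snd d))) \<and>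
     (\<forall>q\<in>set (snd d). q \<in> set (candidates M l (K * N)) \<and> cusp_query orc q \<and>
        dot (mat_vec G (fst d)) q = 1)"

text \<open>\<open>ws\<close> contains a system dual to \<open>S\<close> up to scale, a rational
  proof of independence. The last clause provides a vector outside the given facet, which makes the
  new face a different facet.\<close>

definition certifies_neighbor ::
    "nat \<Rightarrow> nat \<Rightarrow> facet_data \<Rightarrow> facet_data \<Rightarrow> rat list list \<Rightarrow> rat list list \<Rightarrow> bool" where
  "certifies_neighbor n m d d' S ws \<longleftrightarrow>
     distinct S \<and> length S + 1 = m \<and> (\<forall>s\<in>set S. s \<in> set (snd d) \<and> s \<in> set (snd d')) \<and>
     (\<forall>s\<in>set S. \<exists>w\<in>set ws. length w = n \<and> dot w s \<noteq> 0 \<and> (\<forall>t\<in>set S. t \<noteq> s \<longrightarrow> dot w t = 0)) \<and>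
     (\<exists>q\<in>set (snd d'). q \<notin> set (snd d))"

definition separates :: "nat \<Rightarrow> rat list list \<Rightarrow> rat list list \<Rightarrow> rat list \<Rightarrow> bool" where
  "separates n Z S u \<longleftrightarrow> length u = n \<and> (\<forall>s\<in>set S. dot u s = 0) \<and>
     (\<exists>z\<in>set Z. 0 < dot u z) \<and> (\<exists>z\<in>set Z. dot u z < 0)"

text \<open>In order: the output facets; tuples \<open>S\<close> with their dual rows and the
  numbers \<open>N\<close>; the sign-changing functionals.\<close>

type_synonym certificate = "facet_data list \<times> (rat list list \<times> rat list list \<times> nat) list \<times> rat list list"

text \<open>The first clause admits only neighbors to the list; the second accounts for every tuple
  that might span the common face with a neighbor.\<close>

definition check ::
    "(nat \<Rightarrow> nat \<Rightarrow> nat) \<Rightarrow> nat \<Rightarrow> rat list list \<Rightarrow> rat list list \<Rightarrow> nat \<Rightarrow> nat \<Rightarrow> rat list \<Rightarrow> nat \<Rightarrow>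
      facet_data \<Rightarrow> certificate \<Rightarrow> bool" where
  "check orc n G M l K e m d w \<longleftrightarrow>
     (\<forall>d'\<in>set (fst w). \<exists>c\<in>set (fst (snd w)).
        certifies_perfect orc n G M l K e (snd (snd c)) d' \<and>
        certifies_neighbor n m d d' (fst c) (fst (snd c))) \<and>
     (\<forall>S\<in>set (List.n_lists (m - 1) (snd d)).
        (\<exists>u\<in>set (snd (snd w)). separates n (snd d) S u) \<or>
        (\<exists>d'\<in>set (fst w). \<forall>s\<in>set S. s \<in> set (snd d')))"

section \<open>Computability of the check\<close>

lemma computable_dot [computable]:
  "computable orc f \<Longrightarrow> computable orc g \<Longrightarrow> computable orc (\<lambda>x. dot (f x) (g x))"
  unfolding dot_def by (intro computable)

lemma computable_mat_vec [computable]: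
  assumes "computable orc f"
  shows "computable orc (\<lambda>x. mat_vec M (f x))"
  unfolding mat_vec_def
  using computable_comp[OF assms computable_snd[OF computable_id]]
  by (intro computable_map[where l = "\<lambda>_. M" and f = "\<lambda>row x. dot row (f x)"] computable)

lemma computable_small_ints [computable]:
  assumes "computable orc f"
  shows "computable orc (\<lambda>x. small_ints (f x))"
  unfolding small_ints_def
  by (intro computable_rec_nat[where f = "\<lambda>_. [0]" and g = "\<lambda>k r x. of_nat (Suc k) # - of_nat (Suc k) # r"] computable assms)

lemma computable_candidates [computable]:
  assumes "computable orc f"
  shows "computable orc (\<lambda>x. candidates M l (f x))"
  unfolding candidates_def
  by (intro computable_map[where f = "\<lambda>k x. mat_vec M k"] computable assms)

lemma computable_oracle [computable]:
  assumes "computable orc f"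
  shows "computable orc (\<lambda>x. orc i (code (f x)))"
proof -
  have "computable orc (orc i)" by (rule computable_query[where i = i]) simp
  from computable_comp[OF this computable_code[OF assms]] show ?thesis .
qed

lemma computable_cusp_query [computable]:
  assumes "computable orc f"
  shows "computable orc (\<lambda>x. cusp_query orc (f x))"
  unfolding cusp_query_def
  by (intro computable computable_Bex[where P = "\<lambda>a x. a \<noteq> 0"] assms)

lemma computable_certifies_perfect [computable]:
  assumes "computable orc f" "computable orc g"
  shows "computable orc (\<lambda>x. certifies_perfect orc n G M l K e (f x) (g x))"
proof -
  have "computable orc (\<lambda>p. certifies_perfect orc n G M l K e (fst p) (snd p))"
    unfolding certifies_perfect_def
    by (intro computable computable_Ball computable_map)
  from computable_comp[OF this computable_Pair[OF assms]] show ?thesis by simp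
qed

lemma computable_certifies_neighbor [computable]:
  assumes "computable orc f" "computable orc g" "computable orc h" "computable orc k"
  shows "computable orc (\<lambda>x. certifies_neighbor n m (f x) (g x) (h x) (k x))"
proof -
  have "computable orc (\<lambda>p. certifies_neighbor n m (fst p) (fst (snd p)) (fst (snd (snd p))) (snd (snd (snd p))))"
    unfolding certifies_neighbor_def
    by (intro computable computable_Ball computable_Bex)
  from computable_comp[OF this computable_Pair[OF assms(1) computable_Pair[OF assms(2) computable_Pair[OF assms(3,4)]]]]
  show ?thesis by simp
qed

lemma computable_separates [computable]:
  assumes "computable orc f" "computable orc g" "computable orc h"
  shows "computable orc (\<lambda>x. separates n (f x) (g x) (h x))"
proof -
  have "computable orc (\<lambda>p. separates n (fst p) (fst (snd p)) (snd (snd p)))"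
    unfolding separates_def
    by (intro computable computable_Ball computable_Bex)
  from computable_comp[OF this computable_Pair[OF assms(1) computable_Pair[OF assms(2,3)]]]
  show ?thesis by simp
qed

lemma computable_check:
  "computable orc (\<lambda>p. check orc n G M l K e m (fst p) (snd p))"
  unfolding check_def
  by (intro computable computable_Ball computable_Bex)

section \<open>Correctness of the certificates\<close>

lemma code_vec_eq: "code_vec q = code q"
proof -
  have "code_rat = code" by (simp add: fun_eq_iff code_rat_def code_rat_eq code_prod_def code_int_def)
  then show ?thesis by (simp add: code_vec_def code_list_def)
qed

lemma code_facet_eq: "code_facet d = code d"
proof -
  have "code_vec = code" by (simp add: fun_eq_iff code_vec_eq)
  then show ?thesis by (simp add: code_facet_def code_prod_def code_list_def[of "snd d"])
qed

lemma code_facets_eq: "code_facets ds = code ds"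
proof -
  have "code_facet = code" by (simp add: fun_eq_iff code_facet_eq)
  then show ?thesis by (simp add: code_facets_def code_list_def[of ds])
qed

lemma cone_oracle_eq_1_iff:
  assumes "length q = length bs"
  shows "cone_oracle bs C i (code q) = 1 \<longleftrightarrow> rat_vec bs q \<in> (if i = 0 then C else \<Union> (cusps bs C))"
proof -
  have "(\<exists>q'. length q' = length bs \<and> code q = code_vec q' \<and> P q') \<longleftrightarrow> P q" for P
    using assms by (auto simp: code_vec_eq)
  then show ?thesis unfolding cone_oracle_def by auto
qed

lemma sum_nth_distinct:
  assumes "distinct bs"
  shows "(\<Sum>i<length bs. f (bs ! i)) = (\<Sum>b\<in>set bs. f b)"
  by (rule sum.reindex_bij_betw[OF bij_betw_nth[OF assms]]) auto

locale rational_cone =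
  fixes bs :: "'a::euclidean_space list" and C L :: "'a set"
  assumes basis: "is_basis_list bs"
    and inner_rat: "inner_rational bs"
    and open_cone: "open_cone C"
    and self_adjoint: "self_adjoint C"
    and lattice: "rational_lattice bs L"
    and perfect: "\<And>F. F facet_of voronoi_polyhedron bs C L \<Longrightarrow> \<exists>y. perfect_form bs C L F y"
begin

abbreviation "n \<equiv> length bs"

abbreviation "X \<equiv> cusp_vectors bs C L"

lemma distinct_bs: "distinct bs" and independent_bs: "independent (set bs)" and span_bs: "span (set bs) = UNIV"
  using basis by (auto simp: is_basis_list_def)

lemma inner_rat_vec: "u \<bullet> rat_vec bs q = (\<Sum>i<n. of_rat (q ! i) * (u \<bullet> bs ! i))"
  by (simp add: rat_vec_def inner_sum_right)

lemma dual_basis: "\<exists>u. \<forall>i<n. u \<bullet> bs ! i = c i"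
proof -
  obtain u where u: "\<forall>b\<in>set bs. u \<bullet> b = c (inv_into {..<n} ((!) bs) b)"
    using functional_on_independent[OF independent_bs, where f = "\<lambda>b. c (inv_into {..<n} ((!) bs) b)"] by blast
  have "u \<bullet> bs ! i = c i" if "i < n" for i
    using u that inv_into_f_f[of "(!) bs" "{..<n}" i] distinct_bs
    by (simp add: inj_on_nth)
  then show ?thesis by blast
qed

lemma rat_vec_inject:
  assumes "length p = n" "length q = n" "rat_vec bs p = rat_vec bs q"
  shows "p = q"
proof (rule nth_equalityI)
  fix j assume j: "j < length p"
  obtain u where u: "\<forall>i<n. u \<bullet> bs ! i = (if i = j then 1 else 0)"
    using dual_basis[of "\<lambda>i. if i = j then 1 else 0"] by blast
  have "u \<bullet> rat_vec bs q = of_rat (q ! j)" if "length q = n" for q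
  proof -
    have "u \<bullet> rat_vec bs q = (\<Sum>i<n. if i = j then real_of_rat (q ! i) else 0)"
      unfolding inner_rat_vec using u by (intro sum.cong) auto
    also have "\<dots> = of_rat (q ! j)" using j assms(1) by simp
    finally show ?thesis .
  qed
  then show "p ! j = q ! j" using assms by (metis of_rat_eq_iff)
qed (use assms in simp)

text \<open>Leads from real functionals to certificate rows. Only signs survive, and only signs are
  tested by \<open>separates\<close> and \<open>certifies_neighbor\<close>.\<close>

lemma rat_vec_sgn:
  assumes "finite Q" "\<And>a. a \<in> Q \<Longrightarrow> length a = n"
  shows "\<exists>w. length w = n \<and> (\<forall>a\<in>Q. sgn (real_of_rat (dot w a)) = sgn (u \<bullet> rat_vec bs a))"
  using rational_functional_with_same_signs[OF assms, of "\<lambda>i. u \<bullet> bs ! i"] by (simp add: inner_rat_vec)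

text \<open>The way back: values on the basis \<open>bs\<close> can be prescribed, so a certificate
  row acts through a vector of the space.\<close>

lemma dot_functional:
  assumes "length w = n"
  shows "\<exists>u. \<forall>q. length q = n \<longrightarrow> u \<bullet> rat_vec bs q = of_rat (dot w q)"
proof -
  obtain u where u: "\<forall>i<n. u \<bullet> bs ! i = of_rat (w ! i)" using dual_basis[of "\<lambda>i. of_rat (w ! i)"] by blast
  have "u \<bullet> rat_vec bs q = of_rat (dot w q)" if "length q = n" for q
    unfolding inner_rat_vec dot_eq_sum[OF assms that] of_rat_sum
    using u by (intro sum.cong) (auto simp: of_rat_mult)
  then show ?thesis by blast
qed

lemma C_pos: "x \<in> closure C \<Longrightarrow> x \<noteq> 0 \<Longrightarrow> y \<in> C \<Longrightarrow> 0 < x \<bullet> y"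
  using self_adjoint unfolding self_adjoint_def by blast

lemma C_scale: "x \<in> C \<Longrightarrow> 0 < t \<Longrightarrow> t *\<^sub>R x \<in> C"
  using open_cone by (simp add: open_cone_def)

lemma image_scale_eq:
  fixes T :: "'a set"
  assumes "\<And>x s. x \<in> T \<Longrightarrow> 0 < s \<Longrightarrow> s *\<^sub>R x \<in> T" "0 < t"
  shows "(*\<^sub>R) t ` T = T"
proof
  show "T \<subseteq> (*\<^sub>R) t ` T"
  proof
    fix x assume "x \<in> T"
    then have "x = t *\<^sub>R ((1 / t) *\<^sub>R x)" "(1 / t) *\<^sub>R x \<in> T" using assms by auto
    then show "x \<in> (*\<^sub>R) t ` T" by blast
  qed
qed (use assms in auto)

lemma closure_C_scale:
  assumes "x \<in> closure C" "0 < t"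
  shows "t *\<^sub>R x \<in> closure C"
  using closure_scaleR[of t C] image_scale_eq[of C t] C_scale assms by auto

lemma cusp_sub: "K \<in> cusps bs C \<Longrightarrow> K \<subseteq> closure C"
  unfolding cusps_def boundary_component_def using rel_interior_subset by blast

text \<open>Positive scaling preserves the supporting face of the closed cone and commutes with the
  relative interior.\<close>

lemma cusp_scale:
  assumes "K \<in> cusps bs C" "x \<in> K" "0 < t"
  shows "t *\<^sub>R x \<in> K"
proof -
  obtain a where K: "K = rel_interior ({x. a \<bullet> x = 0} \<inter> closure C)" (is "K = rel_interior ?T")
    using assms(1) by (auto simp: cusps_def boundary_component_def)
  have "(*\<^sub>R) t ` ?T = ?T"
    using closure_C_scale by (intro image_scale_eq[OF _ assms(3)]) auto
  then have "(*\<^sub>R) t ` K = K" using rel_interior_scaleR[of t ?T] assms(3) K by simp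
  then show ?thesis using assms(2) by blast
qed

text \<open>A lattice coordinate is the product with a vector of the dual basis \<open>U\<close>,
  hence bounded by a constant times the norm. The matrix \<open>M\<close> converts lattice
  coordinates into coordinates with respect to \<open>bs\<close>.\<close>

lemma lattice_coordinates:
  obtains M :: "rat list list" and l :: nat and \<kappa> :: real where "length M = n" "\<kappa> > 0"
    "\<And>k. length k = l \<Longrightarrow> set k \<subseteq> \<int> \<Longrightarrow> rat_vec bs (mat_vec M k) \<in> L"
    "\<And>z. z \<in> L \<Longrightarrow> \<exists>ks::int list. length ks = l \<and> rat_vec bs (mat_vec M (map rat_of_int ks)) = z \<and>
        (\<forall>k\<in>set ks. \<bar>real_of_int k\<bar> \<le> \<kappa> * norm z)"
proof -
  obtain B where B: "independent B" "L = {\<Sum>b\<in>B. of_int (k b) *\<^sub>R b | k :: 'a \<Rightarrow> int. True}"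
    and sub: "L \<subseteq> rational_points bs"
    using lattice unfolding rational_lattice_def by blast
  have fin: "finite B" using B(1) by (rule independent_imp_finite)
  then obtain Bl where Bl: "set Bl = B" "distinct Bl" using finite_distinct_list by blast
  have "b \<in> L" if "b \<in> B" for b
  proof -
    have "(\<Sum>b'\<in>B. of_int (if b' = b then 1 else 0) *\<^sub>R b') = (\<Sum>b'\<in>B. if b' = b then b else 0)"
      by (intro sum.cong) auto
    also have "\<dots> = b" using that fin by simp
    finally show ?thesis
      unfolding B(2) by (intro CollectI exI[of _ "\<lambda>b'. if b' = b then 1 else 0"]) simp
  qed
  then have "\<forall>b\<in>B. \<exists>q. length q = n \<and> rat_vec bs q = b"
    using sub unfolding rational_points_def by blast
  then obtain \<beta> where \<beta>: "\<And>b. b \<in> B \<Longrightarrow> length (\<beta> b) = n" "\<And>b. b \<in> B \<Longrightarrow> rat_vec bs (\<beta> b) = b"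
    by metis
  define M where "M = map (\<lambda>i. map (\<lambda>b. \<beta> b ! i) Bl) [0..<n]"
  define l where "l = length Bl"
  have vec: "rat_vec bs (mat_vec M k) = (\<Sum>j<l. of_rat (k ! j) *\<^sub>R Bl ! j)" if "length k = l" for k
  proof -
    have "mat_vec M k ! i = (\<Sum>j<l. \<beta> (Bl ! j) ! i * k ! j)" if "i < n" for i
      using that \<open>length k = l\<close> by (simp add: mat_vec_nth M_def l_def dot_eq_sum[of _ l])
    then have "rat_vec bs (mat_vec M k) = (\<Sum>i<n. (\<Sum>j<l. of_rat (\<beta> (Bl ! j) ! i * k ! j)) *\<^sub>R bs ! i)"
      by (simp add: rat_vec_def of_rat_sum)
    also have "\<dots> = (\<Sum>i<n. \<Sum>j<l. of_rat (k ! j) *\<^sub>R (of_rat (\<beta> (Bl ! j) ! i) *\<^sub>R bs ! i))"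
      by (simp add: scaleR_sum_left of_rat_mult mult.commute)
    also have "\<dots> = (\<Sum>j<l. of_rat (k ! j) *\<^sub>R rat_vec bs (\<beta> (Bl ! j)))"
      unfolding rat_vec_def scaleR_sum_right by (rule sum.swap)
    also have "\<dots> = (\<Sum>j<l. of_rat (k ! j) *\<^sub>R Bl ! j)"
      using \<beta>(2) Bl(1) by (intro sum.cong) (auto simp: l_def)
    finally show ?thesis .
  qed
  have "\<forall>b\<in>B. \<exists>u. \<forall>b'\<in>B. u \<bullet> b' = (if b' = b then 1 else 0)"
    by (intro ballI functional_on_independent[OF B(1)])
  then obtain U where U: "\<And>b b'. b \<in> B \<Longrightarrow> b' \<in> B \<Longrightarrow> U b \<bullet> b' = (if b' = b then 1 else 0)"
    by metis
  define \<kappa> where "\<kappa> = 1 + (\<Sum>b\<in>B. norm (U b))"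
  have U_le: "norm (U b) \<le> \<kappa>" if "b \<in> B" for b
    using member_le_sum[OF that, of "\<lambda>b. norm (U b)"] fin by (simp add: \<kappa>_def)
  show ?thesis
  proof (rule that[of M \<kappa> l])
    show "length M = n" by (simp add: M_def)
    show "\<kappa> > 0" unfolding \<kappa>_def by (intro add_pos_nonneg sum_nonneg) auto
    show "rat_vec bs (mat_vec M k) \<in> L" if k: "length k = l" "set k \<subseteq> \<int>" for k
    proof -
      \<comment> \<open>Translates a list of integral rationals into the integer-valued function on
        \<open>B\<close> by which the lattice is described.\<close>
      define f where "f b = \<lfloor>k ! inv_into {..<l} ((!) Bl) b\<rfloor>" for b
      have "real_of_int (f (Bl ! j)) = of_rat (k ! j)" if "j < l" for j
      proof -
        have "k ! j \<in> \<int>" using k that by auto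
        then have "rat_of_int \<lfloor>k ! j\<rfloor> = k ! j" by (rule of_int_floor)
        moreover have "f (Bl ! j) = \<lfloor>k ! j\<rfloor>"
          unfolding f_def using that Bl(2) by (subst inv_into_f_f) (auto simp: inj_on_nth l_def)
        ultimately show ?thesis by (metis of_rat_of_int_eq)
      qed
      then have "rat_vec bs (mat_vec M k) = (\<Sum>j<l. of_int (f (Bl ! j)) *\<^sub>R Bl ! j)"
        unfolding vec[OF k(1)] by (intro sum.cong) auto
      also have "\<dots> = (\<Sum>b\<in>B. of_int (f b) *\<^sub>R b)"
        using sum_nth_distinct[OF Bl(2), of "\<lambda>b. of_int (f b) *\<^sub>R b"] Bl(1) by (simp add: l_def)
      finally show ?thesis unfolding B(2) by blast
    qed
    show "\<exists>ks::int list. length ks = l \<and> rat_vec bs (mat_vec M (map rat_of_int ks)) = z \<and>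
        (\<forall>k\<in>set ks. \<bar>real_of_int k\<bar> \<le> \<kappa> * norm z)" if "z \<in> L" for z
    proof -
      obtain f :: "'a \<Rightarrow> int" where z: "z = (\<Sum>b\<in>B. of_int (f b) *\<^sub>R b)" using \<open>z \<in> L\<close> B(2) by blast
      have "rat_vec bs (mat_vec M (map rat_of_int (map f Bl))) = (\<Sum>j<l. of_int (f (Bl ! j)) *\<^sub>R Bl ! j)"
        by (subst vec) (auto simp: l_def)
      also have "\<dots> = z"
        using sum_nth_distinct[OF Bl(2), of "\<lambda>b. of_int (f b) *\<^sub>R b"] Bl(1) z by (simp add: l_def)
      finally have eq: "rat_vec bs (mat_vec M (map rat_of_int (map f Bl))) = z" .
      have "\<bar>real_of_int (f b)\<bar> \<le> \<kappa> * norm z" if "b \<in> B" for b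
      proof -
        have "U b \<bullet> z = (\<Sum>b'\<in>B. if b' = b then of_int (f b') else 0)"
          unfolding z inner_sum_right using U[OF that] by (intro sum.cong) auto
        then have "U b \<bullet> z = of_int (f b)" using that fin by simp
        then have "\<bar>real_of_int (f b)\<bar> \<le> norm (U b) * norm z"
          using Cauchy_Schwarz_ineq2[of "U b" z] by simp
        also have "\<dots> \<le> \<kappa> * norm z" using U_le[OF that] by (intro mult_right_mono) auto
        finally show ?thesis .
      qed
      with eq show ?thesis using Bl(1) by (intro exI[of _ "map f Bl"]) (auto simp: l_def)
    qed
  qed
qed

lemma L_scale: "z \<in> L \<Longrightarrow> real k *\<^sub>R z \<in> L"
proof -
  assume "z \<in> L"
  obtain B where L: "L = {\<Sum>b\<in>B. of_int (k b) *\<^sub>R b | k :: 'a \<Rightarrow> int. True}"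
    using lattice unfolding rational_lattice_def by blast
  obtain f :: "'a \<Rightarrow> int" where "z = (\<Sum>b\<in>B. of_int (f b) *\<^sub>R b)" using \<open>z \<in> L\<close> L by blast
  then have "real k *\<^sub>R z = (\<Sum>b\<in>B. of_int (int k * f b) *\<^sub>R b)"
    by (simp add: scaleR_sum_right)
  then show "real k *\<^sub>R z \<in> L" unfolding L by (intro CollectI exI[of _ "\<lambda>b. int k * f b"]) simp
qed

lemma finite_L: "finite {z \<in> L. norm z \<le> r}"
proof -
  obtain M :: "rat list list" and l and \<kappa> :: real where "\<kappa> > 0" and
    ks: "\<And>z. z \<in> L \<Longrightarrow> \<exists>ks::int list. length ks = l \<and> rat_vec bs (mat_vec M (map rat_of_int ks)) = z \<and>
        (\<forall>k\<in>set ks. \<bar>real_of_int k\<bar> \<le> \<kappa> * norm z)"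
    using lattice_coordinates by metis
  let ?E = "{ks. set ks \<subseteq> {- \<lceil>\<kappa> * r\<rceil>..\<lceil>\<kappa> * r\<rceil>} \<and> length ks = l}"
  have "z \<in> (\<lambda>ks. rat_vec bs (mat_vec M (map rat_of_int ks))) ` ?E" if z: "z \<in> L" "norm z \<le> r" for z
  proof -
    obtain ks where ks: "length ks = l" "rat_vec bs (mat_vec M (map rat_of_int ks)) = z"
      "\<And>k. k \<in> set ks \<Longrightarrow> \<bar>real_of_int k\<bar> \<le> \<kappa> * norm z"
      using ks[OF z(1)] by blast
    have "k \<in> {- \<lceil>\<kappa> * r\<rceil>..\<lceil>\<kappa> * r\<rceil>}" if "k \<in> set ks" for k
    proof -
      have "\<bar>real_of_int k\<bar> \<le> \<kappa> * r"
        using ks(3)[OF that] z(2) \<open>\<kappa> > 0\<close> mult_left_mono[of "norm z" r \<kappa>] by linarith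
      then have "\<bar>k\<bar> \<le> \<lceil>\<kappa> * r\<rceil>" by linarith
      then show ?thesis by auto
    qed
    then show ?thesis using ks(1,2) by blast
  qed
  then have "{z \<in> L. norm z \<le> r} \<subseteq> (\<lambda>ks. rat_vec bs (mat_vec M (map rat_of_int ks))) ` ?E" by blast
  then show ?thesis by (rule finite_subset) (intro finite_imageI finite_lists_length_eq, simp)
qed

sublocale discrete_cone C X
proof
  show "X \<subseteq> closure C - {0}" using cusp_sub by (auto simp: cusp_vectors_def)
  show "real k *\<^sub>R x \<in> X" if "x \<in> X" "0 < k" for x k
    using that L_scale cusp_scale[of _ x "real k"] by (auto simp: cusp_vectors_def)
  show "finite {x \<in> X. norm x \<le> r}" for r
    by (rule finite_subset[OF _ finite_L[of r]]) (auto simp: cusp_vectors_def)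
qed (use C_pos closure_C_scale in auto)

lemma P_eq: "P = voronoi_polyhedron bs C L"
  by (simp add: P_def voronoi_polyhedron_def)

lemma supports_iff_perfect_form:
  "perfect_form bs C L F y \<longleftrightarrow> supports F y \<and> y \<in> rational_points bs"
  unfolding perfect_form_def supports_def P_eq[symmetric] by (fastforce simp: less_le)

lemma facet_supports:
  assumes "F facet_of P"
  obtains q where "length q = n" "supports F (rat_vec bs q)"
  using perfect[of F] assms unfolding P_eq[symmetric] supports_iff_perfect_form rational_points_def by blast

lemma exists_supports: "F facet_of P \<Longrightarrow> \<exists>y. supports F y"
  using facet_supports by metis

end

section \<open>Constants of the algorithm\<close>

text \<open>\<open>candidates_complete\<close> makes discreteness effective: measuring size by the
  product with the fixed point \<open>e\<close> of the cone gives a box whose side is linear in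
  \<open>N\<close>.\<close>

locale rational_cone_data = rational_cone bs C L
  for bs :: "'a::euclidean_space list" and C L :: "'a set" +
  fixes G M :: "rat list list" and l K :: nat and e :: "rat list"
  assumes gram: "\<And>p q. length p = length bs \<Longrightarrow> length q = length bs \<Longrightarrow>
      real_of_rat (dot (mat_vec G p) q) = rat_vec bs p \<bullet> rat_vec bs q"
    and base_point: "length e = length bs" "rat_vec bs e \<in> C"
    and candidates_sound: "\<And>q r. q \<in> set (candidates M l r) \<Longrightarrow> length q = length bs \<and> rat_vec bs q \<in> L"
    and candidates_complete: "\<And>z N. z \<in> L \<Longrightarrow> z \<in> closure C \<Longrightarrow> z \<bullet> rat_vec bs e \<le> real N \<Longrightarrow>
      \<exists>q\<in>set (candidates M l (K * N)). rat_vec bs q = z"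

context rational_cone
begin

lemma gram_matrix:
  obtains G :: "rat list list" where "\<And>p q. length p = n \<Longrightarrow> length q = n \<Longrightarrow>
      real_of_rat (dot (mat_vec G p) q) = rat_vec bs p \<bullet> rat_vec bs q"
proof -
  have "\<forall>i j. i < n \<longrightarrow> j < n \<longrightarrow> (\<exists>r. real_of_rat r = bs ! i \<bullet> bs ! j)"
    using inner_rat unfolding inner_rational_def by (metis Rats_cases nth_mem)
  then obtain r where r: "\<And>i j. i < n \<Longrightarrow> j < n \<Longrightarrow> real_of_rat (r i j) = bs ! i \<bullet> bs ! j"
    by metis
  define G where "G = map (\<lambda>i. map (\<lambda>j. r i j) [0..<n]) [0..<n]"
  have "real_of_rat (dot (mat_vec G p) q) = rat_vec bs p \<bullet> rat_vec bs q"
    if p: "length p = n" and q: "length q = n" for p q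
  proof -
    have row: "mat_vec G p ! i = (\<Sum>j<n. r i j * p ! j)" if "i < n" for i
      using that p by (simp add: mat_vec_nth G_def dot_eq_sum[of _ n])
    have "real_of_rat (dot (mat_vec G p) q) = (\<Sum>i<n. real_of_rat (mat_vec G p ! i) * of_rat (q ! i))"
      using q by (simp add: dot_eq_sum[of _ n] G_def of_rat_sum of_rat_mult)
    also have "\<dots> = (\<Sum>i<n. of_rat (q ! i) * (rat_vec bs p \<bullet> bs ! i))"
    proof (intro sum.cong refl)
      fix i assume "i \<in> {..<n}"
      then have "real_of_rat (mat_vec G p ! i) = (\<Sum>j<n. of_rat (p ! j) * (bs ! i \<bullet> bs ! j))"
        using r by (simp add: row of_rat_sum of_rat_mult mult.commute)
      then have "real_of_rat (mat_vec G p ! i) = bs ! i \<bullet> rat_vec bs p" by (simp add: inner_rat_vec)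
      then show "real_of_rat (mat_vec G p ! i) * of_rat (q ! i) = of_rat (q ! i) * (rat_vec bs p \<bullet> bs ! i)"
        by (simp add: inner_commute mult.commute)
    qed
    also have "\<dots> = rat_vec bs p \<bullet> rat_vec bs q" by (simp add: inner_rat_vec)
    finally show ?thesis .
  qed
  then show ?thesis by (rule that)
qed

lemma rational_point_in_cone: "\<exists>q. length q = n \<and> rat_vec bs q \<in> C"
proof -
  obtain x \<epsilon> where x: "\<epsilon> > 0" "ball x \<epsilon> \<subseteq> C"
    using open_cone unfolding open_cone_def by (metis openE ex_in_conv)
  have "x \<in> span (set bs)" using span_bs by simp
  then obtain c where "x = (\<Sum>b\<in>set bs. c b *\<^sub>R b)" by (auto simp: span_finite)
  then have xc: "x = (\<Sum>i<n. c (bs ! i) *\<^sub>R bs ! i)"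
    using sum_nth_distinct[OF distinct_bs, of "\<lambda>b. c b *\<^sub>R b"] by simp
  define A where "A = 1 + (\<Sum>i<n. norm (bs ! i))"
  have A: "A > 0" unfolding A_def by (intro add_pos_nonneg sum_nonneg) auto
  \<comment> \<open>An error below \<open>\<epsilon> / A\<close> in each coordinate moves the point
    by less than \<open>\<epsilon>\<close>, as \<open>A\<close> exceeds the sum of the
    norms.\<close>
  then obtain q :: "nat \<Rightarrow> rat" where q: "\<And>i. i < n \<Longrightarrow> \<bar>of_rat (q i) - c (bs ! i)\<bar> < \<epsilon> / A"
    using rational_approximation_of_relations[of "\<epsilon> / A" n "\<lambda>i. c (bs ! i)"] x(1) by auto
  have "rat_vec bs (map q [0..<n]) - x = (\<Sum>i<n. (of_rat (q i) - c (bs ! i)) *\<^sub>R bs ! i)"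
    unfolding xc rat_vec_def by (simp add: sum_subtractf scaleR_diff_left)
  then have "norm (rat_vec bs (map q [0..<n]) - x) \<le> (\<Sum>i<n. norm ((of_rat (q i) - c (bs ! i)) *\<^sub>R bs ! i))"
    by (simp add: sum_norm_le)
  also have "\<dots> \<le> (\<Sum>i<n. (\<epsilon> / A) * norm (bs ! i))"
    unfolding norm_scaleR using q by (intro sum_mono mult_right_mono) (auto intro: less_imp_le)
  also have "\<dots> = (\<epsilon> / A) * (\<Sum>i<n. norm (bs ! i))" by (simp only: sum_distrib_left)
  also have "\<dots> < (\<epsilon> / A) * A" using A x(1) by (intro mult_strict_left_mono) (auto simp: A_def)
  also have "\<dots> = \<epsilon>" using A by simp
  finally have "rat_vec bs (map q [0..<n]) \<in> ball x \<epsilon>" by (simp add: dist_norm norm_minus_commute)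
  then show ?thesis using x(2) by (intro exI[of _ "map q [0..<n]"]) auto
qed

lemma data_exists: "\<exists>G M l K e. rational_cone_data bs C L G M l K e"
proof -
  obtain G :: "rat list list" where G: "\<And>p q. length p = n \<Longrightarrow> length q = n \<Longrightarrow>
      real_of_rat (dot (mat_vec G p) q) = rat_vec bs p \<bullet> rat_vec bs q"
    using gram_matrix by blast
  obtain e where e: "length e = n" "rat_vec bs e \<in> C" using rational_point_in_cone by blast
  obtain M :: "rat list list" and l and \<kappa> :: real where M: "length M = n" "\<kappa> > 0"
    "\<And>k. length k = l \<Longrightarrow> set k \<subseteq> \<int> \<Longrightarrow> rat_vec bs (mat_vec M k) \<in> L"
    "\<And>z. z \<in> L \<Longrightarrow> \<exists>ks::int list. length ks = l \<and> rat_vec bs (mat_vec M (map rat_of_int ks)) = z \<and>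
        (\<forall>k\<in>set ks. \<bar>real_of_int k\<bar> \<le> \<kappa> * norm z)"
    using lattice_coordinates by metis
  obtain K0 where K0: "K0 > 0" "\<And>x. x \<in> closure C \<Longrightarrow> norm x \<le> K0 * (x \<bullet> rat_vec bs e)"
    using norm_bound[OF e(2)] by blast
  \<comment> \<open>\<open>\<kappa>\<close> bounds coordinates by the norm, and \<open>K0\<close>
    bounds the norm by the product with \<open>e\<close>.\<close>
  obtain K where K: "\<kappa> * K0 \<le> real K" using real_arch_simple by blast
  have "length q = n \<and> rat_vec bs q \<in> L" if "q \<in> set (candidates M l r)" for q r
  proof -
    have "set (small_ints r) \<subseteq> \<int>" by (auto simp: set_small_ints)
    then show ?thesis using that M(1,3) by (fastforce simp: candidates_def set_n_lists)
  qed
  moreover have "\<exists>q\<in>set (candidates M l (K * N)). rat_vec bs q = z"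
    if z: "z \<in> L" "z \<in> closure C" "z \<bullet> rat_vec bs e \<le> real N" for z N
  proof -
    obtain ks where ks: "length ks = l" "rat_vec bs (mat_vec M (map rat_of_int ks)) = z"
      "\<And>k. k \<in> set ks \<Longrightarrow> \<bar>real_of_int k\<bar> \<le> \<kappa> * norm z"
      using M(4)[OF z(1)] by blast
    have "\<kappa> * norm z \<le> real (K * N)"
    proof -
      have "\<kappa> * norm z \<le> \<kappa> * (K0 * (z \<bullet> rat_vec bs e))"
        using K0(2)[OF z(2)] M(2) by (intro mult_left_mono) auto
      also have "\<dots> \<le> (\<kappa> * K0) * real N" using z(3) M(2) K0(1) by simp
      also have "\<dots> \<le> real K * real N" using K by (intro mult_right_mono) auto
      finally show ?thesis by simp
    qed
    then have "\<bar>k\<bar> \<le> int (K * N)" if "k \<in> set ks" for k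
      using ks(3)[OF that] by linarith
    then have "set (map rat_of_int ks) \<subseteq> set (small_ints (K * N))"
      unfolding set_small_ints set_map by (intro image_mono) (force simp: abs_le_iff)
    then show ?thesis using ks(1,2)
      by (intro bexI[of _ "mat_vec M (map rat_of_int ks)"]) (auto simp: candidates_def set_n_lists)
  qed
  ultimately have "rational_cone_data bs C L G M l K e"
    using G e by unfold_locales auto
  then show ?thesis by blast
qed

end

section \<open>Certificates for perfect forms\<close>

context rational_cone_data
begin

abbreviation "orc \<equiv> cone_oracle bs C"

abbreviation "certified_perfect \<equiv> certifies_perfect orc n G M l K e"

lemma cusp_query_candidate:
  assumes "q \<in> set (candidates M l r)"
  shows "cusp_query orc q \<longleftrightarrow> rat_vec bs q \<in> X"
proof -
  have q: "length q = n" "rat_vec bs q \<in> L" using candidates_sound[OF assms] by auto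
  have "(\<exists>a\<in>set q. a \<noteq> 0) \<longleftrightarrow> rat_vec bs q \<noteq> 0"
  proof -
    have zero: "rat_vec bs (replicate n 0) = 0" by (simp add: rat_vec_def)
    have "rat_vec bs q = 0 \<longleftrightarrow> q = replicate n 0"
      using rat_vec_inject[of q "replicate n 0"] q(1) zero by auto
    also have "\<dots> \<longleftrightarrow> (\<forall>a\<in>set q. a = 0)" using q(1) by (metis replicate_eqI in_set_replicate)
    finally show ?thesis by blast
  qed
  then show ?thesis
    unfolding cusp_query_def using cone_oracle_eq_1_iff[OF q(1), of C 1] q(2)
    by (auto simp: cusp_vectors_def)
qed

lemma rat_vec_scaled_difference:
  assumes "length p = n"
  shows "rat_vec bs (map (\<lambda>p. of_nat N * fst p - snd p) (zip p e)) = real N *\<^sub>R rat_vec bs p - rat_vec bs e"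
  using assms base_point(1)
  by (simp add: rat_vec_def scaleR_sum_right sum_subtractf[symmetric] of_rat_diff of_rat_mult scaleR_diff_left)

lemma candidate_of_small:
  assumes "length p = n" "orc 0 (code (map (\<lambda>p. of_nat N * fst p - snd p) (zip p e))) = 1"
    and z: "z \<in> X" "z \<bullet> rat_vec bs p \<le> 1"
  shows "\<exists>q\<in>set (candidates M l (K * N)). rat_vec bs q = z"
proof (rule candidates_complete)
  show "z \<in> L" "z \<in> closure C" using z(1) X_sub by (auto simp: cusp_vectors_def)
  have "real N *\<^sub>R rat_vec bs p - rat_vec bs e \<in> C"
    using assms(1,2) base_point(1) cone_oracle_eq_1_iff[of "map (\<lambda>p. of_nat N * fst p - snd p) (zip p e)" bs C 0]
    by (simp add: rat_vec_scaled_difference)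
  then have "0 < z \<bullet> (real N *\<^sub>R rat_vec bs p - rat_vec bs e)" using z(1) X_sub C_pos by auto
  then have "z \<bullet> rat_vec bs e \<le> real N * (z \<bullet> rat_vec bs p)" by (simp add: inner_diff_right)
  also have "\<dots> \<le> real N * 1" using z(2) by (intro mult_left_mono) auto
  finally show "z \<bullet> rat_vec bs e \<le> real N" by simp
qed

lemma gram_le_iff:
  assumes "length p = n" "length q = n"
  shows "1 \<le> dot (mat_vec G p) q \<longleftrightarrow> 1 \<le> rat_vec bs q \<bullet> rat_vec bs p"
    and "dot (mat_vec G p) q = 1 \<longleftrightarrow> rat_vec bs q \<bullet> rat_vec bs p = 1"
proof -
  have eq: "rat_vec bs q \<bullet> rat_vec bs p = of_rat (dot (mat_vec G p) q)"
    using gram[OF assms] by (simp add: inner_commute)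
  show "1 \<le> dot (mat_vec G p) q \<longleftrightarrow> 1 \<le> rat_vec bs q \<bullet> rat_vec bs p"
    unfolding eq by simp
  show "dot (mat_vec G p) q = 1 \<longleftrightarrow> rat_vec bs q \<bullet> rat_vec bs p = 1"
    unfolding eq by simp
qed

lemma certified_perfect_sound:
  assumes "certified_perfect N d"
  shows "length (fst d) = n" "\<forall>q\<in>set (snd d). length q = n" "rat_vec bs (fst d) \<in> C"
    "\<And>z. z \<in> X \<Longrightarrow> 1 \<le> z \<bullet> rat_vec bs (fst d)"
    "rat_vec bs ` set (snd d) = {z \<in> X. z \<bullet> rat_vec bs (fst d) = 1}"
proof -
  let ?y = "rat_vec bs (fst d)"
  note d = assms[unfolded certifies_perfect_def]
  show len: "length (fst d) = n" "\<forall>q\<in>set (snd d). length q = n" using d by auto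
  show "?y \<in> C" using d cone_oracle_eq_1_iff[OF len(1), of C 0] by simp
  have small: "\<exists>q\<in>set (candidates M l (K * N)). length q = n \<and> cusp_query orc q \<and> rat_vec bs q = z"
    if z: "z \<in> X" "z \<bullet> ?y \<le> 1" for z
  proof -
    obtain q where "q \<in> set (candidates M l (K * N))" "rat_vec bs q = z"
      using candidate_of_small[OF len(1) _ z] d by blast
    then show ?thesis using z(1) cusp_query_candidate candidates_sound by blast
  qed
  show ge: "1 \<le> z \<bullet> ?y" if "z \<in> X" for z
  proof (rule ccontr)
    assume "\<not> ?thesis"
    then obtain q where "q \<in> set (candidates M l (K * N))" "length q = n" "cusp_query orc q" "rat_vec bs q = z"
      using small[OF \<open>z \<in> X\<close>] by force
    then have "1 \<le> z \<bullet> ?y" using d gram_le_iff(1)[OF len(1)] by blast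
    with \<open>\<not> 1 \<le> z \<bullet> ?y\<close> show False by simp
  qed
  show "rat_vec bs ` set (snd d) = {z \<in> X. z \<bullet> ?y = 1}"
  proof
    show "rat_vec bs ` set (snd d) \<subseteq> {z \<in> X. z \<bullet> ?y = 1}"
      using d gram_le_iff(2)[OF len(1)] cusp_query_candidate len(2) by blast
    show "{z \<in> X. z \<bullet> ?y = 1} \<subseteq> rat_vec bs ` set (snd d)"
    proof
      fix z assume z: "z \<in> {z \<in> X. z \<bullet> ?y = 1}"
      then obtain q where q: "q \<in> set (candidates M l (K * N))" "length q = n" "cusp_query orc q" "rat_vec bs q = z"
        using small[of z] by auto
      then have "dot (mat_vec G (fst d)) q = 1" using z gram_le_iff(2)[OF len(1)] by blast
      then show "z \<in> rat_vec bs ` set (snd d)" using d q by blast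
    qed
  qed
qed

lemma certified_perfect_complete:
  assumes "length p = n" "supports F (rat_vec bs p)"
  shows "\<exists>Z N. certified_perfect N (p, Z)"
proof -
  let ?y = "rat_vec bs p"
  have y: "?y \<in> C" "\<And>z. z \<in> X \<Longrightarrow> 1 \<le> z \<bullet> ?y"
    using assms(2) X_sub_P by (auto simp: supports_def)
  obtain \<epsilon> where \<epsilon>: "\<epsilon> > 0" "ball ?y \<epsilon> \<subseteq> C"
    using y(1) open_cone unfolding open_cone_def by (meson openE)
  \<comment> \<open>Then \<open>e / N\<close> is shorter than \<open>\<epsilon>\<close>, so
    \<open>y - e / N\<close> stays in the open cone; multiplying by \<open>N\<close> gives the point
    that oracle 0 must accept.\<close>
  obtain N where N: "norm (rat_vec bs e) / \<epsilon> < real N" using reals_Archimedean2 by blast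
  have "0 \<le> norm (rat_vec bs e) / \<epsilon>" using \<epsilon>(1) by simp
  with N have "real N > 0" by linarith
  have "norm ((1 / real N) *\<^sub>R rat_vec bs e) < \<epsilon>"
    using N \<epsilon>(1) \<open>real N > 0\<close> by (simp add: field_simps)
  then have "?y - (1 / real N) *\<^sub>R rat_vec bs e \<in> C" using \<epsilon>(2) by (auto simp: dist_norm)
  then have "real N *\<^sub>R (?y - (1 / real N) *\<^sub>R rat_vec bs e) \<in> C"
    using \<open>real N > 0\<close> by (rule C_scale)
  then have "real N *\<^sub>R ?y - rat_vec bs e \<in> C" using \<open>real N > 0\<close> by (simp add: scaleR_diff_right)
  then have orc0: "orc 0 (code (map (\<lambda>p. of_nat N * fst p - snd p) (zip p e))) = 1"
    using assms(1) base_point(1) cone_oracle_eq_1_iff[of "map (\<lambda>p. of_nat N * fst p - snd p) (zip p e)" bs C 0]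
    by (simp add: rat_vec_scaled_difference)
  define Z where "Z = filter (\<lambda>q. rat_vec bs q \<in> X \<and> rat_vec bs q \<bullet> ?y = 1) (candidates M l (K * N))"
  have "certified_perfect N (p, Z)"
    unfolding certifies_perfect_def fst_conv snd_conv
  proof (intro conjI ballI impI)
    show "orc 0 (code p) = 1" using y(1) cone_oracle_eq_1_iff[OF assms(1), of C 0] by simp
  qed (use assms(1) orc0 y(2) candidates_sound cusp_query_candidate gram_le_iff[OF assms(1)] in
      \<open>auto simp: Z_def\<close>)
  then show ?thesis by blast
qed

end

section \<open>The search for neighbors\<close>

context rational_cone_data
begin

abbreviation "certified_neighbor \<equiv> certifies_neighbor n (dim X)"

abbreviation "checked \<equiv> check orc n G M l K e (dim X)"

lemma represents_facetD:
  assumes "represents_facet bs C L d F"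
  shows "F facet_of P" "length (fst d) = n" "\<And>q. q \<in> set (snd d) \<Longrightarrow> length q = n"
    "supports F (rat_vec bs (fst d))"
    "rat_vec bs ` set (snd d) = {z \<in> X. z \<bullet> rat_vec bs (fst d) = 1}"
  using assms
  by (auto simp: represents_facet_def P_eq supports_iff_perfect_form minimal_vectors_def)

lemma represents_facetI:
  assumes "certified_perfect N d" "{x \<in> P. x \<bullet> rat_vec bs (fst d) = 1} facet_of P"
  shows "represents_facet bs C L d {x \<in> P. x \<bullet> rat_vec bs (fst d) = 1}"
proof -
  let ?y = "rat_vec bs (fst d)"
  note d = certified_perfect_sound[OF assms(1)]
  have "supports {x \<in> P. x \<bullet> ?y = 1} ?y"
    using d(3) P_ge[OF d(4)] by (auto simp: supports_def)
  moreover have "?y \<in> rational_points bs" using d(1) by (auto simp: rational_points_def)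
  ultimately show ?thesis
    using d assms(2) face_eq_convex_hull[OF d(3,4)]
    by (auto simp: represents_facet_def supports_iff_perfect_form minimal_vectors_def P_eq)
qed

text \<open>The row belonging to \<open>s\<close> kills the rest of \<open>S\<close> but not
  \<open>s\<close>, so \<open>s\<close> is not in the span of the rest.\<close>

lemma independent_of_certificate:
  assumes len: "\<And>s. s \<in> set S \<Longrightarrow> length s = n" and "distinct S"
    and ws: "\<And>s. s \<in> set S \<Longrightarrow> \<exists>w\<in>set ws. length w = n \<and> dot w s \<noteq> 0 \<and> (\<forall>t\<in>set S. t \<noteq> s \<longrightarrow> dot w t = 0)"
  shows "independent (rat_vec bs ` set S)" "card (rat_vec bs ` set S) = length S"
proof -
  show "independent (rat_vec bs ` set S)"
    unfolding dependent_def
  proof safe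
    fix s assume s: "s \<in> set S" "rat_vec bs s \<in> span (rat_vec bs ` set S - {rat_vec bs s})"
    obtain w where w: "length w = n" "dot w s \<noteq> 0" "\<And>t. t \<in> set S \<Longrightarrow> t \<noteq> s \<Longrightarrow> dot w t = 0"
      using ws[OF s(1)] by blast
    obtain u where u: "\<And>q. length q = n \<Longrightarrow> u \<bullet> rat_vec bs q = of_rat (dot w q)"
      using dot_functional[OF w(1)] by blast
    have "u \<bullet> rat_vec bs s = 0"
    proof (rule inner_span_zero[OF s(2)])
      fix b assume "b \<in> rat_vec bs ` set S - {rat_vec bs s}"
      then obtain t where "t \<in> set S" "t \<noteq> s" "b = rat_vec bs t" by blast
      then show "u \<bullet> b = 0" using u[OF len] w(3) by simp
    qed
    then show False using u[OF len[OF s(1)]] w(2) by simp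
  qed
  have "inj_on (rat_vec bs) (set S)" using len rat_vec_inject by (auto intro: inj_onI)
  then show "card (rat_vec bs ` set S) = length S"
    using \<open>distinct S\<close> by (simp add: card_image distinct_card)
qed

lemma certified_neighbor_sound:
  assumes d: "represents_facet bs C L d F"
    and d': "certified_perfect N d'" and nb: "certified_neighbor d d' S ws"
  shows "\<exists>F'. neighbor P F F' \<and> represents_facet bs C L d' F'"
proof -
  let ?y = "rat_vec bs (fst d)" and ?y' = "rat_vec bs (fst d')"
  note D = represents_facetD[OF d] and D' = certified_perfect_sound[OF d']
  note S = nb[unfolded certifies_neighbor_def]
  let ?B = "rat_vec bs ` set S"
  have ind: "independent ?B" "card ?B = length S"
    using independent_of_certificate[of S ws] S D(3) by auto
  have B: "?B \<subseteq> {z \<in> X. z \<bullet> ?y = 1}" "?B \<subseteq> {z \<in> X. z \<bullet> ?y' = 1}"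
    using S unfolding D(5)[symmetric] D'(5)[symmetric] by auto
  obtain q where q: "q \<in> set (snd d')" "q \<notin> set (snd d)" using S by blast
  then have z: "rat_vec bs q \<in> X" "rat_vec bs q \<bullet> ?y' = 1" using D'(5) by auto
  have "rat_vec bs q \<notin> rat_vec bs ` set (snd d)"
    using q D(3) D'(2) rat_vec_inject by blast
  then have "rat_vec bs q \<bullet> ?y \<noteq> 1" using z(1) unfolding D(5) by blast
  then have "neighbor P F {x \<in> P. x \<bullet> ?y' = 1}"
    using B z S ind(2)
    by (intro neighborI[OF D(1,4) D'(4) ind(1), where z = "rat_vec bs q"]) auto
  then show ?thesis
    using represents_facetI[OF d'] by (auto simp: neighbor_def)
qed

lemma checked_sound:
  assumes d: "represents_facet bs C L d F" and w: "checked d w"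
  shows "\<And>d'. d' \<in> set (fst w) \<Longrightarrow> \<exists>F'. neighbor P F F' \<and> represents_facet bs C L d' F'"
    and "\<And>F'. neighbor P F F' \<Longrightarrow> \<exists>d'\<in>set (fst w). represents_facet bs C L d' F'"
proof -
  let ?y = "rat_vec bs (fst d)"
  note D = represents_facetD[OF d] and W = w[unfolded check_def]
  show sound: "\<exists>F'. neighbor P F F' \<and> represents_facet bs C L d' F'" if "d' \<in> set (fst w)" for d'
    using certified_neighbor_sound[OF d] W that by blast
  fix F' assume nb: "neighbor P F F'"
  then have "F' facet_of P" by (simp add: neighbor_def)
  then obtain q' where F': "supports F' (rat_vec bs q')" using facet_supports by blast
  have "P \<noteq> {}" using D(1) by (auto simp: facet_of_def face_of_def)
  then have "X \<noteq> {}" by (auto simp: P_def)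
  obtain B where B: "B \<subseteq> {z \<in> X. z \<bullet> ?y = 1}" "independent B" "card B + 1 = dim X"
    "\<And>b. b \<in> B \<Longrightarrow> b \<bullet> rat_vec bs q' = 1"
    using neighbor_basis[OF D(4) F' nb \<open>X \<noteq> {}\<close>] by blast
  have B': "B \<subseteq> X" "\<And>b. b \<in> B \<Longrightarrow> b \<bullet> ?y = 1" using B(1) by auto
  have "\<forall>b\<in>B. \<exists>s\<in>set (snd d). rat_vec bs s = b" using B(1) unfolding D(5)[symmetric] by blast
  then obtain c where c: "\<And>b. b \<in> B \<Longrightarrow> c b \<in> set (snd d)" "\<And>b. b \<in> B \<Longrightarrow> rat_vec bs (c b) = b"
    by metis
  obtain Bl where Bl: "set Bl = B" "distinct Bl"
    using finite_distinct_list independent_imp_finite[OF B(2)] by blast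
  \<comment> \<open>Any ordering of the basis \<open>B\<close> is among the tuples examined by
    \<open>check\<close>.\<close>
  let ?S = "map c Bl"
  have "length ?S = dim X - 1" using B(3) distinct_card[OF Bl(2)] Bl(1) by simp
  then have "?S \<in> set (List.n_lists (dim X - 1) (snd d))" using c(1) Bl(1) by (auto simp: set_n_lists)
  then consider u where "u \<in> set (snd (snd w))" "separates n (snd d) ?S u"
    | d' where "d' \<in> set (fst w)" "\<forall>s\<in>set ?S. s \<in> set (snd d')"
    using W by blast
  then show "\<exists>d'\<in>set (fst w). represents_facet bs C L d' F'"
  proof cases
    case 1
    then obtain z1 z2 where u: "length u = n" "\<forall>s\<in>set ?S. dot u s = 0"
      "z1 \<in> set (snd d)" "dot u z1 > 0" "z2 \<in> set (snd d)" "dot u z2 < 0"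
      unfolding separates_def by blast
    obtain v where v: "\<And>q. length q = n \<Longrightarrow> v \<bullet> rat_vec bs q = of_rat (dot u q)"
      using dot_functional[OF u(1)] by blast
    have "v \<bullet> b = 0" if "b \<in> B" for b
      using v[OF D(3)[OF c(1)[OF that]]] c(2)[OF that] u(2) that Bl(1) by simp
    moreover have "rat_vec bs z1 \<in> {z \<in> X. z \<bullet> ?y = 1}" "rat_vec bs z2 \<in> {z \<in> X. z \<bullet> ?y = 1}"
      using u(3,5) unfolding D(5)[symmetric] by auto
    moreover have "v \<bullet> rat_vec bs z1 > 0" "v \<bullet> rat_vec bs z2 < 0"
      using u(3-6) v D(3) by simp_all
    ultimately have False
      using no_sign_change_across_neighbor[OF D(4) F' nb D(1) B(2) B'(1) B(3) B'(2) B(4)] by blast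
    then show ?thesis ..
  next
    case 2
    obtain F'' where F'': "neighbor P F F''" "represents_facet bs C L d' F''" using sound[OF 2(1)] by blast
    note D'' = represents_facetD[OF F''(2)]
    have "b \<bullet> rat_vec bs (fst d') = 1" if "b \<in> B" for b
    proof -
      have "rat_vec bs (c b) \<in> rat_vec bs ` set (snd d')" using 2(2) that Bl(1) by auto
      then show ?thesis unfolding D''(5) using c(2)[OF that] by simp
    qed
    then have "F' = F''"
      using neighbor_unique[OF D(4,1) F' nb D''(4) F''(1) B(2) B'(1) B(3) B'(2) B(4)] by blast
    with F''(2) 2(1) show ?thesis by blast
  qed
qed

lemma certificate_for_tuple:
  assumes d: "represents_facet bs C L d F" and dimX: "2 \<le> dim X"
    and S: "length S = dim X - 1" "set S \<subseteq> set (snd d)"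
  shows "(\<exists>u. separates n (snd d) S u) \<or>
    (\<exists>d' c. certified_perfect (snd (snd c)) d' \<and> certified_neighbor d d' (fst c) (fst (snd c)) \<and>
       (\<forall>s\<in>set S. s \<in> set (snd d')))"
proof -
  let ?y = "rat_vec bs (fst d)" and ?B = "rat_vec bs ` set S"
  note D = represents_facetD[OF d]
  have lenS: "length s = n" if "s \<in> set S" for s using that S(2) D(3) by blast
  have B: "finite ?B" "?B \<subseteq> {z \<in> X. z \<bullet> ?y = 1}"
    using S(2) unfolding D(5)[symmetric] by auto
  have "card ?B \<le> length S" using card_image_le card_length order_trans by blast
  then have card: "card ?B + 1 \<le> dim X" using S(1) dimX by linarith
  show ?thesis
  proof (rule sign_change_or_neighbor[OF exists_supports D(4,1) dimX B card], goal_cases)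
    case (1 F)
    then show ?case .
  next
    case (2 u)
    obtain w where w: "length w = n"
      "\<And>q. q \<in> set (snd d) \<Longrightarrow> sgn (real_of_rat (dot w q)) = sgn (u \<bullet> rat_vec bs q)"
      using rat_vec_sgn[of "set (snd d)" u] D(3) by blast
    have sgn: "dot w q = 0 \<longleftrightarrow> u \<bullet> rat_vec bs q = 0" "0 < dot w q \<longleftrightarrow> 0 < u \<bullet> rat_vec bs q"
      "dot w q < 0 \<longleftrightarrow> u \<bullet> rat_vec bs q < 0" if "q \<in> set (snd d)" for q
    proof -
      show "dot w q = 0 \<longleftrightarrow> u \<bullet> rat_vec bs q = 0"
        using w(2)[OF that] by (metis of_rat_eq_0_iff sgn_eq_0_iff)
      show "0 < dot w q \<longleftrightarrow> 0 < u \<bullet> rat_vec bs q"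
        using w(2)[OF that] by (metis zero_less_of_rat_iff sgn_greater)
      show "dot w q < 0 \<longleftrightarrow> u \<bullet> rat_vec bs q < 0"
        using w(2)[OF that] by (metis of_rat_less_0_iff sgn_less)
    qed
    have "\<exists>q\<in>set (snd d). 0 < dot w q" "\<exists>q\<in>set (snd d). dot w q < 0"
    proof -
      obtain z where "z \<in> rat_vec bs ` set (snd d)" "0 < u \<bullet> z" using 2(2) unfolding D(5) by blast
      then show "\<exists>q\<in>set (snd d). 0 < dot w q" using sgn(2) by blast
      obtain z where "z \<in> rat_vec bs ` set (snd d)" "u \<bullet> z < 0" using 2(3) unfolding D(5) by blast
      then show "\<exists>q\<in>set (snd d). dot w q < 0" using sgn(3) by blast
    qed
    moreover have "\<forall>s\<in>set S. dot w s = 0" using 2(1) sgn(1) S(2) by blast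
    ultimately show ?thesis using w(1) unfolding separates_def by blast
  next
    case (3 F' y')
    have "F' facet_of P" using 3(1) by (simp add: neighbor_def)
    \<comment> \<open>The form \<open>y'\<close> may be irrational, so a rational form of the same
      facet replaces it; the minimal vectors depend on the facet alone.\<close>
    then obtain q' where q': "length q' = n" "supports F' (rat_vec bs q')" using facet_supports by blast
    obtain Z N where Z: "certified_perfect N (q', Z)" using certified_perfect_complete[OF q'] by blast
    note D' = certified_perfect_sound[OF Z, unfolded fst_conv snd_conv]
    have F'_iff: "z \<in> F' \<longleftrightarrow> z \<in> rat_vec bs ` set Z" if "z \<in> X" for z
      using that q'(2) X_sub_P unfolding D'(5) by (auto simp: supports_def)
    have S_Z: "s \<in> set Z" if "s \<in> set S" for s
    proof -
      have "rat_vec bs s \<in> X" "rat_vec bs s \<in> F'" using that B(2) 3(3) by auto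
      then obtain q where "q \<in> set Z" "rat_vec bs q = rat_vec bs s" using F'_iff by force
      then show ?thesis using rat_vec_inject[of q s] D'(2) lenS[OF that] by auto
    qed
    have "card ?B = length S" using 3(5) S(1) by linarith
    moreover have "card ?B \<le> card (set S)" by (rule card_image_le) simp
    \<comment> \<open>The image has as many elements as \<open>S\<close> has entries, so no entry is
      repeated.\<close>
    ultimately have dist: "distinct S" using card_distinct[of S] card_length[of S] by linarith
    have "\<forall>s\<in>set S. \<exists>w. length w = n \<and> dot w s \<noteq> 0 \<and> (\<forall>t\<in>set S. t \<noteq> s \<longrightarrow> dot w t = 0)"
    proof
      fix s assume s: "s \<in> set S"
      obtain u where u: "\<forall>b\<in>?B. u \<bullet> b = (if b = rat_vec bs s then 1 else 0)"
        using functional_on_independent[OF 3(4), where f = "\<lambda>b. if b = rat_vec bs s then 1 else 0"] by blast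
      obtain w where w: "length w = n"
        "\<And>q. q \<in> set S \<Longrightarrow> sgn (real_of_rat (dot w q)) = sgn (u \<bullet> rat_vec bs q)"
        using rat_vec_sgn[of "set S" u] lenS by blast
      have "u \<bullet> rat_vec bs t = 0" if "t \<in> set S" "t \<noteq> s" for t
        using u that rat_vec_inject[of t s] lenS s by auto
      then have "dot w t = 0" if "t \<in> set S" "t \<noteq> s" for t
        using w(2)[OF that(1)] that by (metis of_rat_eq_0_iff sgn_eq_0_iff)
      moreover have "dot w s \<noteq> 0" using w(2)[OF s] u s by auto
      ultimately show "\<exists>w. length w = n \<and> dot w s \<noteq> 0 \<and> (\<forall>t\<in>set S. t \<noteq> s \<longrightarrow> dot w t = 0)"
        using w(1) by blast
    qed
    then obtain W where W: "\<And>s. s \<in> set S \<Longrightarrow> length (W s) = n \<and> dot (W s) s \<noteq> 0 \<and>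
        (\<forall>t\<in>set S. t \<noteq> s \<longrightarrow> dot (W s) t = 0)"
      by metis
    obtain z where z: "z \<in> X" "z \<in> F'" "z \<bullet> ?y \<noteq> 1" using 3(6) by blast
    then obtain q where "q \<in> set Z" "rat_vec bs q = z" using F'_iff by blast
    moreover from this have "q \<notin> set (snd d)" using z(3) D(5) by blast
    moreover have "\<forall>s\<in>set S. \<exists>w\<in>set (map W S). length w = n \<and> dot w s \<noteq> 0 \<and>
        (\<forall>t\<in>set S. t \<noteq> s \<longrightarrow> dot w t = 0)"
      using W by (intro ballI bexI[of _ "W s" for s]) auto
    ultimately have "certified_neighbor d (q', Z) S (map W S)"
      using dist S dimX S_Z unfolding certifies_neighbor_def by auto
    with Z S_Z show ?thesis
      by (intro disjI2 exI[of _ "(q', Z)"] exI[of _ "(S, map W S, N)"]) simp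
  qed
qed

text \<open>Merges the outcomes for finitely many tuples into the lists of one certificate.\<close>

lemma collect_witnesses:
  assumes "\<And>S. S \<in> set Ss \<Longrightarrow> (\<exists>u. A S u) \<or> (\<exists>d c. B d c \<and> E S d)"
  shows "\<exists>us ds cs. (\<forall>d\<in>set ds. \<exists>c\<in>set cs. B d c) \<and>
    (\<forall>S\<in>set Ss. (\<exists>u\<in>set us. A S u) \<or> (\<exists>d\<in>set ds. E S d))"
  using assms
proof (induction Ss)
  case Nil
  show ?case by (intro exI[of _ "[]"]) simp
next
  case (Cons S Ss)
  then obtain us ds cs where IH: "\<forall>d\<in>set ds. \<exists>c\<in>set cs. B d c"
    "\<forall>S\<in>set Ss. (\<exists>u\<in>set us. A S u) \<or> (\<exists>d\<in>set ds. E S d)"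
    by auto
  consider u where "A S u" | d c where "B d c" "E S d" using Cons.prems[of S] by auto
  then show ?case
  proof cases
    case 1
    with IH show ?thesis by (intro exI[of _ "u # us"] exI[of _ ds] exI[of _ cs]) auto
  next
    case 2
    with IH show ?thesis by (intro exI[of _ us] exI[of _ "d # ds"] exI[of _ "c # cs"]) auto
  qed
qed

lemma checked_complete:
  assumes "represents_facet bs C L d F" "2 \<le> dim X"
  shows "\<exists>w. checked d w"
proof -
  have "\<exists>us ds cs. (\<forall>d'\<in>set ds. \<exists>c\<in>set cs. certified_perfect (snd (snd c)) d' \<and>
      certified_neighbor d d' (fst c) (fst (snd c))) \<and>
    (\<forall>S\<in>set (List.n_lists (dim X - 1) (snd d)). (\<exists>u\<in>set us. separates n (snd d) S u) \<or>
      (\<exists>d'\<in>set ds. \<forall>s\<in>set S. s \<in> set (snd d')))"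
    by (rule collect_witnesses) (use certificate_for_tuple[OF assms] in \<open>auto simp: set_n_lists\<close>)
  then obtain us ds cs where "checked d (ds, cs, us)" unfolding check_def by auto
  then show ?thesis by blast
qed

lemma neighbors_computable:
  "\<exists>p. \<forall>F d. represents_facet bs C L d F \<longrightarrow>
     (\<exists>ds. evaluates orc p [code_facet d] (code_facets ds) \<and>
       (\<forall>d'\<in>set ds. \<exists>F'. neighbor P F F' \<and> represents_facet bs C L d' F') \<and>
       (\<forall>F'. neighbor P F F' \<longrightarrow> (\<exists>d'\<in>set ds. represents_facet bs C L d' F')))"
proof (cases "2 \<le> dim X")
  case True
  obtain r :: "nat \<Rightarrow> rat" where r: "enumerates orc r" using enumerates_rat by blast
  obtain v :: "nat \<Rightarrow> rat list" where v: "enumerates orc v" using enumerates_list[OF r] by blast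
  obtain vs :: "nat \<Rightarrow> rat list list" where vs: "enumerates orc vs" using enumerates_list[OF v] by blast
  obtain ds :: "nat \<Rightarrow> facet_data list" where ds: "enumerates orc ds"
    using enumerates_list[OF enumerates_prod[OF v vs]] by blast
  obtain cs :: "nat \<Rightarrow> (rat list list \<times> rat list list \<times> nat) list" where cs: "enumerates orc cs"
    using enumerates_list[OF enumerates_prod[OF vs enumerates_prod[OF vs enumerates_nat]]] by blast
  obtain w :: "nat \<Rightarrow> certificate" where w: "computable orc w" "surj w"
    using enumerates_prod[OF ds enumerates_prod[OF cs vs]] unfolding enumerates_def by blast
  have wsnd: "computable orc (\<lambda>p :: facet_data \<times> nat. w (snd p))"
    by (rule computable_comp[OF w(1)]) (intro computable)
  have "computable orc (\<lambda>p. (fst p, w (snd p)) :: facet_data \<times> certificate)"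
    by (intro computable_Pair wsnd computable)
  from computable_comp[OF computable_check this]
  have "computable orc (\<lambda>p. checked (fst p) (w (snd p)))" by simp
  moreover have "computable orc (\<lambda>p :: facet_data \<times> nat. fst (w (snd p)))"
    by (rule computable_fst[OF wsnd])
  ultimately obtain p where p: "\<And>d. \<exists>k. checked d (w k) \<Longrightarrow>
      evaluates orc p [code d] (code (fst (w (LEAST k. checked d (w k)))))"
    using computable_Least[of orc "\<lambda>d k. checked d (w k)" "\<lambda>p. fst (w (snd p))"] by auto
  show ?thesis
  proof (intro exI[of _ p] allI impI)
    fix F d assume d: "represents_facet bs C L d F"
    then have ex: "\<exists>k. checked d (w k)" using checked_complete[OF d True] w(2) by (metis surjD)
    then have "checked d (w (LEAST k. checked d (w k)))" by (rule LeastI_ex)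
    from p[OF ex] checked_sound[OF d this]
    show "\<exists>ds. evaluates orc p [code_facet d] (code_facets ds) \<and>
       (\<forall>d'\<in>set ds. \<exists>F'. neighbor P F F' \<and> represents_facet bs C L d' F') \<and>
       (\<forall>F'. neighbor P F F' \<longrightarrow> (\<exists>d'\<in>set ds. represents_facet bs C L d' F'))"
      unfolding code_facet_eq code_facets_eq by blast
  qed
next
  case False
  have "\<not> neighbor P F F'" if "represents_facet bs C L d F" for d F F'
  proof
    assume nb: "neighbor P F F'"
    then obtain q where "supports F' (rat_vec bs q)" using facet_supports by (auto simp: neighbor_def)
    with nb show False
      using no_neighbors_of_dim_le_1[of F _ F'] represents_facetD[OF that] False by force
  qed
  \<comment> \<open>The empty list has code 0, so the constant program suffices when no neighbors
    exist.\<close>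
  moreover have "evaluates orc Zero [code_facet d] (code_facets [])" for d
    using evaluates.zero by (simp add: code_facets_def)
  ultimately show ?thesis by (intro exI[of _ Zero] allI impI exI[of _ "[]"]) auto
qed

end

theorem theorem4p5:
  fixes bs :: "'a::euclidean_space list" and C L :: "'a set"
  assumes "is_basis_list bs"
    and "inner_rational bs"
    and "open_cone C"
    and "self_adjoint C"
    and "homogeneous C"
    and "aut_defined_over_rat bs C"
    and "rational_lattice bs L"
    and "\<And>F. F facet_of voronoi_polyhedron bs C L \<Longrightarrow> \<exists>y. perfect_form bs C L F y"
  shows "\<exists>p. \<forall>F d. represents_facet bs C L d F \<longrightarrow>
           (\<exists>ds. evaluates (cone_oracle bs C) p [code_facet d] (code_facets ds) \<and>
                 (\<forall>d'\<in>set ds. \<exists>F'. neighbor (voronoi_polyhedron bs C L) F F' \<and>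
                                  represents_facet bs C L d' F') \<and>
                 (\<forall>F'. neighbor (voronoi_polyhedron bs C L) F F' \<longrightarrow>
                       (\<exists>d'\<in>set ds. represents_facet bs C L d' F')))"
proof -
  interpret rational_cone bs C L by standard (fact assms)+
  obtain G M l K e where "rational_cone_data bs C L G M l K e" using data_exists by blast
  then interpret rational_cone_data bs C L G M l K e .
  show ?thesis using neighbors_computable by (simp only: P_eq)
qed

end
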